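(* Constructions I and II restrict to a bijective correspondence between topological conjugacy classes of homeomorphisms on totally disconnected compact metrizable spaces and equivalence classes of $h$-diagrams (via isomorphism and contraction). That is, $[(X,\varphi)]\mapsto[(F,D)]$ (Construction I, using any $\varphi$-refined sequence of partitions) and $[(F,D)]\mapsto[(X,\varphi)]$ (Construction II) are well-defined mutually inverse maps between $\mathsf{Homeo}/\!\sim_{t.c.}$ and $\mathsf{HDiag}/\!\sim_h$.
   Context: **Dynamical systems.** $\mathsf{Homeo}$ is the class of pairs $(X,\varphi)$ with $X$ a nonempty totally disconnected compact metrizable space and $\varphi:X\to X$ a homeomorphism. $(X_1,\varphi_1)\sim_{t.c.}(X_2,\varphi_2)$ means there is a homeomorphism $h:X_1\to X_2$ with $h\circ\varphi_1=\varphi_2\circ h$. **Separated Bratteli diagrams.** A directed graph $E=(E^0,E^1,r,s)$ has vertices $E^0$, edges $E^1$, range and source maps $r,s:E^1\to E^0$. A separated graph $(E,C)$ is a directed graph with $C=\bigsqcup_{v\in E^0}C_v$, where $C_v$ is a partition of $r^{-1}(v)$ into pairwise disjoint nonempty subsets ($C_v=\emptyset$ if $r^{-1}(v)=\emptyset$). A separated Bratteli diagram is a separated graph $(F,D)$ such that $F^0$ is the disjoint union of finite nonempty sets $F^{0,j}$ ($j\ge0$), $F^1$ is the disjoint union of finite nonempty sets $F^{1,j}$, and $r(F^{1,j})=F^{0,j}$, $s(F^{1,j})=F^{0,j+1}$. **$h$-diagrams.** A separated Bratteli diagram $(F,D)$ is an $h$-diagram if: (a) for $n\ge0$, $v\in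 F^{0,n}$, $D_v=\{B_v,R_v\}$ (elements of $B_v$ are blue edges, elements of $R_v$ red edges); (b) for $n\ge0$, $F^{0,n+1}=\bigsqcup_{v\in F^{0,n}}s(B_v)=\bigsqcup_{v\in F^{0,n}}s(R_v)$, and for each $v\in F^{0,n}$ distinct edges of $B_v$ have distinct sources and distinct edges of $R_v$ have distinct sources; (c) for $n\ge0$, $v\in F^{0,n}$, $\bigsqcup_{e\in B_v}s(B_{s(e)})=\bigsqcup_{f\in R_v}s(R_{s(f)})$. $\mathsf{HDiag}$ is the class of $h$-diagrams. **The relation $\sim_h$.** Given integers $0\le m_0<m_1<\cdots$ with $m_0$ even and all $m_{n+1}-m_n$ odd, the contraction $(F',D')$ of an $h$-diagram $(F,D)$ has $(F')^{0,n}=F^{0,m_n}$, blue (resp. red) edges of $(F')^{1,n}$ the tuples $(e_{m_n},\dots,e_{m_{n+1}-1})$ of blue (resp. red) edges $e_i\in F^{1,i}$ with $s(e_i)=r(e_{i+1})$, with range that of the first entry and source that of the last entry, and $D'_v=\{B'_v,R'_v\}$ the sets of blue, red edges with range $v$; it is again an $h$-diagram. An isomorphism of $h$-diagrams is a pair of bijections on vertices and on edges respecting levels, $r$, $s$, and mapping $B_v$ to $B_{\phi(v)}$ and $R_v$ to $R_{\phi(v)}$. $\sim_h$ is the equivalence relation on $\mathsf{HDiag}$ generated by isomorphism and by contraction. (In the paper, $h$-diagrams are a special case of "$l$-diagrams", and $\sim_h$ is the restriction of the analogous relation on $l$-diagrams.) **Refined sequences.** A partition of $X$ is a finite family of nonempty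 pairwise disjoint clopen sets with union $X$. $\mathcal P_1\precsim\mathcal P_2$ means every element of $\mathcal P_2$ is contained in an element of $\mathcal P_1$; $\mathcal P_1\vee\mathcal P_2$ is the family of nonempty intersections; $\operatorname{diam}(\mathcal P)$ is the maximal diameter of elements (for a compatible metric). For a homeomorphism $\varphi$ put $\mathcal P^\varphi=\{\varphi(Z)\mid Z\in\mathcal P\}$ and $\varphi^{-1}(\mathcal P)=\{\varphi^{-1}(Z)\mid Z\in\mathcal P\}$. A sequence $\{\mathcal P_n\}_{n\ge0}$ of partitions is $\varphi$-refined if $\mathcal P_n\precsim\mathcal P_{n+1}$, $\bigcup_n\mathcal P_n$ generates the topology, $\operatorname{diam}(\mathcal P_n)\to0$, and $\mathcal P_{2j}\vee\mathcal P_{2j}^\varphi\precsim\mathcal P_{2j+1}$, $\mathcal P_{2j+1}\vee\varphi^{-1}(\mathcal P_{2j+1})\precsim\mathcal P_{2j+2}$ for all $j\ge0$. **Construction I.** Given a $\varphi$-refined sequence, let $F^{0,n}=\mathcal P_n$. Blue edges in $F^{1,n}$: one edge with source $Z'\in\mathcal P_{n+1}$ and range $Z\in\mathcal P_n$ whenever $Z'\subseteq Z$. Red edges in $F^{1,2j}$: one edge with source $Z'\in\mathcal P_{2j+1}$ and range $Z\in\mathcal P_{2j}$ whenever $Z'\subseteq\varphi(Z)$. Red edges in $F^{1,2j+1}$: one edge with source $Z''\in\mathcal P_{2j+2}$ and range $Z'\in\mathcal P_{2j+1}$ whenever $\varphi(Z'')\subseteq Z'$. $D_Z=\{B_Z,R_Z\}$,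 the sets of blue, red edges with range $Z$. **Construction II.** Given an $h$-diagram $(F,D)$, let $X$ be the set of infinite sequences $(e_0,e_1,\dots)$ of blue edges $e_i\in F^{1,i}$ with $r(e_{i+1})=s(e_i)$, with topology generated by the cylinder sets $Z(e_0,\dots,e_n)$. In an $h$-diagram, for each pair of blue edges $(e_0,e_1)$ with $r(e_1)=s(e_0)$ there is a unique pair of red edges $(f_0,f_1)$ with $r(f_0)=r(e_0)$, $r(f_1)=s(f_0)$, $s(f_1)=s(e_1)$, and conversely each such red pair determines a unique such blue pair; $(e_0,e_1,f_0,f_1)$ is then called a romb. Given $(e_0,e_1,\dots)\in X$, let $(e_{2j},e_{2j+1},f_{2j},f_{2j+1})$ be rombs for $j\ge0$; then let $(e'_{2j-1},e'_{2j},f_{2j-1},f_{2j})$ be rombs for $j\ge1$, and let $e'_0$ be the unique blue edge with $s(e'_0)=r(e'_1)$. Then $\varphi(e_0,e_1,\dots):=(e'_0,e'_1,\dots)$. *)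

theory Defs
  imports "HOL-Analysis.Analysis" "HOL-Library.Disjoint_Sets"
begin

section \<open>Dynamical systems\<close>

text \<open>The map of a system is only meaningful on the underlying space; its values elsewhere are
  ignored throughout.\<close>

type_synonym 'a system = "'a topology \<times> ('a \<Rightarrow> 'a)"

definition totally_disconnected_space :: "'a topology \<Rightarrow> bool" where
  "totally_disconnected_space X \<longleftrightarrow> (\<forall>S. connectedin X S \<longrightarrow> (\<exists>a. S \<subseteq> {a}))"

definition Homeo :: "'a system set" where
  "Homeo = {(X, \<phi>). topspace X \<noteq> {} \<and> totally_disconnected_space X \<and> compact_space X \<and>
     metrizable_space X \<and> homeomorphic_map X X \<phi>}"

definition top_conj :: "'a system \<Rightarrow> 'b system \<Rightarrow> bool" (infix "\<sim>tc" 50) where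
  "S \<sim>tc T \<longleftrightarrow> (case S of (X, \<phi>) \<Rightarrow> case T of (Y, \<psi>) \<Rightarrow>
     \<exists>h. homeomorphic_map X Y h \<and> (\<forall>x \<in> topspace X. h (\<phi> x) = \<psi> (h x)))"


section \<open>Separated Bratteli diagrams and h-diagrams\<close>

definition separated_graph ::
  "'v set \<Rightarrow> 'e set \<Rightarrow> ('e \<Rightarrow> 'v) \<Rightarrow> ('e \<Rightarrow> 'v) \<Rightarrow> ('v \<Rightarrow> 'e set set) \<Rightarrow> bool" where
  "separated_graph V E r s C \<longleftrightarrow>
     r ` E \<subseteq> V \<and> s ` E \<subseteq> V \<and> (\<forall>v \<in> V. partition_on {e \<in> E. r e = v} (C v))"

definition separated_bratteli_diagram ::
  "(nat \<Rightarrow> 'v set) \<Rightarrow> (nat \<Rightarrow> 'e set) \<Rightarrow> ('e \<Rightarrow> 'v) \<Rightarrow> ('e \<Rightarrow> 'v) \<Rightarrow> ('v \<Rightarrow> 'e set set) \<Rightarrow> bool" where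
  "separated_bratteli_diagram V E r s D \<longleftrightarrow>
     separated_graph (\<Union>n. V n) (\<Union>n. E n) r s D \<and>
     disjoint_family V \<and> disjoint_family E \<and>
     (\<forall>n. finite (V n) \<and> V n \<noteq> {} \<and> finite (E n) \<and> E n \<noteq> {} \<and>
          r ` E n = V n \<and> s ` E n = V (Suc n))"

text \<open>The data of an h-diagram: levels of vertices and of edges, range, source, and the two
  colour classes of edges with a given range. The separation is \<open>D v = {blue F v, red F v}\<close>.\<close>

record ('v, 'e) diagram =
  vert :: "nat \<Rightarrow> 'v set"
  edge :: "nat \<Rightarrow> 'e set"
  rng  :: "'e \<Rightarrow> 'v"
  src  :: "'e \<Rightarrow> 'v"
  blue :: "'v \<Rightarrow> 'e set"
  red  :: "'v \<Rightarrow> 'e set"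

definition is_disjoint_union :: "'a set \<Rightarrow> ('i \<Rightarrow> 'a set) \<Rightarrow> 'i set \<Rightarrow> bool" where
  "is_disjoint_union A f I \<longleftrightarrow> disjoint_family_on f I \<and> A = (\<Union>i \<in> I. f i)"

text \<open>The requirement \<open>blue F v \<noteq> red F v\<close> says that the two blocks of the partition are
  distinct, so that no edge is both blue and red.\<close>

definition HDiag :: "('v, 'e) diagram set" where
  "HDiag = {F.
     separated_bratteli_diagram (vert F) (edge F) (rng F) (src F) (\<lambda>v. {blue F v, red F v}) \<and>
     (\<forall>n. \<forall>v \<in> vert F n. blue F v \<noteq> red F v) \<and>
     (\<forall>n. is_disjoint_union (vert F (Suc n)) (\<lambda>v. src F ` blue F v) (vert F n) \<and>
          is_disjoint_union (vert F (Suc n)) (\<lambda>v. src F ` red F v) (vert F n) \<and>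
          (\<forall>v \<in> vert F n. inj_on (src F) (blue F v) \<and> inj_on (src F) (red F v))) \<and>
     (\<forall>n. \<forall>v \<in> vert F n. \<exists>A.
          is_disjoint_union A (\<lambda>e. src F ` blue F (src F e)) (blue F v) \<and>
          is_disjoint_union A (\<lambda>f. src F ` red F (src F f)) (red F v))}"


section \<open>Isomorphism, contraction and the generated equivalence relation\<close>

definition diagram_iso :: "('v, 'e) diagram \<Rightarrow> ('w, 'f) diagram \<Rightarrow> bool" (infix "\<cong>h" 50) where
  "F \<cong>h G \<longleftrightarrow> (\<exists>p q.
     bij_betw p (\<Union>n. vert F n) (\<Union>n. vert G n) \<and> bij_betw q (\<Union>n. edge F n) (\<Union>n. edge G n) \<and>
     (\<forall>n. p ` vert F n = vert G n \<and> q ` edge F n = edge G n) \<and>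
     (\<forall>n. \<forall>e \<in> edge F n. p (rng F e) = rng G (q e) \<and> p (src F e) = src G (q e)) \<and>
     (\<forall>n. \<forall>v \<in> vert F n. q ` blue F v = blue G (p v) \<and> q ` red F v = red G (p v)))"

definition blue_edges :: "('v, 'e) diagram \<Rightarrow> nat \<Rightarrow> 'e set" where
  "blue_edges F n = {e \<in> edge F n. e \<in> blue F (rng F e)}"

definition red_edges :: "('v, 'e) diagram \<Rightarrow> nat \<Rightarrow> 'e set" where
  "red_edges F n = {e \<in> edge F n. e \<in> red F (rng F e)}"

text \<open>Composable tuples \<open>(e\<^sub>a, \<dots>, e\<^sub>b\<^sub>-\<^sub>1)\<close> with \<open>e\<^sub>i \<in> K i\<close>, as lists.\<close>

definition tuples :: "('v, 'e) diagram \<Rightarrow> (nat \<Rightarrow> 'e set) \<Rightarrow> nat \<Rightarrow> nat \<Rightarrow> 'e list set" where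
  "tuples F K a b = {es. length es = b - a \<and> (\<forall>i < length es. es ! i \<in> K (a + i)) \<and>
     (\<forall>i. Suc i < length es \<longrightarrow> src F (es ! i) = rng F (es ! Suc i))}"

definition contraction_seq :: "(nat \<Rightarrow> nat) \<Rightarrow> bool" where
  "contraction_seq m \<longleftrightarrow> strict_mono m \<and> even (m 0) \<and> (\<forall>n. odd (m (Suc n) - m n))"

definition contraction :: "('v, 'e) diagram \<Rightarrow> (nat \<Rightarrow> nat) \<Rightarrow> ('v, 'e list) diagram" where
  "contraction F m =
     (let Bl = (\<lambda>n. tuples F (blue_edges F) (m n) (m (Suc n)));
          Rd = (\<lambda>n. tuples F (red_edges F) (m n) (m (Suc n)))
      in \<lparr> vert = (\<lambda>n. vert F (m n)),
           edge = (\<lambda>n. Bl n \<union> Rd n),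
           rng = (\<lambda>es. rng F (hd es)),
           src = (\<lambda>es. src F (last es)),
           blue = (\<lambda>v. {es \<in> (\<Union>n. Bl n). rng F (hd es) = v}),
           red = (\<lambda>v. {es \<in> (\<Union>n. Rd n). rng F (hd es) = v}) \<rparr>)"

text \<open>The relation generated by isomorphism and contraction has to be formed inside one type.
  Since every h-diagram has countably many vertices and edges, it is isomorphic to one on
  natural numbers, so the equivalence relation is generated there and then transported along
  isomorphisms to diagrams over arbitrary types.\<close>

definition h_step :: "(nat, nat) diagram \<Rightarrow> (nat, nat) diagram \<Rightarrow> bool" where
  "h_step F G \<longleftrightarrow> F \<in> HDiag \<and> G \<in> HDiag \<and>
     (F \<cong>h G \<or> (\<exists>m. contraction_seq m \<and> contraction F m \<cong>h G))"

definition h_equiv :: "('v, 'e) diagram \<Rightarrow> ('w, 'f) diagram \<Rightarrow> bool" (infix "\<sim>h" 50) where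
  "F \<sim>h G \<longleftrightarrow> F \<in> HDiag \<and> G \<in> HDiag \<and>
     (\<exists>F' \<in> HDiag. \<exists>G' \<in> HDiag. F \<cong>h F' \<and> equivclp h_step F' G' \<and> G' \<cong>h G)"


section \<open>Refined sequences of partitions\<close>

definition clopen_partition :: "'a topology \<Rightarrow> 'a set set \<Rightarrow> bool" where
  "clopen_partition X P \<longleftrightarrow>
     finite P \<and> partition_on (topspace X) P \<and> (\<forall>Z \<in> P. openin X Z \<and> closedin X Z)"

definition coarser :: "'a set set \<Rightarrow> 'a set set \<Rightarrow> bool" (infix "\<precsim>" 50) where
  "P \<precsim> Q \<longleftrightarrow> (\<forall>Z \<in> Q. \<exists>W \<in> P. Z \<subseteq> W)"

definition join :: "'a set set \<Rightarrow> 'a set set \<Rightarrow> 'a set set" where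
  "join P Q = {Z \<inter> W | Z W. Z \<in> P \<and> W \<in> Q \<and> Z \<inter> W \<noteq> {}}"

definition image_part :: "('a \<Rightarrow> 'a) \<Rightarrow> 'a set set \<Rightarrow> 'a set set" where
  "image_part \<phi> P = {\<phi> ` Z | Z. Z \<in> P}"

definition preimage_part :: "'a system \<Rightarrow> 'a set set \<Rightarrow> 'a set set" where
  "preimage_part S P = {{x \<in> topspace (fst S). snd S x \<in> Z} | Z. Z \<in> P}"

definition set_diam :: "('a \<Rightarrow> 'a \<Rightarrow> real) \<Rightarrow> 'a set \<Rightarrow> real" where
  "set_diam d Z = (SUP (x, y) \<in> Z \<times> Z. d x y)"

definition part_diam :: "('a \<Rightarrow> 'a \<Rightarrow> real) \<Rightarrow> 'a set set \<Rightarrow> real" where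
  "part_diam d P = Max (set_diam d ` P)"

definition refined_seq :: "'a system \<Rightarrow> (nat \<Rightarrow> 'a set set) \<Rightarrow> bool" where
  "refined_seq S P \<longleftrightarrow> (case S of (X, \<phi>) \<Rightarrow>
     (\<forall>n. clopen_partition X (P n)) \<and>
     (\<forall>n. P n \<precsim> P (Suc n)) \<and>
     X = topology_generated_by (\<Union>n. P n) \<and>
     (\<exists>d. Metric_space (topspace X) d \<and> Metric_space.mtopology (topspace X) d = X \<and>
          (\<lambda>n. part_diam d (P n)) \<longlonglongrightarrow> 0) \<and>
     (\<forall>j. join (P (2*j)) (image_part \<phi> (P (2*j))) \<precsim> P (2*j + 1)) \<and>
     (\<forall>j. join (P (2*j + 1)) (preimage_part (X, \<phi>) (P (2*j + 1))) \<precsim> P (2*j + 2)))"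


section \<open>Construction I: from systems to h-diagrams\<close>

datatype colour = Blue | Red

text \<open>A set may belong to several of the partitions \<open>P n\<close>, so vertices are tagged with their
  level. The edge \<open>(c, n, W, Z)\<close> has colour \<open>c\<close>, source \<open>W \<in> P (Suc n)\<close> and range \<open>Z \<in> P n\<close>.\<close>

definition edge_set_I :: "'a system \<Rightarrow> (nat \<Rightarrow> 'a set set) \<Rightarrow> colour \<Rightarrow> nat \<Rightarrow>
    (colour \<times> nat \<times> 'a set \<times> 'a set) set" where
  "edge_set_I S P c n = {(c, n, W, Z) | W Z. W \<in> P (Suc n) \<and> Z \<in> P n \<and>
     (case c of Blue \<Rightarrow> W \<subseteq> Z
              | Red \<Rightarrow> if even n then W \<subseteq> snd S ` Z else snd S ` W \<subseteq> Z)}"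

definition construction_I :: "'a system \<Rightarrow> (nat \<Rightarrow> 'a set set) \<Rightarrow>
    (nat \<times> 'a set, colour \<times> nat \<times> 'a set \<times> 'a set) diagram" where
  "construction_I S P =
     (let r = (\<lambda>(c, n, W, Z). (n, Z)) in
      \<lparr> vert = (\<lambda>n. {n} \<times> P n),
        edge = (\<lambda>n. edge_set_I S P Blue n \<union> edge_set_I S P Red n),
        rng = r,
        src = (\<lambda>(c, n, W, Z). (Suc n, W)),
        blue = (\<lambda>v. {e \<in> (\<Union>n. edge_set_I S P Blue n). r e = v}),
        red = (\<lambda>v. {e \<in> (\<Union>n. edge_set_I S P Red n). r e = v}) \<rparr>)"


section \<open>Construction II: from h-diagrams to systems\<close>

definition path_space :: "('v, 'e) diagram \<Rightarrow> (nat \<Rightarrow> 'e) set" where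
  "path_space F = {x. \<forall>i. x i \<in> blue_edges F i \<and> rng F (x (Suc i)) = src F (x i)}"

definition cylinder :: "('v, 'e) diagram \<Rightarrow> 'e list \<Rightarrow> (nat \<Rightarrow> 'e) set" where
  "cylinder F es = {x \<in> path_space F. \<forall>i < length es. x i = es ! i}"

definition path_topology :: "('v, 'e) diagram \<Rightarrow> (nat \<Rightarrow> 'e) topology" where
  "path_topology F =
     topology_generated_by {cylinder F es | n es. es \<in> tuples F (blue_edges F) 0 (Suc n)}"

definition romb :: "('v, 'e) diagram \<Rightarrow> 'e \<Rightarrow> 'e \<Rightarrow> 'e \<Rightarrow> 'e \<Rightarrow> bool" where
  "romb F e0 e1 f0 f1 \<longleftrightarrow>
     {e0, e1} \<subseteq> (\<Union>n. blue_edges F n) \<and> {f0, f1} \<subseteq> (\<Union>n. red_edges F n) \<and>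
     rng F e1 = src F e0 \<and> rng F f1 = src F f0 \<and>
     rng F f0 = rng F e0 \<and> src F f1 = src F e1"

definition path_map_rel :: "('v, 'e) diagram \<Rightarrow> (nat \<Rightarrow> 'e) \<Rightarrow> (nat \<Rightarrow> 'e) \<Rightarrow> bool" where
  "path_map_rel F e e' \<longleftrightarrow> (\<exists>f.
     (\<forall>j. romb F (e (2*j)) (e (2*j + 1)) (f (2*j)) (f (2*j + 1))) \<and>
     (\<forall>j \<ge> 1. romb F (e' (2*j - 1)) (e' (2*j)) (f (2*j - 1)) (f (2*j))) \<and>
     e' 0 \<in> (\<Union>n. blue_edges F n) \<and> src F (e' 0) = rng F (e' 1))"

definition path_map :: "('v, 'e) diagram \<Rightarrow> (nat \<Rightarrow> 'e) \<Rightarrow> (nat \<Rightarrow> 'e)" where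
  "path_map F e = (THE e'. path_map_rel F e e')"

definition construction_II :: "('v, 'e) diagram \<Rightarrow> (nat \<Rightarrow> 'e) system" where
  "construction_II F = (path_topology F, path_map F)"


section \<open>Equivalence classes and the induced maps\<close>

text \<open>The quotients are formed over universes large enough to represent everything up to the
  respective equivalence: \<open>nat \<Rightarrow> nat\<close> for points of spaces, \<open>nat\<close> for vertices and edges.
  The class of an object over an arbitrary type consists of its representatives there.\<close>

type_synonym usystem = "(nat \<Rightarrow> nat) system"
type_synonym udiagram = "(nat, nat) diagram"

definition Homeo_classes :: "usystem set set" where
  "Homeo_classes = Homeo // {(S, T). S \<in> Homeo \<and> T \<in> Homeo \<and> S \<sim>tc T}"

definition HDiag_classes :: "udiagram set set" where
  "HDiag_classes = HDiag // {(F, G). F \<in> HDiag \<and> G \<in> HDiag \<and> F \<sim>h G}"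

definition system_class :: "'a system \<Rightarrow> usystem set" where
  "system_class S = {T \<in> Homeo. S \<sim>tc T}"

definition diagram_class :: "('v, 'e) diagram \<Rightarrow> udiagram set" where
  "diagram_class F = {G \<in> HDiag. F \<sim>h G}"

text \<open>Unions of all classes obtained from arbitrary representatives (and arbitrary refined
  sequences); well-definedness means that each such union is a single class.\<close>

definition class_map_I :: "usystem set \<Rightarrow> udiagram set" where
  "class_map_I \<S> = (\<Union>S \<in> \<S>. \<Union>P \<in> {P. refined_seq S P}. diagram_class (construction_I S P))"

definition class_map_II :: "udiagram set \<Rightarrow> usystem set" where
  "class_map_II \<F> = (\<Union>F \<in> \<F>. system_class (construction_II F))"

end

theory Submission
  imports Defs
begin

text \<open>In an h-diagram every vertex above the bottom level is the source of exactly one blue and one red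
  edge. So an h-diagram is, up to isomorphism, a tower of finite nonempty sets \<open>V n\<close> with two
  families of surjective parent maps \<open>b, \<rho> : V (Suc n) \<Rightarrow> V n\<close>, and condition (c) becomes the law
  \<open>\<rho> \<circ> \<rho> = b \<circ> b\<close> (lemmas \<open>parent_parent\<close> and \<open>HDiagI\<close>). Isomorphisms become level-preserving
  bijections that commute with the parent maps, and a contraction replaces the parent maps by their
  iterates, where an odd red iterate is one \<open>\<rho>\<close> together with an even number of \<open>b\<close>.

  Say that a diagram \<open>F\<close> belongs to a system \<open>S\<close> if \<open>F\<close> is isomorphic to the diagram that
  Construction I makes of some refined sequence of \<open>S\<close>. The theorem rests on five facts about this
  relation.

  \<^item> Every system has a diagram (\<open>refined_seq_exists\<close>): join partitions with their images under
    \<open>\<phi>\<close> or its inverse and with finer and finer clopen partitions.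
  \<^item> Every diagram belongs to the system of Construction II (\<open>iso_construction_I_II\<close>). A path is
    determined by its vertices, and on vertices the map of Construction II is \<open>\<rho>\<close> from the even to
    the odd levels. The sets of paths through the vertices of level \<open>n\<close>, for \<open>n = 0, 1, ...\<close>,
    are a refined sequence that gives back the diagram.
  \<^item> Two systems with a common diagram are conjugate (\<open>conj_if_iso\<close>), because points are nested
    sequences of cells: the blue edges describe the nesting, and the red edges determine the map.
  \<^item> A contraction of a diagram of \<open>S\<close> belongs to \<open>S\<close> as well, namely to a subsequence of the refined
    sequence (\<open>contraction_subseq\<close>).
  \<^item> Two diagrams of conjugate systems are equivalent (\<open>h_equiv_if_conj\<close>). By compactness, late
    partitions of one sequence refine any given partition of the other. So both sequences share
    subsequences with a third refined sequence, and the previous fact applies to it.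

  Hence a single step of \<open>\<sim>h\<close> does not change the system up to conjugacy, and both constructions
  are well defined on classes. They are mutually inverse, since passing from \<open>F\<close> to its system and
  to any diagram of that system stays in the class of \<open>F\<close>, and passing from \<open>S\<close> to a diagram and to
  the system of that diagram stays in the class of \<open>S\<close>. Diagrams are countable and
  therefore have copies on the natural numbers, and so every system has a copy on sequences of
  natural numbers.\<close>

section \<open>h-diagrams as towers of finite sets with two parent maps\<close>

definition coloured_edges :: "('v, 'e) diagram \<Rightarrow> colour \<Rightarrow> nat \<Rightarrow> 'e set" where
  "coloured_edges F c n = (case c of Blue \<Rightarrow> blue_edges F n | Red \<Rightarrow> red_edges F n)"

definition parent_edge :: "('v, 'e) diagram \<Rightarrow> colour \<Rightarrow> nat \<Rightarrow> 'v \<Rightarrow> 'e" where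
  "parent_edge F c n = inv_into (coloured_edges F c n) (src F)"

definition parent :: "('v, 'e) diagram \<Rightarrow> colour \<Rightarrow> nat \<Rightarrow> 'v \<Rightarrow> 'v" where
  "parent F c n w = rng F (parent_edge F c n w)"

lemma coloured_edges_simps [simp]:
  "coloured_edges F Blue = blue_edges F" "coloured_edges F Red = red_edges F"
  by (simp_all add: coloured_edges_def fun_eq_iff)

lemma disjoint_familyD: "disjoint_family A \<Longrightarrow> x \<in> A m \<Longrightarrow> x \<in> A n \<Longrightarrow> m = n"
  by (auto simp: disjoint_family_on_def)

lemma HDiag_vert:
  assumes "F \<in> HDiag"
  shows "finite (vert F n)" "vert F n \<noteq> {}" "disjoint_family (vert F)" "disjoint_family (edge F)"
    "rng F ` edge F n = vert F n" "src F ` edge F n = vert F (Suc n)"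
  using assms by (auto simp: HDiag_def separated_bratteli_diagram_def)

lemma HDiag_partition:
  assumes "F \<in> HDiag" "v \<in> vert F n"
  shows "blue F v \<union> red F v = {e \<in> edge F n. rng F e = v}" "blue F v \<inter> red F v = {}"
    "blue F v \<noteq> {}" "red F v \<noteq> {}"
proof -
  have *: "partition_on {e \<in> (\<Union>n. edge F n). rng F e = v} {blue F v, red F v}"
    and ne: "blue F v \<noteq> red F v"
    using assms by (auto simp: HDiag_def separated_bratteli_diagram_def separated_graph_def)
  have "{e \<in> (\<Union>n. edge F n). rng F e = v} = {e \<in> edge F n. rng F e = v}"
    using disjoint_familyD[OF HDiag_vert(3)[OF assms(1)]] HDiag_vert(5)[OF assms(1)] assms(2)
    by blast
  then have "\<Union>{blue F v, red F v} = {e \<in> edge F n. rng F e = v}"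
    using partition_onD1[OF *] by simp
  then show "blue F v \<union> red F v = {e \<in> edge F n. rng F e = v}" by simp
  show "blue F v \<inter> red F v = {}"
    using partition_onD2[OF *] ne by (simp add: disjoint_def)
  show "blue F v \<noteq> {}" "red F v \<noteq> {}"
    using partition_onD3[OF *] by auto
qed

lemma HDiag_blue:
  assumes "F \<in> HDiag" "v \<in> vert F n"
  shows "blue F v = {e \<in> blue_edges F n. rng F e = v}"
proof -
  have "e \<in> edge F n \<and> rng F e = v" if "e \<in> blue F v" for e
    using HDiag_partition(1)[OF assms] that by (metis (mono_tags, lifting) UnCI mem_Collect_eq)
  then show ?thesis unfolding blue_edges_def by auto
qed

lemma HDiag_red:
  assumes "F \<in> HDiag" "v \<in> vert F n"
  shows "red F v = {e \<in> red_edges F n. rng F e = v}"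
proof -
  have "e \<in> edge F n \<and> rng F e = v" if "e \<in> red F v" for e
    using HDiag_partition(1)[OF assms] that by (metis (mono_tags, lifting) UnCI mem_Collect_eq)
  then show ?thesis unfolding red_edges_def by auto
qed

lemma HDiag_edge:
  assumes "F \<in> HDiag"
  shows "edge F n = blue_edges F n \<union> red_edges F n"
proof -
  have "e \<in> blue F (rng F e) \<union> red F (rng F e)" if "e \<in> edge F n" for e
  proof -
    have "rng F e \<in> vert F n" using that HDiag_vert(5)[OF assms] by blast
    from HDiag_partition(1)[OF assms this] that show ?thesis by blast
  qed
  then show ?thesis by (auto simp: blue_edges_def red_edges_def)
qed

lemma HDiag_disjoint:
  assumes "F \<in> HDiag"
  shows "blue_edges F n \<inter> red_edges F n = {}"
proof -
  have False if "e \<in> edge F n" "e \<in> blue F (rng F e)" "e \<in> red F (rng F e)" for e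
  proof -
    have "rng F e \<in> vert F n" using that HDiag_vert(5)[OF assms] by blast
    from HDiag_partition(2)[OF assms this] that show ?thesis by blast
  qed
  then show ?thesis by (auto simp: blue_edges_def red_edges_def)
qed

lemma coloured_edges_subset: "coloured_edges F c n \<subseteq> edge F n"
  by (cases c) (auto simp: blue_edges_def red_edges_def)

text \<open>By condition (b) the sources of the edges of one colour exhaust the next level without
  repetition, so every vertex above the bottom level is the source of exactly one edge of each
  colour. This is what makes the parent maps meaningful.\<close>

lemma HDiag_bij:
  assumes "F \<in> HDiag"
  shows "bij_betw (src F) (coloured_edges F c n) (vert F (Suc n))"
proof -
  have aux: "bij_betw (src F) (\<Union>v\<in>vert F n. K v) (vert F (Suc n))"
    if "is_disjoint_union (vert F (Suc n)) (\<lambda>v. src F ` K v) (vert F n)"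
      "\<forall>v\<in>vert F n. inj_on (src F) (K v)" for K
    unfolding bij_betw_def
  proof
    show "inj_on (src F) (\<Union>v\<in>vert F n. K v)"
    proof (rule inj_onI)
      fix x y assume "x \<in> (\<Union>v\<in>vert F n. K v)" "y \<in> (\<Union>v\<in>vert F n. K v)" and eq: "src F x = src F y"
      then obtain v w where *: "v \<in> vert F n" "w \<in> vert F n" "x \<in> K v" "y \<in> K w" by blast
      then have "v = w" using that(1) eq
        unfolding is_disjoint_union_def disjoint_family_on_def by blast
      with * that(2) eq show "x = y" by (meson inj_onD)
    qed
    show "src F ` (\<Union>v\<in>vert F n. K v) = vert F (Suc n)"
      using that(1) by (auto simp: is_disjoint_union_def)
  qed
  have r: "rng F e \<in> vert F n" if "e \<in> edge F n" for e
    using that HDiag_vert(5)[OF assms] by blast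
  have "blue_edges F n = (\<Union>v\<in>vert F n. blue F v)" "red_edges F n = (\<Union>v\<in>vert F n. red F v)"
    using HDiag_blue[OF assms] HDiag_red[OF assms] r
    by (auto simp: blue_edges_def red_edges_def)
  then show ?thesis
    using assms by (cases c) (auto simp: HDiag_def intro!: aux)
qed

lemma HDiag_rng:
  assumes "F \<in> HDiag"
  shows "rng F ` coloured_edges F c n = vert F n"
proof
  show "rng F ` coloured_edges F c n \<subseteq> vert F n"
    unfolding HDiag_vert(5)[OF assms, symmetric] by (rule image_mono[OF coloured_edges_subset])
  show "vert F n \<subseteq> rng F ` coloured_edges F c n"
  proof
    fix v assume v: "v \<in> vert F n"
    from HDiag_partition(3,4)[OF assms v] show "v \<in> rng F ` coloured_edges F c n"
      unfolding HDiag_blue[OF assms v] HDiag_red[OF assms v]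
      by (cases c) (simp_all add: image_iff, metis+)
  qed
qed

lemma coloured_edge_src_rng:
  assumes "F \<in> HDiag" "e \<in> coloured_edges F c n"
  shows "src F e \<in> vert F (Suc n)" "rng F e \<in> vert F n"
  using assms HDiag_rng[of F c n] HDiag_bij[of F c n] by (auto simp: bij_betw_def)

lemma coloured_edge_unique:
  assumes "F \<in> HDiag" "e \<in> coloured_edges F c n" "f \<in> coloured_edges F c n" "src F e = src F f"
  shows "e = f"
  using assms HDiag_bij[of F c n] by (meson bij_betw_def inj_onD)

lemma parent_edge:
  assumes "F \<in> HDiag" "w \<in> vert F (Suc n)"
  shows "parent_edge F c n w \<in> coloured_edges F c n" "src F (parent_edge F c n w) = w"
  using assms HDiag_bij[of F c n] unfolding parent_edge_def
  by (auto simp: bij_betw_def inv_into_into f_inv_into_f)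

lemma parent_edge_eqI:
  assumes "F \<in> HDiag" "e \<in> coloured_edges F c n" "src F e = w"
  shows "parent_edge F c n w = e"
proof -
  have w: "w \<in> vert F (Suc n)" using coloured_edge_src_rng(1)[OF assms(1,2)] assms(3) by simp
  show ?thesis
    using coloured_edge_unique[OF assms(1) parent_edge(1)[OF assms(1) w] assms(2)]
      parent_edge(2)[OF assms(1) w] assms(3) by simp
qed

lemma parent_eqI:
  assumes "F \<in> HDiag" "e \<in> coloured_edges F c n" "src F e = w" "rng F e = v"
  shows "parent F c n w = v"
  using parent_edge_eqI[OF assms(1-3)] assms(4) by (simp add: parent_def)

lemma parent_vert:
  assumes "F \<in> HDiag" "w \<in> vert F (Suc n)"
  shows "parent F c n w \<in> vert F n"
  unfolding parent_def using parent_edge[OF assms] coloured_edge_src_rng[OF assms(1)] by blast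

lemma parent_surj:
  assumes "F \<in> HDiag" "v \<in> vert F n"
  obtains w where "w \<in> vert F (Suc n)" "parent F c n w = v"
proof -
  obtain e where e: "e \<in> coloured_edges F c n" "rng F e = v"
    using assms(2) unfolding HDiag_rng[OF assms(1), of c n, symmetric] by auto
  show thesis
    using that[of "src F e"] coloured_edge_src_rng(1)[OF assms(1) e(1)]
      parent_eqI[OF assms(1) e(1) refl e(2)] by blast
qed

text \<open>This is condition (c) in the language of parent maps: over a vertex \<open>w\<close> two levels up there
  is exactly one blue pair and one red pair of edges, and the condition says that both pairs lie
  over the same vertex.\<close>

lemma parent_parent:
  assumes "F \<in> HDiag" "w \<in> vert F (Suc (Suc n))"
  shows "parent F Red n (parent F Red (Suc n) w) = parent F Blue n (parent F Blue (Suc n) w)"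
proof -
  let ?w1 = "parent F Blue (Suc n) w" let ?v = "parent F Blue n ?w1"
  have w1: "?w1 \<in> vert F (Suc n)" and v: "?v \<in> vert F n"
    using parent_vert assms by metis+
  obtain A where A: "is_disjoint_union A (\<lambda>e. src F ` blue F (src F e)) (blue F ?v)"
          "is_disjoint_union A (\<lambda>f. src F ` red F (src F f)) (red F ?v)"
    using assms v unfolding HDiag_def by blast
  let ?e = "parent_edge F Blue n ?w1" let ?e1 = "parent_edge F Blue (Suc n) w"
  have "?e \<in> blue F ?v"
    using parent_edge[OF assms(1) w1, of Blue] unfolding HDiag_blue[OF assms(1) v]
    by (simp add: parent_def)
  moreover have "?e1 \<in> blue F (src F ?e)" "src F ?e1 = w"
    using parent_edge[OF assms(1) w1, of Blue] parent_edge[OF assms, of Blue]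
      HDiag_blue[OF assms(1) w1]
    by (simp_all add: parent_def)
  ultimately have "w \<in> (\<Union>e\<in>blue F ?v. src F ` blue F (src F e))"
    by (intro UN_I[of ?e] image_eqI[of _ _ ?e1]) simp_all
  then have "w \<in> (\<Union>f\<in>red F ?v. src F ` red F (src F f))"
    using A unfolding is_disjoint_union_def by argo
  then obtain f f1 where f: "f \<in> red F ?v" "f1 \<in> red F (src F f)" "src F f1 = w" by auto
  then have fe: "f \<in> red_edges F n" "rng F f = ?v" unfolding HDiag_red[OF assms(1) v] by simp_all
  then have "src F f \<in> vert F (Suc n)" using coloured_edge_src_rng[OF assms(1), of f Red] by simp
  from f(2) have "f1 \<in> red_edges F (Suc n)" "rng F f1 = src F f"
    unfolding HDiag_red[OF assms(1) \<open>src F f \<in> vert F (Suc n)\<close>] by simp_all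
  then have "parent F Red (Suc n) w = src F f"
    using parent_eqI[OF assms(1), of f1 Red] f by auto
  then show ?thesis using parent_eqI[OF assms(1), of f Red] fe by auto
qed

text \<open>Conversely, two colours whose edges are bijective with the next level by source and satisfy the
  law of condition (c) make an h-diagram. The copies on the natural numbers, the contractions and the
  results of Construction I are all recognised as h-diagrams in this way.\<close>

lemma HDiagI:
  assumes fin: "\<And>n. finite (vert F n)" and ne: "\<And>n. vert F n \<noteq> {}"
    and dV: "disjoint_family (vert F)" and dE: "disjoint_family (edge F)"
    and edge: "\<And>n. edge F n = blue_edges F n \<union> red_edges F n"
    and dis: "\<And>n. blue_edges F n \<inter> red_edges F n = {}"
    and blue: "\<And>n v. v \<in> vert F n \<Longrightarrow> blue F v = {e \<in> blue_edges F n. rng F e = v}"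
    and red: "\<And>n v. v \<in> vert F n \<Longrightarrow> red F v = {e \<in> red_edges F n. rng F e = v}"
    and bij: "\<And>c n. bij_betw (src F) (coloured_edges F c n) (vert F (Suc n))"
    and rng: "\<And>c n. rng F ` coloured_edges F c n = vert F n"
    and comm: "\<And>n e0 e1 f0 f1. e0 \<in> blue_edges F n \<Longrightarrow> e1 \<in> blue_edges F (Suc n) \<Longrightarrow>
       f0 \<in> red_edges F n \<Longrightarrow> f1 \<in> red_edges F (Suc n) \<Longrightarrow> rng F e1 = src F e0 \<Longrightarrow>
       rng F f1 = src F f0 \<Longrightarrow> src F f1 = src F e1 \<Longrightarrow> rng F f0 = rng F e0"
  shows "F \<in> HDiag"
proof -
  note bijB = bij[of Blue, simplified] and bijR = bij[of Red, simplified]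
  note rngB = rng[of Blue, simplified] and rngR = rng[of Red, simplified]
  have injB: "e = f" if "e \<in> blue_edges F n" "f \<in> blue_edges F n" "src F e = src F f" for e f n
    using bijB[of n] that by (meson bij_betw_def inj_onD)
  have injR: "e = f" if "e \<in> red_edges F n" "f \<in> red_edges F n" "src F e = src F f" for e f n
    using bijR[of n] that by (meson bij_betw_def inj_onD)
  have sB: "src F e \<in> vert F (Suc n)" if "e \<in> blue_edges F n" for e n
    using bijB[of n] that by (auto simp: bij_betw_def)
  have sR: "src F e \<in> vert F (Suc n)" if "e \<in> red_edges F n" for e n
    using bijR[of n] that by (auto simp: bij_betw_def)
  have finE: "finite (edge F n)" for n
    unfolding edge using bijB[of n] bijR[of n] fin by (simp add: bij_betw_finite)
  have rE: "rng F ` edge F n = vert F n" for n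
    unfolding edge image_Un rngB rngR by simp
  have sE: "src F ` edge F n = vert F (Suc n)" for n
    unfolding edge image_Un using bijB[of n] bijR[of n] by (simp add: bij_betw_def)
  have neB: "blue F v \<noteq> {}" "red F v \<noteq> {}" "blue F v \<inter> red F v = {}" if "v \<in> vert F n" for v n
  proof -
    have "v \<in> rng F ` blue_edges F n" "v \<in> rng F ` red_edges F n"
      unfolding rngB rngR by (fact that)+
    then show "blue F v \<noteq> {}" "red F v \<noteq> {}"
      unfolding blue[OF that] red[OF that] by auto
    show "blue F v \<inter> red F v = {}"
      using dis[of n] unfolding blue[OF that] red[OF that] by auto
  qed
  have part: "partition_on {e \<in> (\<Union>n. edge F n). rng F e = v} {blue F v, red F v}"
    if v: "v \<in> vert F n" for v n
  proof -
    have "{e \<in> (\<Union>n. edge F n). rng F e = v} = {e \<in> edge F n. rng F e = v}"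
      using rE v disjoint_familyD[OF dV] by blast
    then show ?thesis using neB[OF v]
      by (auto simp: partition_on_def disjoint_def edge blue[OF v] red[OF v])
  qed
  have C: "\<exists>A. is_disjoint_union A (\<lambda>e. src F ` blue F (src F e)) (blue F v) \<and>
          is_disjoint_union A (\<lambda>f. src F ` red F (src F f)) (red F v)" if v: "v \<in> vert F n" for v n
  proof -
    let ?A = "\<Union>e\<in>blue F v. src F ` blue F (src F e)"
    have djI: "disjoint_family_on (\<lambda>e. src F ` K (src F e)) (K v)"
      if K: "\<And>n v. v \<in> vert F n \<Longrightarrow> K v = {e \<in> E n. rng F e = v}"
        and inj: "\<And>n e f. e \<in> E n \<Longrightarrow> f \<in> E n \<Longrightarrow> src F e = src F f \<Longrightarrow> e = f"
        and s: "\<And>n e. e \<in> E n \<Longrightarrow> src F e \<in> vert F (Suc n)" for K E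
    proof -
      have "e = e'" if "e \<in> E n" "e' \<in> E n" "x \<in> K (src F e)" "x' \<in> K (src F e')"
        "src F x = src F x'" for e e' x x'
      proof -
        have x: "x \<in> E (Suc n)" "x' \<in> E (Suc n)" "rng F x = src F e" "rng F x' = src F e'"
          using that K[OF s[OF that(1)]] K[OF s[OF that(2)]] by auto
        have "x = x'" by (rule inj[OF x(1,2) that(5)])
        with x show ?thesis using inj[OF that(1,2)] by simp
      qed
      then show ?thesis unfolding disjoint_family_on_def K[OF v] by blast
    qed
    have dB: "disjoint_family_on (\<lambda>e. src F ` blue F (src F e)) (blue F v)"
      by (rule djI[OF blue injB sB])
    have dR: "disjoint_family_on (\<lambda>e. src F ` red F (src F e)) (red F v)"
      by (rule djI[OF red injR sR])
    let ?T = "\<lambda>E. {src F e1 |e0 e1. e0 \<in> E F n \<and> e1 \<in> E F (Suc n) \<and> rng F e0 = v \<and> rng F e1 = src F e0}"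
    have union: "(\<Union>e\<in>K v. src F ` K (src F e)) = ?T E"
      if K: "\<And>n v. v \<in> vert F n \<Longrightarrow> K v = {e \<in> E F n. rng F e = v}"
        and s: "\<And>n e. e \<in> E F n \<Longrightarrow> src F e \<in> vert F (Suc n)" for K E
    proof -
      have "(\<Union>e\<in>K v. src F ` K (src F e)) =
        (\<Union>e\<in>{e \<in> E F n. rng F e = v}. src F ` {f \<in> E F (Suc n). rng F f = src F e})"
        unfolding K[OF v] by (intro SUP_cong refl arg_cong[where f = "image (src F)"] K s) simp
      then show ?thesis by auto
    qed
    have sub: "?T E \<subseteq> ?T E'"
      if s: "\<And>n e. e \<in> E F n \<Longrightarrow> src F e \<in> vert F (Suc n)"
        and bijE': "\<And>n. bij_betw (src F) (E' F n) (vert F (Suc n))"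
        and rngE': "\<And>n. rng F ` E' F n = vert F n"
        and c: "\<And>e0 e1 f0 f1. e0 \<in> E F n \<Longrightarrow> e1 \<in> E F (Suc n) \<Longrightarrow> f0 \<in> E' F n \<Longrightarrow>
          f1 \<in> E' F (Suc n) \<Longrightarrow> rng F e1 = src F e0 \<Longrightarrow> rng F f1 = src F f0 \<Longrightarrow>
          src F f1 = src F e1 \<Longrightarrow> rng F f0 = rng F e0" for E E'
    proof
      fix w assume "w \<in> ?T E"
      then obtain e0 e1 where e: "e0 \<in> E F n" "rng F e0 = v" "e1 \<in> E F (Suc n)"
        "rng F e1 = src F e0" "w = src F e1" by blast
      then have "w \<in> vert F (Suc (Suc n))" using s by blast
      then obtain f1 where f1: "f1 \<in> E' F (Suc n)" "src F f1 = w"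
        unfolding bij_betw_imp_surj_on[OF bijE', symmetric] by auto
      have "rng F f1 \<in> src F ` E' F n"
        unfolding bij_betw_imp_surj_on[OF bijE'] rngE'[symmetric] using f1(1) by (rule imageI)
      then obtain f0 where f0: "f0 \<in> E' F n" "src F f0 = rng F f1" by auto
      have "rng F f0 = v" using c[of e0 e1 f0 f1] e f1 f0 by auto
      with f0 f1 show "w \<in> ?T E'" by (intro CollectI exI[of _ f0] exI[of _ f1]) auto
    qed
    have "?T blue_edges = ?T red_edges"
    proof
      show "?T blue_edges \<subseteq> ?T red_edges" by (rule sub[of blue_edges red_edges, OF sB bijR rngR comm])
      show "?T red_edges \<subseteq> ?T blue_edges"
      proof (rule sub[of red_edges blue_edges, OF sR bijB rngB])
        show "rng F f0 = rng F e0" if "e0 \<in> red_edges F n" "e1 \<in> red_edges F (Suc n)"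
          "f0 \<in> blue_edges F n" "f1 \<in> blue_edges F (Suc n)" "rng F e1 = src F e0"
          "rng F f1 = src F f0" "src F f1 = src F e1" for e0 e1 f0 f1
          using comm[of f0 n f1 e0 e1] that by simp
      qed
    qed
    then have "?A = (\<Union>e\<in>red F v. src F ` red F (src F e))"
      using union[of "blue F" blue_edges, OF blue sB] union[of "red F" red_edges, OF red sR] by simp
    then show ?thesis
      unfolding is_disjoint_union_def using dB dR by (intro exI[of _ ?A] conjI refl)
  qed
  have sep: "separated_bratteli_diagram (vert F) (edge F) (rng F) (src F) (\<lambda>v. {blue F v, red F v})"
    unfolding separated_bratteli_diagram_def separated_graph_def
    using fin ne dV dE finE rE sE part by (auto 0 0) blast+
  have ds: "is_disjoint_union (vert F (Suc n)) (\<lambda>v. src F ` blue F v) (vert F n)"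
      "is_disjoint_union (vert F (Suc n)) (\<lambda>v. src F ` red F v) (vert F n)" for n
  proof -
    have "is_disjoint_union (vert F (Suc n)) (\<lambda>v. src F ` K v) (vert F n)"
      if K: "\<And>n v. v \<in> vert F n \<Longrightarrow> K v = {e \<in> E n. rng F e = v}"
        and bijE: "\<And>n. bij_betw (src F) (E n) (vert F (Suc n))"
        and rngE: "\<And>n. rng F ` E n = vert F n" for K E
    proof -
      have inj: "e = f" if "e \<in> E n" "f \<in> E n" "src F e = src F f" for e f
        using bijE[of n] that by (meson bij_betw_def inj_onD)
      have "(\<Union>v\<in>vert F n. src F ` K v) = src F ` E n"
      proof -
        have "(\<Union>v\<in>vert F n. src F ` K v) = (\<Union>v\<in>rng F ` E n. src F ` {e \<in> E n. rng F e = v})"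
          unfolding rngE[of n] using K[of _ n] by simp
        then show ?thesis by auto
      qed
      moreover have "disjoint_family_on (\<lambda>v. src F ` K v) (vert F n)"
        unfolding disjoint_family_on_def using inj by (auto simp: K)
      ultimately show ?thesis
        using bijE[of n] by (simp add: is_disjoint_union_def bij_betw_def)
    qed
    from this[OF blue bijB rngB] this[OF red bijR rngR]
    show "is_disjoint_union (vert F (Suc n)) (\<lambda>v. src F ` blue F v) (vert F n)"
      "is_disjoint_union (vert F (Suc n)) (\<lambda>v. src F ` red F v) (vert F n)" by simp_all
  qed
  have "inj_on (src F) (blue F v) \<and> inj_on (src F) (red F v)" if "v \<in> vert F n" for v n
    using injB injR by (auto simp: inj_on_def blue[OF that] red[OF that])
  moreover have "blue F v \<noteq> red F v" if "v \<in> vert F n" for v n using neB[OF that] by blast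
  ultimately show ?thesis unfolding HDiag_def using sep ds C by blast
qed

section \<open>Isomorphism of h-diagrams in terms of vertices\<close>

definition level_iso ::
  "('v, 'e) diagram \<Rightarrow> ('w, 'f) diagram \<Rightarrow> (nat \<Rightarrow> 'v \<Rightarrow> 'w) \<Rightarrow> bool" where
  "level_iso F G p \<longleftrightarrow> (\<forall>n. bij_betw (p n) (vert F n) (vert G n) \<and>
     (\<forall>c. \<forall>w \<in> vert F (Suc n). p n (parent F c n w) = parent G c n (p (Suc n) w)))"

lemma bij_betw_UN_disjoint:
  assumes "\<And>n. bij_betw f (A n) (B n)" "disjoint_family B"
  shows "bij_betw f (\<Union>n. A n) (\<Union>n. B n)"
  unfolding bij_betw_def
proof
  show "inj_on f (\<Union>n. A n)"
  proof (rule inj_onI)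
    fix x y assume "x \<in> (\<Union>n. A n)" "y \<in> (\<Union>n. A n)" and eq: "f x = f y"
    then obtain m n where mn: "x \<in> A m" "y \<in> A n" by blast
    then have "f x \<in> B m" "f y \<in> B n" using assms(1) by (meson bij_betwE)+
    with eq have "m = n" using disjoint_familyD[OF assms(2)] by metis
    with mn eq show "x = y" using assms(1)[of n] by (auto simp: bij_betw_def dest: inj_onD)
  qed
  show "f ` (\<Union>n. A n) = (\<Union>n. B n)"
    using assms(1) by (simp add: image_UN bij_betw_def)
qed

text \<open>An isomorphism preserves sources, ranges and colours, hence it maps the parent edge of a vertex
  to the parent edge of its image.\<close>

lemma level_iso_if_iso:
  assumes F: "F \<in> HDiag" and G: "G \<in> HDiag" and "F \<cong>h G"
  obtains p where "level_iso F G p"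
proof -
  obtain p q where p: "bij_betw p (\<Union>n. vert F n) (\<Union>n. vert G n)"
     and im': "\<forall>n. p ` vert F n = vert G n \<and> q ` edge F n = edge G n"
     and rs': "\<forall>n. \<forall>e\<in>edge F n. p (rng F e) = rng G (q e) \<and> p (src F e) = src G (q e)"
     and br': "\<forall>n. \<forall>v\<in>vert F n. q ` blue F v = blue G (p v) \<and> q ` red F v = red G (p v)"
    using \<open>F \<cong>h G\<close> unfolding diagram_iso_def by auto
  have im: "p ` vert F n = vert G n" for n using im' by simp
  have rs: "p (rng F e) = rng G (q e)" "p (src F e) = src G (q e)" if "e \<in> edge F n" for e n
    using rs' that by blast+
  have br: "q ` blue F v = blue G (p v)" "q ` red F v = red G (p v)" if "v \<in> vert F n" for v n
    using br' that by blast+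
  have "bij_betw p (vert F n) (vert G n)" for n
    by (rule bij_betw_subset[OF p UN_upper[OF UNIV_I] im])
  moreover have "p (parent F c n w) = parent G c n (p w)" if w: "w \<in> vert F (Suc n)" for c n w
  proof -
    let ?e = "parent_edge F c n w"
    note e = parent_edge[OF F w, of c]
    have eE: "?e \<in> edge F n" using e(1) coloured_edges_subset by (rule subsetD[rotated])
    have v: "rng F ?e \<in> vert F n" using coloured_edge_src_rng(2)[OF F e(1)] .
    then have pv: "p (rng F ?e) \<in> vert G n" unfolding im[symmetric] by (rule imageI)
    have "q ?e \<in> coloured_edges G c n"
    proof (cases c)
      case Blue
      with e(1) have "?e \<in> blue F (rng F ?e)" unfolding HDiag_blue[OF F v] by simp
      then have "q ?e \<in> blue G (p (rng F ?e))" using br[OF v] by blast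
      then show ?thesis unfolding HDiag_blue[OF G pv] using Blue by simp
    next
      case Red
      with e(1) have "?e \<in> red F (rng F ?e)" unfolding HDiag_red[OF F v] by simp
      then have "q ?e \<in> red G (p (rng F ?e))" using br[OF v] by blast
      then show ?thesis unfolding HDiag_red[OF G pv] using Red by simp
    qed
    from parent_eqI[OF G this, of "p w" "p (parent F c n w)"] rs[OF eE] e(2)
    show ?thesis by (simp add: parent_def)
  qed
  ultimately show thesis by (intro that[of "\<lambda>_. p"]) (simp add: level_iso_def)
qed

text \<open>Since every vertex above the bottom level is the source of exactly one edge of each colour,
  the map on edges is forced by the map on vertices.\<close>

lemma iso_if_level_iso:
  assumes F: "F \<in> HDiag" and G: "G \<in> HDiag" and p: "level_iso F G p"
  shows "F \<cong>h G"
proof -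
  have pbij: "bij_betw (p n) (vert F n) (vert G n)"
    and pc: "w \<in> vert F (Suc n) \<Longrightarrow> p n (parent F c n w) = parent G c n (p (Suc n) w)" for n c w
    using p by (auto simp: level_iso_def)
  define p' where "p' v = p (THE n. v \<in> vert F n) v" for v
  have p': "p' v = p n v" if "v \<in> vert F n" for v n
  proof -
    have "(THE n. v \<in> vert F n) = n"
      using that disjoint_familyD[OF HDiag_vert(3)[OF F]] by (intro the_equality)
    then show ?thesis by (simp add: p'_def)
  qed
  define q where "q e = (let n = (THE n. e \<in> edge F n) in
      parent_edge G (if e \<in> blue_edges F n then Blue else Red) n (p (Suc n) (src F e)))" for e
  have q: "q e = parent_edge G c n (p (Suc n) (src F e))" if "e \<in> coloured_edges F c n" for e c n
  proof -
    have "e \<in> edge F n" using that coloured_edges_subset by (rule subsetD[rotated])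
    then have "(THE n. e \<in> edge F n) = n"
      using disjoint_familyD[OF HDiag_vert(4)[OF F]] by (intro the_equality)
    moreover have "(if e \<in> blue_edges F n then Blue else Red) = c"
      using that HDiag_disjoint[OF F, of n] by (cases c) auto
    ultimately show ?thesis by (simp add: q_def)
  qed
  have qbij: "bij_betw q (coloured_edges F c n) (coloured_edges G c n)" for c n
  proof -
    have "bij_betw (parent_edge G c n) (vert G (Suc n)) (coloured_edges G c n)"
      unfolding parent_edge_def by (rule bij_betw_inv_into[OF HDiag_bij[OF G]])
    from bij_betw_trans[OF bij_betw_trans[OF HDiag_bij[OF F] pbij] this]
    have "bij_betw (parent_edge G c n \<circ> (p (Suc n) \<circ> src F)) (coloured_edges F c n) (coloured_edges G c n)" .
    then show ?thesis by (rule bij_betw_cong[THEN iffD1, rotated]) (simp add: q)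
  qed
  have qE: "bij_betw q (edge F n) (edge G n)" for n
    unfolding HDiag_edge[OF F] HDiag_edge[OF G]
    using qbij[of Blue n] qbij[of Red n] HDiag_disjoint[OF G, of n]
    by (intro bij_betw_combine) simp_all
  have pV: "bij_betw p' (vert F n) (vert G n)" for n
    using pbij[of n] by (rule bij_betw_cong[THEN iffD1, rotated]) (simp add: p')
  have rs: "p' (rng F e) = rng G (q e)" "p' (src F e) = src G (q e)"
    if e: "e \<in> coloured_edges F c n" for e c n
  proof -
    have w: "src F e \<in> vert F (Suc n)" and v: "rng F e \<in> vert F n"
      using coloured_edge_src_rng[OF F e] .
    then have pw: "p (Suc n) (src F e) \<in> vert G (Suc n)" using pbij by (meson bij_betwE)
    show "p' (src F e) = src G (q e)"
      by (simp add: q[OF e] parent_edge(2)[OF G pw] p'[OF w])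
    show "p' (rng F e) = rng G (q e)"
      using pc[OF w, of c] parent_eqI[OF F e refl refl]
      by (simp add: q[OF e] p'[OF v] parent_def)
  qed
  have colour: "q ` {e \<in> coloured_edges F c n. rng F e = v} = {e \<in> coloured_edges G c n. rng G e = p' v}"
    if v: "v \<in> vert F n" for c n v
  proof (intro equalityI subsetI)
    fix e' assume "e' \<in> q ` {e \<in> coloured_edges F c n. rng F e = v}"
    then obtain e where "e \<in> coloured_edges F c n" "rng F e = v" "e' = q e" by blast
    then show "e' \<in> {e \<in> coloured_edges G c n. rng G e = p' v}"
      using qbij[of c n] rs[of e c n] by (auto dest: bij_betwE)
  next
    fix e' assume e': "e' \<in> {e \<in> coloured_edges G c n. rng G e = p' v}"
    then obtain e where e: "e \<in> coloured_edges F c n" "e' = q e"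
      using qbij[of c n] by (auto simp: bij_betw_def)
    with rs[OF e(1)] e' have "p' (rng F e) = p' v" by simp
    then have "rng F e = v"
      using pV[of n] v coloured_edge_src_rng(2)[OF F e(1)] by (meson bij_betw_def inj_onD)
    with e show "e' \<in> q ` {e \<in> coloured_edges F c n. rng F e = v}" by blast
  qed
  have "bij_betw p' (\<Union>n. vert F n) (\<Union>n. vert G n)" "bij_betw q (\<Union>n. edge F n) (\<Union>n. edge G n)"
    using bij_betw_UN_disjoint pV qE HDiag_vert(3,4)[OF G] by blast+
  moreover have "p' ` vert F n = vert G n" "q ` edge F n = edge G n" for n
    using pV qE by (auto simp: bij_betw_def)
  moreover have "p' (rng F e) = rng G (q e)" "p' (src F e) = src G (q e)" if "e \<in> edge F n" for e n
    using that rs[of e Blue n] rs[of e Red n] by (auto simp: HDiag_edge[OF F])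
  moreover have "q ` blue F v = blue G (p' v)" "q ` red F v = red G (p' v)" if v: "v \<in> vert F n" for v n
  proof -
    have pv: "p' v \<in> vert G n" using v pV by (meson bij_betwE)
    show "q ` blue F v = blue G (p' v)" "q ` red F v = red G (p' v)"
      using colour[OF v, of Blue] colour[OF v, of Red]
      by (simp_all add: HDiag_blue[OF F v] HDiag_blue[OF G pv] HDiag_red[OF F v] HDiag_red[OF G pv])
  qed
  ultimately show ?thesis unfolding diagram_iso_def by (intro exI[of _ p'] exI[of _ q]) simp
qed

lemma level_iso_refl: "level_iso F F (\<lambda>_ v. v)"
  by (simp add: level_iso_def bij_betw_id[unfolded id_def])

lemma level_iso_trans:
  assumes "level_iso F G p" "level_iso G H q"
  shows "level_iso F H (\<lambda>n. q n \<circ> p n)"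
  unfolding level_iso_def
proof (intro allI conjI ballI)
  show "bij_betw (q n \<circ> p n) (vert F n) (vert H n)" for n
    using assms unfolding level_iso_def by (blast intro: bij_betw_trans)
  fix n c w assume w: "w \<in> vert F (Suc n)"
  then have "p (Suc n) w \<in> vert G (Suc n)"
    using assms(1) unfolding level_iso_def by (meson bij_betwE)
  then show "(q n \<circ> p n) (parent F c n w) = parent H c n ((q (Suc n) \<circ> p (Suc n)) w)"
    using assms w unfolding level_iso_def by simp
qed

lemma level_iso_sym:
  assumes F: "F \<in> HDiag" and p: "level_iso F G p"
  shows "level_iso G F (\<lambda>n. inv_into (vert F n) (p n))"
proof -
  have pbij: "bij_betw (p n) (vert F n) (vert G n)"
    and pc: "w \<in> vert F (Suc n) \<Longrightarrow> p n (parent F c n w) = parent G c n (p (Suc n) w)" for n c w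
    using p by (auto simp: level_iso_def)
  show ?thesis
    unfolding level_iso_def
  proof (intro allI conjI ballI)
    fix n show "bij_betw (inv_into (vert F n) (p n)) (vert G n) (vert F n)"
      by (rule bij_betw_inv_into[OF pbij])
  next
    fix n c x assume x: "x \<in> vert G (Suc n)"
    let ?w = "inv_into (vert F (Suc n)) (p (Suc n)) x"
    have w: "?w \<in> vert F (Suc n)" "p (Suc n) ?w = x"
      using x pbij[of "Suc n"] by (metis bij_betw_def inv_into_into, metis bij_betw_inv_into_right)
    have "inv_into (vert F n) (p n) (p n (parent F c n ?w)) = parent F c n ?w"
      using bij_betw_inv_into_left[OF pbij parent_vert[OF F w(1)]] .
    then show "inv_into (vert F n) (p n) (parent G c n x) = parent F c n ?w"
      using pc[OF w(1)] w(2) by simp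
  qed
qed

lemma iso_refl: "F \<in> HDiag \<Longrightarrow> F \<cong>h F"
  using iso_if_level_iso level_iso_refl by metis

lemma iso_sym: "F \<in> HDiag \<Longrightarrow> G \<in> HDiag \<Longrightarrow> F \<cong>h G \<Longrightarrow> G \<cong>h F"
  by (metis iso_if_level_iso level_iso_if_iso level_iso_sym)

lemma iso_trans:
  "F \<in> HDiag \<Longrightarrow> G \<in> HDiag \<Longrightarrow> H \<in> HDiag \<Longrightarrow> F \<cong>h G \<Longrightarrow> G \<cong>h H \<Longrightarrow> F \<cong>h H"
  by (metis iso_if_level_iso level_iso_if_iso level_iso_trans)


section \<open>Every h-diagram has a copy on the natural numbers\<close>

text \<open>The edge of colour \<open>c\<close> with source \<open>w\<close> is coded as \<open>2 w\<close> or \<open>2 w + 1\<close>.\<close>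

lemma nat_diagram_exists:
  fixes U :: "nat \<Rightarrow> nat set" and P :: "colour \<Rightarrow> nat \<Rightarrow> nat \<Rightarrow> nat"
  assumes fin: "\<And>n. finite (U n)" and ne: "\<And>n. U n \<noteq> {}" and dis: "disjoint_family U"
    and surj: "\<And>c n. P c n ` U (Suc n) = U n"
    and comm: "\<And>n w. w \<in> U (Suc (Suc n)) \<Longrightarrow> P Red n (P Red (Suc n) w) = P Blue n (P Blue (Suc n) w)"
  obtains N :: "(nat, nat) diagram" where "N \<in> HDiag" "vert N = U"
    "\<And>c n w. w \<in> U (Suc n) \<Longrightarrow> parent N c n w = P c n w"
proof -
  define col where "col e = (if even e then Blue else Red)" for e :: nat
  define lev where "lev w = (THE n. w \<in> U (Suc n))" for w
  have lev: "lev w = n" if "w \<in> U (Suc n)" for w n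
    unfolding lev_def using that disjoint_familyD[OF dis, of w] by (intro the_equality) blast+
  define N where "N = \<lparr> vert = U, edge = (\<lambda>n. {e. e div 2 \<in> U (Suc n)}),
     rng = (\<lambda>e. P (col e) (lev (e div 2)) (e div 2)), src = (\<lambda>e. e div 2),
     blue = (\<lambda>v. {e. col e = Blue \<and> (\<exists>n. e div 2 \<in> U (Suc n) \<and> P Blue n (e div 2) = v)}),
     red = (\<lambda>v. {e. col e = Red \<and> (\<exists>n. e div 2 \<in> U (Suc n) \<and> P Red n (e div 2) = v)}) \<rparr>"
  have col: "coloured_edges N c n = {e. col e = c \<and> e div 2 \<in> U (Suc n)}" for c n
    by (cases c) (auto simp: N_def blue_edges_def red_edges_def lev)
  note colB = col[of Blue, simplified] and colR = col[of Red, simplified]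
  define en :: "colour \<Rightarrow> nat \<Rightarrow> nat" where "en c w = (if c = Blue then 2 * w else 2 * w + 1)" for c w
  have en: "col (en c w) = c" "en c w div 2 = w" for c w
    by (cases c; simp add: en_def col_def)+
  have en': "e = en (col e) (e div 2)" for e
    by (auto simp: en_def col_def elim!: evenE oddE)
  have "N \<in> HDiag"
  proof (rule HDiagI)
    show "finite (vert N n)" "vert N n \<noteq> {}" for n using fin ne by (simp_all add: N_def)
    show "disjoint_family (vert N)" using dis by (simp add: N_def)
    show "disjoint_family (edge N)"
      using disjoint_familyD[OF dis] by (auto simp: N_def disjoint_family_on_def)
    show "edge N n = blue_edges N n \<union> red_edges N n" for n
      unfolding colB colR by (auto simp: N_def) (metis colour.exhaust)
    show "blue_edges N n \<inter> red_edges N n = {}" for n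
      unfolding colB colR by auto
    have same: "n = k" if "e div 2 \<in> U (Suc n)" "P c n (e div 2) \<in> U k" for n k c and e :: nat
      using disjoint_familyD[OF dis] that surj by blast
    show "blue N v = {e \<in> blue_edges N n. rng N e = v}" if "v \<in> vert N n" for n v
      unfolding colB using that by (auto simp: N_def lev dest: same)
    show "red N v = {e \<in> red_edges N n. rng N e = v}" if "v \<in> vert N n" for n v
      unfolding colR using that by (auto simp: N_def lev dest: same)
    show "bij_betw (src N) (coloured_edges N c n) (vert N (Suc n))" for c n
      unfolding col by (rule bij_betw_byWitness[where f' = "en c"])
        (auto simp: N_def en, metis en')
    show "rng N ` coloured_edges N c n = vert N n" for c n
    proof -
      have "rng N ` coloured_edges N c n = (\<lambda>e. P c n (e div 2)) ` {e. col e = c \<and> e div 2 \<in> U (Suc n)}"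
        unfolding col by (intro image_cong) (auto simp: N_def lev)
      also have "\<dots> = P c n ` U (Suc n)"
        by (auto simp: image_iff) (metis en)
      finally show ?thesis using surj by (simp add: N_def)
    qed
    fix n e0 e1 f0 f1
    assume "e0 \<in> blue_edges N n" "e1 \<in> blue_edges N (Suc n)" "f0 \<in> red_edges N n"
      "f1 \<in> red_edges N (Suc n)" "rng N e1 = src N e0" "rng N f1 = src N f0" "src N f1 = src N e1"
    then show "rng N f0 = rng N e0"
      using comm[of "e1 div 2" n] unfolding colB colR by (auto simp: N_def lev)
  qed
  moreover have "parent N c n w = P c n w" if "w \<in> U (Suc n)" for c n w
  proof (rule parent_eqI[OF \<open>N \<in> HDiag\<close>])
    show "en c w \<in> coloured_edges N c n" using that by (simp add: col en)
    show "src N (en c w) = w" "rng N (en c w) = P c n w"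
      using that by (simp_all add: N_def en lev)
  qed
  ultimately show thesis using that[of N] by (simp add: N_def)
qed

text \<open>The generated equivalence relation and the quotients consist of diagrams on natural numbers, and
  this copy connects diagrams over other types with them. It exists because an h-diagram has only
  countably many vertices.\<close>

lemma HDiag_nat_copy:
  assumes F: "F \<in> HDiag"
  obtains N :: "(nat, nat) diagram" where "N \<in> HDiag" "F \<cong>h N"
proof -
  let ?V = "\<Union>n. vert F n"
  have cnt: "countable ?V" using HDiag_vert(1)[OF F] by (simp add: countable_finite)
  define f where "f = to_nat_on ?V"
  have inj: "inj_on f ?V" unfolding f_def using cnt by (rule inj_on_to_nat_on)
  have f_eq: "f v = f w \<longleftrightarrow> v = w" if "v \<in> vert F n" "w \<in> vert F m" for v w n m
    using inj that by (meson UN_I UNIV_I inj_on_eq_iff)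
  define g where "g = inv_into ?V f"
  have g: "g (f v) = v" if "v \<in> vert F n" for v n
    unfolding g_def using that inj by (intro inv_into_f_f) auto
  define U where "U n = f ` vert F n" for n
  define P where "P c n w = f (parent F c n (g w))" for c n w
  obtain N :: "(nat, nat) diagram" where N: "N \<in> HDiag" "vert N = U"
      "\<And>c n w. w \<in> U (Suc n) \<Longrightarrow> parent N c n w = P c n w"
  proof (rule nat_diagram_exists[of U P])
    show "finite (U n)" "U n \<noteq> {}" for n using HDiag_vert[OF F] by (simp_all add: U_def)
    show "disjoint_family U"
      using disjoint_familyD[OF HDiag_vert(3)[OF F]] f_eq
      unfolding U_def disjoint_family_on_def by (auto simp: f_eq)
    show "P c n ` U (Suc n) = U n" for c n
    proof -
      have "P c n ` U (Suc n) = f ` parent F c n ` vert F (Suc n)"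
        by (simp add: U_def P_def image_image g cong: image_cong)
      moreover have "parent F c n ` vert F (Suc n) = vert F n"
        using parent_vert[OF F] parent_surj[OF F] by (auto simp: image_iff) metis
      ultimately show ?thesis by (simp add: U_def)
    qed
    show "P Red n (P Red (Suc n) w) = P Blue n (P Blue (Suc n) w)" if "w \<in> U (Suc (Suc n))" for n w
      using that parent_parent[OF F] by (auto simp: U_def P_def g g[OF parent_vert[OF F]])
  qed blast
  have "level_iso F N (\<lambda>_. f)"
    unfolding level_iso_def
  proof (intro allI conjI ballI)
    show "bij_betw f (vert F n) (vert N n)" for n
      unfolding N(2) U_def by (rule bij_betw_imageI) (use inj in \<open>auto intro: inj_on_subset\<close>)
    show "f (parent F c n w) = parent N c n (f w)" if "w \<in> vert F (Suc n)" for c n w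
      using that N(3)[of "f w"] by (simp add: U_def P_def g)
  qed
  then show thesis using that N(1) iso_if_level_iso[OF F N(1)] by blast
qed

section \<open>Iterated parents and contraction\<close>

primrec ancestor :: "('v, 'e) diagram \<Rightarrow> colour \<Rightarrow> nat \<Rightarrow> nat \<Rightarrow> 'v \<Rightarrow> 'v" where
  "ancestor F c a 0 w = w"
| "ancestor F c a (Suc k) w = parent F c a (ancestor F c (Suc a) k w)"

lemma ancestor_Suc_inner: "ancestor F c a (Suc k) w = ancestor F c a k (parent F c (a + k) w)"
proof (induction k arbitrary: a)
  case (Suc k)
  show ?case using Suc.IH[of "Suc a"] by simp
qed simp

lemma ancestor_add: "ancestor F c a (j + k) w = ancestor F c a j (ancestor F c (a + j) k w)"
  by (induction j arbitrary: a) simp_all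

lemma ancestor_vert:
  assumes "F \<in> HDiag"
  shows "w \<in> vert F (a + k) \<Longrightarrow> ancestor F c a k w \<in> vert F a"
proof (induction k arbitrary: a)
  case (Suc k)
  then show ?case using Suc.IH[of "Suc a"] parent_vert[OF assms] by simp
qed simp

lemma ancestor_surj:
  assumes "F \<in> HDiag" "v \<in> vert F a"
  shows "\<exists>w \<in> vert F (a + k). ancestor F c a k w = v"
  using assms(2)
proof (induction k arbitrary: a v)
  case (Suc k)
  obtain u where u: "u \<in> vert F (Suc a)" "parent F c a u = v"
    using parent_surj[OF assms(1) Suc.prems] .
  from Suc.IH[OF u(1)] u(2) show ?case by auto
qed simp

text \<open>Condition (c) allows two consecutive red steps to be replaced by two blue ones.\<close>

lemma ancestor_even:
  assumes "F \<in> HDiag"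
  shows "w \<in> vert F (a + 2 * k) \<Longrightarrow> ancestor F Red a (2 * k) w = ancestor F Blue a (2 * k) w"
proof (induction k arbitrary: a)
  case (Suc k)
  let ?v = "ancestor F Blue (Suc (Suc a)) (2 * k) w"
  have "ancestor F Red (Suc (Suc a)) (2 * k) w = ?v"
    using Suc by simp
  moreover have "?v \<in> vert F (Suc (Suc a))"
    using Suc.prems by (intro ancestor_vert[OF assms]) simp
  ultimately show ?case using parent_parent[OF assms] by simp
qed simp

text \<open>The square of the blue parent map commutes with the red one, because it is also the square of
  the red one.\<close>

lemma parent_commute:
  assumes F: "F \<in> HDiag" and w: "w \<in> vert F (Suc (Suc (Suc n)))"
  shows "parent F Blue n (parent F Blue (Suc n) (parent F Red (Suc (Suc n)) w)) =
    parent F Red n (parent F Blue (Suc n) (parent F Blue (Suc (Suc n)) w))"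
  using parent_parent[OF F parent_vert[OF F w, of Red]] parent_parent[OF F w] by simp

lemma ancestor_level_iso:
  assumes F: "F \<in> HDiag" and p: "level_iso F G p"
  shows "w \<in> vert F (a + k) \<Longrightarrow> p a (ancestor F c a k w) = ancestor G c a k (p (a + k) w)"
proof (induction k arbitrary: a)
  case (Suc k)
  have "ancestor F c (Suc a) k w \<in> vert F (Suc a)"
    using Suc.prems by (intro ancestor_vert[OF F]) simp
  then have "p a (ancestor F c a (Suc k) w) = parent G c a (p (Suc a) (ancestor F c (Suc a) k w))"
    using p by (simp add: level_iso_def)
  then show ?case using Suc.IH[of "Suc a"] Suc.prems by simp
qed simp

lemma tuples_snoc:
  "es \<in> tuples F K a (a + Suc d) \<longleftrightarrow> (\<exists>es' e. es = es' @ [e] \<and> es' \<in> tuples F K a (a + d) \<and>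
     e \<in> K (a + d) \<and> (es' \<noteq> [] \<longrightarrow> src F (last es') = rng F e))" (is "?L \<longleftrightarrow> ?R")
proof
  assume L: ?L
  then have len: "length es = Suc d" by (simp add: tuples_def)
  then obtain es' e where es: "es = es' @ [e]" by (metis length_Suc_conv_rev)
  with len have len': "length es' = d" by simp
  have K: "es ! i \<in> K (a + i)" if "i < Suc d" for i using L len that by (simp add: tuples_def)
  have comp: "src F (es ! i) = rng F (es ! Suc i)" if "Suc i < Suc d" for i
    using L len that by (simp add: tuples_def)
  have "es' \<in> tuples F K a (a + d)"
    unfolding tuples_def
  proof (intro CollectI conjI allI impI)
    show "length es' = a + d - a" using len' by simp
    show "es' ! i \<in> K (a + i)" if "i < length es'" for i
      using K[of i] that len' by (simp add: es nth_append)
    show "src F (es' ! i) = rng F (es' ! Suc i)" if "Suc i < length es'" for i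
      using comp[of i] that len' by (simp add: es nth_append)
  qed
  moreover have "e \<in> K (a + d)" using K[of d] len' by (simp add: es nth_append)
  moreover have "src F (last es') = rng F e" if "es' \<noteq> []"
  proof -
    from that len' obtain k where k: "d = Suc k" by (cases d) auto
    show ?thesis using comp[of k] len' that by (simp add: es nth_append k last_conv_nth)
  qed
  ultimately show ?R using es by blast
next
  assume ?R
  then obtain es' e where es: "es = es' @ [e]" and es': "es' \<in> tuples F K a (a + d)"
     and e: "e \<in> K (a + d)" "es' \<noteq> [] \<longrightarrow> src F (last es') = rng F e" by blast
  have len': "length es' = d" using es' by (simp add: tuples_def)
  show ?L
    unfolding tuples_def
  proof (intro CollectI conjI allI impI)
    show "length es = a + Suc d - a" using len' es by simp
    show "es ! i \<in> K (a + i)" if "i < length es" for i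
      using that es' e(1) len' by (auto simp: es nth_append tuples_def less_Suc_eq)
    fix i assume i: "Suc i < length es"
    show "src F (es ! i) = rng F (es ! Suc i)"
    proof (cases "Suc i < d")
      case True
      then show ?thesis using es' len' by (simp add: es nth_append tuples_def)
    next
      case False
      with i len' have "d = Suc i" by (simp add: es)
      moreover from this len' have "es' \<noteq> []" by auto
      moreover from this len' \<open>d = Suc i\<close> have "last es' = es' ! i" by (simp add: last_conv_nth)
      ultimately show ?thesis using e(2) len' by (simp add: es nth_append)
    qed
  qed
qed

text \<open>A monochromatic path is determined by its upper end, and its lower end is the ancestor of
  the upper end.\<close>

lemma tuples_ancestor:
  assumes F: "F \<in> HDiag"
  shows "(\<forall>es \<in> tuples F (coloured_edges F c) a (a + Suc d).
      src F (last es) \<in> vert F (a + Suc d) \<and>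
      rng F (hd es) = ancestor F c a (Suc d) (src F (last es))) \<and>
    bij_betw (\<lambda>es. src F (last es)) (tuples F (coloured_edges F c) a (a + Suc d)) (vert F (a + Suc d))"
proof (induction d)
  case 0
  have "tuples F (coloured_edges F c) a (a + Suc 0) = (\<lambda>e. [e]) ` coloured_edges F c a"
    unfolding tuples_def by (auto simp: length_Suc_conv)
  moreover have "bij_betw (\<lambda>es. src F (last es)) ((\<lambda>e. [e]) ` coloured_edges F c a) (vert F (Suc a))"
    using HDiag_bij[OF F, of c a] by (auto simp: bij_betw_def inj_on_def image_image)
  ultimately show ?case
    using coloured_edge_src_rng[OF F] parent_eqI[OF F _ refl refl, symmetric] by auto
next
  case (Suc d)
  let ?K = "coloured_edges F c"
  let ?T = "\<lambda>d. tuples F ?K a (a + d)"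
  have split: "\<exists>es' e. es = es' @ [e] \<and> es' \<in> ?T (Suc d) \<and> e \<in> ?K (a + Suc d) \<and>
      src F (last es') = rng F e \<and> es' \<noteq> []" if "es \<in> ?T (Suc (Suc d))" for es
  proof -
    from that[unfolded tuples_snoc[of es _ _ _ "Suc d"]] obtain es' e where
      es: "es = es' @ [e]" "es' \<in> ?T (Suc d)" "e \<in> ?K (a + Suc d)"
      "es' \<noteq> [] \<longrightarrow> src F (last es') = rng F e" by blast
    from es(2) have "es' \<noteq> []" by (auto simp: tuples_def)
    with es show ?thesis by blast
  qed
  have 1: "src F (last es) \<in> vert F (a + Suc (Suc d)) \<and>
      rng F (hd es) = ancestor F c a (Suc (Suc d)) (src F (last es))" if "es \<in> ?T (Suc (Suc d))" for es
  proof -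
    from split[OF that] obtain es' e where es: "es = es' @ [e]" "es' \<in> ?T (Suc d)"
      "e \<in> ?K (a + Suc d)" "src F (last es') = rng F e" "es' \<noteq> []" by blast
    have "rng F (hd es) = rng F (hd es')" using es(1,5) by simp
    also have "\<dots> = ancestor F c a (Suc d) (rng F e)" using Suc.IH es(2,4) by simp
    also have "rng F e = parent F c (a + Suc d) (src F e)"
      using parent_eqI[OF F es(3) refl refl] by simp
    finally show ?thesis
      using coloured_edge_src_rng(1)[OF F es(3)]
      unfolding ancestor_Suc_inner[of F c a "Suc d"] by (simp add: es(1))
  qed
  moreover have "inj_on (\<lambda>es. src F (last es)) (?T (Suc (Suc d)))"
  proof (rule inj_onI)
    fix es fs assume "es \<in> ?T (Suc (Suc d))" "fs \<in> ?T (Suc (Suc d))"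
      and eq: "src F (last es) = src F (last fs)"
    then obtain es' e fs' f where es: "es = es' @ [e]" "es' \<in> ?T (Suc d)"
      "e \<in> ?K (a + Suc d)" "src F (last es') = rng F e"
      and fs: "fs = fs' @ [f]" "fs' \<in> ?T (Suc d)"
      "f \<in> ?K (a + Suc d)" "src F (last fs') = rng F f" using split by metis
    have "e = f" using coloured_edge_unique[OF F es(3) fs(3)] eq es(1) fs(1) by simp
    moreover from this have "es' = fs'"
      using Suc.IH es(2,4) fs(2,4) unfolding bij_betw_def inj_on_def by metis
    ultimately show "es = fs" using es fs by simp
  qed
  moreover have "w \<in> (\<lambda>es. src F (last es)) ` ?T (Suc (Suc d))" if w: "w \<in> vert F (a + Suc (Suc d))" for w
  proof -
    have w': "w \<in> vert F (Suc (a + Suc d))" using w by simp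
    note e = parent_edge[OF F w', of c]
    have "rng F (parent_edge F c (a + Suc d) w) \<in> vert F (a + Suc d)"
      by (rule coloured_edge_src_rng(2)[OF F e(1)])
    then have "rng F (parent_edge F c (a + Suc d) w) \<in> (\<lambda>es. src F (last es)) ` ?T (Suc d)"
      using bij_betw_imp_surj_on[OF conjunct2[OF Suc.IH]] by simp
    then obtain es' where es': "es' \<in> ?T (Suc d)"
      "src F (last es') = rng F (parent_edge F c (a + Suc d) w)" by auto
    then have "es' @ [parent_edge F c (a + Suc d) w] \<in> ?T (Suc (Suc d))"
      unfolding tuples_snoc[of _ _ _ _ "Suc d"] using e(1) by blast
    then show ?thesis using e(2) by (intro image_eqI) simp_all
  qed
  ultimately show ?case unfolding bij_betw_def by blast
qed

lemma tuples_hd: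
  assumes "es \<in> tuples F K a b" "a < b"
  shows "hd es \<in> K a"
  using assms by (cases es) (auto simp: tuples_def)

lemma contraction_seq_lt: "contraction_seq m \<Longrightarrow> m n < m (Suc n)"
  by (simp add: contraction_seq_def strict_mono_Suc_iff)

text \<open>The colour classes of a contraction are formed over all levels at once; the first entry of a
  tuple tells its level and its colour.\<close>

lemma contraction_coloured_edges:
  assumes F: "F \<in> HDiag" and m: "contraction_seq m"
  shows "coloured_edges (contraction F m) c n = tuples F (coloured_edges F c) (m n) (m (Suc n))"
proof -
  have disj: False if "es \<in> tuples F (blue_edges F) (m n) (m (Suc n))"
     "es \<in> tuples F (red_edges F) (m k) (m (Suc k))" for es n k
  proof -
    have h: "hd es \<in> blue_edges F (m n)" "hd es \<in> red_edges F (m k)"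
      using tuples_hd[OF that(1) contraction_seq_lt[OF m]]
        tuples_hd[OF that(2) contraction_seq_lt[OF m]] by simp_all
    then have "m n = m k"
      by (intro disjoint_familyD[OF HDiag_vert(4)[OF F], of "hd es"])
        (auto simp: blue_edges_def red_edges_def)
    with h HDiag_disjoint[OF F] show False by auto
  qed
  show ?thesis
    by (cases c) (auto simp: contraction_def blue_edges_def[where n = n]
      red_edges_def[where n = n] dest: disj)
qed

text \<open>The parent maps of a contraction are iterated parent maps. Condition (c) survives because two
  consecutive steps of a contraction cover an even distance, over which red and blue ancestors
  coincide.\<close>

lemma contraction_HDiag_parent:
  assumes F: "F \<in> HDiag" and m: "contraction_seq m"
  shows "contraction F m \<in> HDiag"
    and "w \<in> vert F (m (Suc n)) \<Longrightarrow>
      parent (contraction F m) c n w = ancestor F c (m n) (m (Suc n) - m n) w"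
proof -
  let ?C = "contraction F m"
  have sel: "vert ?C = (\<lambda>n. vert F (m n))" "rng ?C = (\<lambda>es. rng F (hd es))"
    "src ?C = (\<lambda>es. src F (last es))"
    by (simp_all add: contraction_def)
  let ?T = "\<lambda>c n. tuples F (coloured_edges F c) (m n) (m (Suc n))"
  note col = contraction_coloured_edges[OF F m]
  note colB = col[of Blue, simplified] and colR = col[of Red, simplified]
  have edge: "edge ?C n = tuples F (blue_edges F) (m n) (m (Suc n)) \<union> tuples F (red_edges F) (m n) (m (Suc n))" for n
    by (simp add: contraction_def)
  have blue: "blue ?C v = {es \<in> (\<Union>n. tuples F (blue_edges F) (m n) (m (Suc n))). rng F (hd es) = v}"
    and red: "red ?C v = {es \<in> (\<Union>n. tuples F (red_edges F) (m n) (m (Suc n))). rng F (hd es) = v}" for v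
    by (simp_all add: contraction_def)
  have tup: "es \<in> ?T c n \<Longrightarrow> src F (last es) \<in> vert F (m (Suc n)) \<and>
      rng F (hd es) = ancestor F c (m n) (m (Suc n) - m n) (src F (last es))"
    "bij_betw (\<lambda>es. src F (last es)) (?T c n) (vert F (m (Suc n)))" for es c n
  proof -
    obtain d where d: "m (Suc n) = m n + Suc d"
      using contraction_seq_lt[OF m, of n] less_imp_Suc_add by fastforce
    show "es \<in> ?T c n \<Longrightarrow> src F (last es) \<in> vert F (m (Suc n)) \<and>
      rng F (hd es) = ancestor F c (m n) (m (Suc n) - m n) (src F (last es))"
      "bij_betw (\<lambda>es. src F (last es)) (?T c n) (vert F (m (Suc n)))"
      using tuples_ancestor[OF F, of c "m n" d] unfolding d by auto
  qed
  have inj: "m n = m k \<longleftrightarrow> n = k" for n k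
    using m by (metis contraction_seq_def strict_mono_eq)
  have le: "m n + (m (Suc n) - m n) = m (Suc n)" for n
    using contraction_seq_lt[OF m, of n] by simp
  have rngv: "rng F (hd es) \<in> vert F (m n)" if "es \<in> ?T c n" for es c n
    using tup(1)[OF that] ancestor_vert[OF F, of _ "m n" "m (Suc n) - m n"] le by simp
  have hd: "hd es \<in> edge F (m n)" if "es \<in> ?T c n" for es c n
    using tuples_hd[OF that contraction_seq_lt[OF m]] coloured_edges_subset by (rule subsetD[rotated])
  have hd': "hd es \<in> edge F (m n)" if "es \<in> edge ?C n" for es and n :: nat
    using that hd[of es Blue n] hd[of es Red n] by (auto simp: edge)
  have lev: "n = k" if "es \<in> ?T c n" "rng F (hd es) \<in> vert F (m k)" for es c n k
    using disjoint_familyD[OF HDiag_vert(3)[OF F] rngv[OF that(1)] that(2)] inj by simp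
  show C: "?C \<in> HDiag"
  proof (rule HDiagI)
    show "finite (vert ?C n)" "vert ?C n \<noteq> {}" for n using HDiag_vert[OF F] by (simp_all add: sel)
    show "disjoint_family (vert ?C)"
      unfolding sel disjoint_family_on_def using disjoint_familyD[OF HDiag_vert(3)[OF F]] inj by blast
    show "disjoint_family (edge ?C)"
      unfolding disjoint_family_on_def
    proof (intro ballI impI equals0I)
      fix n k es assume "n \<noteq> k" "es \<in> edge ?C n \<inter> edge ?C k"
      then show False using disjoint_familyD[OF HDiag_vert(4)[OF F] hd', of es n "m k"] hd'[of es k] inj by simp
    qed
    show "edge ?C n = blue_edges ?C n \<union> red_edges ?C n" for n
      unfolding edge colB colR ..
    show "blue_edges ?C n \<inter> red_edges ?C n = {}" for n
      unfolding colB colR using tuples_hd[OF _ contraction_seq_lt[OF m]] HDiag_disjoint[OF F] by blast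
    show "blue ?C v = {e \<in> blue_edges ?C n. rng ?C e = v}" if "v \<in> vert ?C n" for n v
      using that lev[of _ Blue] unfolding blue colB sel by auto
    show "red ?C v = {e \<in> red_edges ?C n. rng ?C e = v}" if "v \<in> vert ?C n" for n v
      using that lev[of _ Red] unfolding red colR sel by auto
    show "bij_betw (src ?C) (coloured_edges ?C c n) (vert ?C (Suc n))" for c n
      unfolding col sel by (rule tup)
    show "rng ?C ` coloured_edges ?C c n = vert ?C n" for c n
      unfolding col sel
    proof (intro equalityI subsetI)
      fix v assume "v \<in> (\<lambda>es. rng F (hd es)) ` ?T c n"
      then show "v \<in> vert F (m n)" using rngv by blast
    next
      fix v assume "v \<in> vert F (m n)"
      from ancestor_surj[OF F this, of "m (Suc n) - m n" c] le obtain w where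
        w: "w \<in> vert F (m (Suc n))" "ancestor F c (m n) (m (Suc n) - m n) w = v" by auto
      have "w \<in> (\<lambda>es. src F (last es)) ` ?T c n"
        unfolding bij_betw_imp_surj_on[OF tup(2)] by (rule w(1))
      then obtain es where "es \<in> ?T c n" "src F (last es) = w" by auto
      with tup(1)[of es c n] w show "v \<in> (\<lambda>es. rng F (hd es)) ` ?T c n" by auto
    qed
    fix n e0 e1 f0 f1
    assume e: "e0 \<in> blue_edges ?C n" "e1 \<in> blue_edges ?C (Suc n)" "f0 \<in> red_edges ?C n"
      "f1 \<in> red_edges ?C (Suc n)" "rng ?C e1 = src ?C e0" "rng ?C f1 = src ?C f0" "src ?C f1 = src ?C e1"
    let ?a = "m n" and ?b = "m (Suc n)" and ?c = "m (Suc (Suc n))" and ?w = "src F (last e1)"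
    have "rng F (hd e0) = ancestor F Blue ?a (?b - ?a) (ancestor F Blue ?b (?c - ?b) ?w)"
      using tup(1)[of e0 Blue n] tup(1)[of e1 Blue "Suc n"] e by (simp add: colB sel)
    also have "\<dots> = ancestor F Blue ?a ((?b - ?a) + (?c - ?b)) ?w"
      by (simp add: ancestor_add le)
    also have "\<dots> = ancestor F Red ?a ((?b - ?a) + (?c - ?b)) ?w"
    proof -
      \<comment> \<open>a sum of two odd steps\<close>
      have "even ((?b - ?a) + (?c - ?b))" using m by (simp add: contraction_seq_def)
      then obtain k where k: "(?b - ?a) + (?c - ?b) = 2 * k" by (elim evenE)
      have "?w \<in> vert F (?a + 2 * k)"
        using tup(1)[of e1 Blue "Suc n"] e(2) le[of n] le[of "Suc n"] k[symmetric]
        by (simp add: colB flip: add.assoc)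
      then show ?thesis unfolding k by (simp add: ancestor_even[OF F])
    qed
    also have "\<dots> = ancestor F Red ?a (?b - ?a) (ancestor F Red ?b (?c - ?b) ?w)"
      by (simp add: ancestor_add le)
    also have "\<dots> = rng F (hd f0)"
      using tup(1)[of f0 Red n] tup(1)[of f1 Red "Suc n"] e by (simp add: colR sel)
    finally show "rng ?C f0 = rng ?C e0" by (simp add: sel)
  qed
  show "parent ?C c n w = ancestor F c (m n) (m (Suc n) - m n) w" if "w \<in> vert F (m (Suc n))"
  proof -
    have "w \<in> (\<lambda>es. src F (last es)) ` ?T c n"
      unfolding bij_betw_imp_surj_on[OF tup(2)] by (rule that)
    then obtain es where es: "es \<in> ?T c n" "src F (last es) = w" by auto
    show ?thesis
    proof (rule parent_eqI[OF C])
      show "es \<in> coloured_edges ?C c n" unfolding col by (rule es(1))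
      show "src ?C es = w" unfolding sel by (rule es(2))
      show "rng ?C es = ancestor F c (m n) (m (Suc n) - m n) w"
        using tup(1)[OF es(1)] unfolding sel es(2) by (rule conjunct2)
    qed
  qed
qed

lemma contraction_vert [simp]: "vert (contraction F m) n = vert F (m n)"
  by (simp add: contraction_def)

lemma contraction_cong_iso:
  assumes F: "F \<in> HDiag" and G: "G \<in> HDiag" and m: "contraction_seq m" and iso: "F \<cong>h G"
  shows "contraction F m \<cong>h contraction G m"
proof -
  obtain p where p: "level_iso F G p" using level_iso_if_iso[OF F G iso] .
  have "level_iso (contraction F m) (contraction G m) (\<lambda>n. p (m n))"
    unfolding level_iso_def
  proof (intro allI conjI ballI)
    show "bij_betw (p (m n)) (vert (contraction F m) n) (vert (contraction G m) n)" for n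
      using p by (simp add: level_iso_def)
    fix n c w assume "w \<in> vert (contraction F m) (Suc n)"
    then have w: "w \<in> vert F (m (Suc n))" by simp
    then have "p (m (Suc n)) w \<in> vert G (m (Suc n))"
      using p unfolding level_iso_def by (meson bij_betwE)
    with w show "p (m n) (parent (contraction F m) c n w) = parent (contraction G m) c n (p (m (Suc n)) w)"
      using ancestor_level_iso[OF F p, of w "m n" "m (Suc n) - m n" c] contraction_seq_lt[OF m, of n]
      by (simp add: contraction_HDiag_parent(2)[OF F m] contraction_HDiag_parent(2)[OF G m])
  qed
  then show ?thesis
    by (rule iso_if_level_iso[OF contraction_HDiag_parent(1)[OF F m] contraction_HDiag_parent(1)[OF G m]])
qed


section \<open>The equivalence relation on h-diagrams\<close>

lemma h_equiv_if_iso: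
  assumes "F \<in> HDiag" "G \<in> HDiag" "F \<cong>h G"
  shows "F \<sim>h G"
proof -
  obtain N :: "(nat, nat) diagram" where N: "N \<in> HDiag" "F \<cong>h N" using HDiag_nat_copy[OF assms(1)] .
  then have "N \<cong>h G" using iso_trans[OF N(1) assms(1,2) iso_sym[OF assms(1) N]] assms(3) by simp
  with N assms show ?thesis unfolding h_equiv_def using equivclp_refl by metis
qed

lemma h_equiv_sym:
  assumes "F \<sim>h G"
  shows "G \<sim>h F"
proof -
  obtain F' G' where *: "F \<in> HDiag" "G \<in> HDiag" "F' \<in> HDiag" "G' \<in> HDiag" "F \<cong>h F'"
    "equivclp h_step F' G'" "G' \<cong>h G" using assms unfolding h_equiv_def by blast
  note iso_sym[OF *(4,2,7)] equivclp_sym[OF *(6)] iso_sym[OF *(1,3,5)]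
  with *(1-4) show ?thesis unfolding h_equiv_def by blast
qed

text \<open>The diagram in the middle may be represented by two different copies on the natural numbers. They
  are isomorphic, so one more step leads from one to the other.\<close>

lemma h_equiv_trans:
  assumes "F \<sim>h G" "G \<sim>h H"
  shows "F \<sim>h H"
proof -
  obtain F' G' where 1: "F \<in> HDiag" "G \<in> HDiag" "F' \<in> HDiag" "G' \<in> HDiag" "F \<cong>h F'"
    "equivclp h_step F' G'" "G' \<cong>h G" using assms(1) unfolding h_equiv_def by blast
  obtain G'' H' where 2: "H \<in> HDiag" "G'' \<in> HDiag" "H' \<in> HDiag" "G \<cong>h G''"
    "equivclp h_step G'' H'" "H' \<cong>h H" using assms(2) unfolding h_equiv_def by blast
  have "h_step G' G''"
    using iso_trans[OF 1(4,2) 2(2) 1(7) 2(4)] 1(4) 2(2) unfolding h_step_def by simp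
  then have "equivclp h_step F' H'"
    using 1(6) 2(5) by (meson equivclp_into_equivclp equivclp_trans)
  with 1(1,3,5) 2(1,3,6) show ?thesis unfolding h_equiv_def by blast
qed

lemma h_equiv_contraction:
  assumes F: "F \<in> HDiag" and m: "contraction_seq m"
  shows "F \<sim>h contraction F m"
proof -
  have C: "contraction F m \<in> HDiag" using contraction_HDiag_parent(1)[OF F m] .
  obtain N :: "(nat, nat) diagram" where N: "N \<in> HDiag" "F \<cong>h N" using HDiag_nat_copy[OF F] .
  obtain M :: "(nat, nat) diagram" where M: "M \<in> HDiag" "contraction F m \<cong>h M"
    using HDiag_nat_copy[OF C] .
  have CN: "contraction N m \<in> HDiag" using contraction_HDiag_parent(1)[OF N(1) m] .
  have "contraction N m \<cong>h M"
    using iso_trans[OF CN C M(1) iso_sym[OF C CN contraction_cong_iso[OF F N(1) m N(2)]] M(2)] .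
  then have "h_step N M" using N(1) M(1) m unfolding h_step_def by blast
  then have "equivclp h_step N M" by (rule r_into_equivclp)
  then show ?thesis
    unfolding h_equiv_def using F C N M(1) iso_sym[OF C M(1) M(2)] by blast
qed

section \<open>Clopen partitions\<close>

lemma clopen_partitionD:
  assumes "clopen_partition X P"
  shows "finite P" "\<Union>P = topspace X" "\<And>Z. Z \<in> P \<Longrightarrow> Z \<noteq> {}"
    "\<And>Z. Z \<in> P \<Longrightarrow> openin X Z" "\<And>Z. Z \<in> P \<Longrightarrow> closedin X Z" "\<And>Z. Z \<in> P \<Longrightarrow> Z \<subseteq> topspace X"
    "\<And>Z W x. Z \<in> P \<Longrightarrow> W \<in> P \<Longrightarrow> x \<in> Z \<Longrightarrow> x \<in> W \<Longrightarrow> Z = W"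
    "\<And>x. x \<in> topspace X \<Longrightarrow> \<exists>Z \<in> P. x \<in> Z"
proof -
  have p: "partition_on (topspace X) P" using assms by (simp add: clopen_partition_def)
  show "finite P" "\<And>Z. Z \<in> P \<Longrightarrow> openin X Z" "\<And>Z. Z \<in> P \<Longrightarrow> closedin X Z"
    using assms by (auto simp: clopen_partition_def)
  show U: "\<Union>P = topspace X" using partition_onD1[OF p] by simp
  show "\<And>Z. Z \<in> P \<Longrightarrow> Z \<noteq> {}" using partition_onD3[OF p] by auto
  show "\<And>Z. Z \<in> P \<Longrightarrow> Z \<subseteq> topspace X" "\<And>x. x \<in> topspace X \<Longrightarrow> \<exists>Z \<in> P. x \<in> Z"
    using U by auto
  show "\<And>Z W x. Z \<in> P \<Longrightarrow> W \<in> P \<Longrightarrow> x \<in> Z \<Longrightarrow> x \<in> W \<Longrightarrow> Z = W"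
    using partition_onD2[OF p] unfolding disjoint_def by blast
qed

text \<open>Closedness comes for free: the complement of a cell is the union of the other cells.\<close>

lemma clopen_partitionI:
  assumes "finite P" "\<Union>P = topspace X" "\<And>Z. Z \<in> P \<Longrightarrow> Z \<noteq> {}"
    "\<And>Z. Z \<in> P \<Longrightarrow> openin X Z"
    "\<And>Z W x. Z \<in> P \<Longrightarrow> W \<in> P \<Longrightarrow> x \<in> Z \<Longrightarrow> x \<in> W \<Longrightarrow> Z = W"
  shows "clopen_partition X P"
proof -
  have "partition_on (topspace X) P"
  proof (rule partition_onI)
    show "disjnt p q" if "p \<in> P" "q \<in> P" "p \<noteq> q" for p q
      using assms(5)[OF that(1,2)] that(3) unfolding disjnt_iff by blast
  qed (use assms(2,3) in auto)
  moreover have "closedin X Z" if Z: "Z \<in> P" for Z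
  proof -
    have "x \<notin> Z" if "x \<in> W" "W \<in> P - {Z}" for x W using assms(5)[of W Z x] that Z by blast
    then have "Z = topspace X - \<Union>(P - {Z})"
      unfolding assms(2)[symmetric] using Z by auto
    moreover have "openin X (\<Union>(P - {Z}))" using assms(4) by (intro openin_Union) auto
    ultimately show ?thesis by (metis closedin_diff closedin_topspace)
  qed
  ultimately show ?thesis using assms(1,4) by (simp add: clopen_partition_def)
qed

lemma coarser_refl: "P \<precsim> P"
  by (auto simp: coarser_def)

lemma coarser_trans: "P \<precsim> Q \<Longrightarrow> Q \<precsim> R \<Longrightarrow> P \<precsim> R"
  unfolding coarser_def by (meson subset_trans)

lemma coarser_join1: "join P Q \<precsim> R \<Longrightarrow> P \<precsim> R"
  unfolding coarser_def join_def by fastforce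

lemma coarser_join2: "join P Q \<precsim> R \<Longrightarrow> Q \<precsim> R"
  unfolding coarser_def join_def by fastforce

lemma joinI: "Z \<in> P \<Longrightarrow> W \<in> Q \<Longrightarrow> x \<in> Z \<Longrightarrow> x \<in> W \<Longrightarrow> Z \<inter> W \<in> join P Q"
  unfolding join_def by blast

lemma coarser_joinI:
  assumes "P \<precsim> R" "Q \<precsim> R" "{} \<notin> R"
  shows "join P Q \<precsim> R"
  unfolding coarser_def
proof
  fix V assume V: "V \<in> R"
  obtain Z where "Z \<in> P" "V \<subseteq> Z" using assms(1) V unfolding coarser_def by blast
  moreover obtain W where "W \<in> Q" "V \<subseteq> W" using assms(2) V unfolding coarser_def by blast
  moreover obtain x where "x \<in> V" using V assms(3) by (metis equals0I)
  ultimately show "\<exists>W\<in>join P Q. V \<subseteq> W"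
    by (intro bexI[OF _ joinI[of Z P W Q x]] Int_greatest) auto
qed

lemma clopen_partition_join:
  assumes P: "clopen_partition X P" and Q: "clopen_partition X Q"
  shows "clopen_partition X (join P Q)"
proof (rule clopen_partitionI)
  note P' = clopen_partitionD[OF P] and Q' = clopen_partitionD[OF Q]
  have "join P Q \<subseteq> (\<lambda>(Z, W). Z \<inter> W) ` (P \<times> Q)" by (auto simp: join_def)
  then show "finite (join P Q)" using P'(1) Q'(1) by (meson finite_SigmaI finite_imageI finite_subset)
  show "\<Union>(join P Q) = topspace X"
  proof
    show "\<Union>(join P Q) \<subseteq> topspace X" using P'(6) by (auto simp: join_def)
    show "topspace X \<subseteq> \<Union>(join P Q)"
    proof
      fix x assume "x \<in> topspace X"
      then obtain Z W where "Z \<in> P" "x \<in> Z" "W \<in> Q" "x \<in> W" using P'(8) Q'(8) by meson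
      then show "x \<in> \<Union>(join P Q)" using joinI[of Z P W Q x] by blast
    qed
  qed
  show "Z \<noteq> {}" if "Z \<in> join P Q" for Z using that by (auto simp: join_def)
  show "openin X Z" if "Z \<in> join P Q" for Z using that P'(4) Q'(4) by (auto simp: join_def)
  show "Z = W" if ZW: "Z \<in> join P Q" "W \<in> join P Q" "x \<in> Z" "x \<in> W" for Z W x
  proof -
    obtain A B C D where *: "Z = A \<inter> B" "A \<in> P" "B \<in> Q" "W = C \<inter> D" "C \<in> P" "D \<in> Q"
      using ZW(1,2) unfolding join_def by blast
    then have "A = C" "B = D" using P'(7)[of A C x] Q'(7)[of B D x] ZW(3,4) by simp_all
    with * show ?thesis by simp
  qed
qed

lemma clopen_partition_image:
  assumes h: "homeomorphic_map X Y h" and P: "clopen_partition X P"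
  shows "clopen_partition Y ((`) h ` P)"
proof (rule clopen_partitionI)
  note P' = clopen_partitionD[OF P]
  note inj = homeomorphic_imp_injective_map[OF h]
  show "finite ((`) h ` P)" using P'(1) by simp
  show "\<Union>((`) h ` P) = topspace Y"
    using P'(2) homeomorphic_imp_surjective_map[OF h] by (metis image_Union)
  show "Z \<noteq> {}" if "Z \<in> (`) h ` P" for Z using that P'(3) by auto
  show "openin Y Z" if "Z \<in> (`) h ` P" for Z
    using that P'(4,6) homeomorphic_map_openness[OF h] by auto
  show "Z = W" if ZW: "Z \<in> (`) h ` P" "W \<in> (`) h ` P" "y \<in> Z" "y \<in> W" for Z W y
  proof -
    obtain A B a b where *: "A \<in> P" "Z = h ` A" "B \<in> P" "W = h ` B" "a \<in> A" "b \<in> B" "h a = y" "h b = y"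
      using ZW by auto
    then have "a \<in> topspace X" "b \<in> topspace X" using P'(6) by blast+
    with * have "a = b" using inj_onD[OF inj, of a b] by simp
    with * P'(7) show ?thesis by metis
  qed
qed

lemma coarser_image: "P \<precsim> Q \<Longrightarrow> (`) h ` P \<precsim> (`) h ` Q"
  unfolding coarser_def by (metis (no_types, lifting) image_iff image_mono)


section \<open>Refined sequences without metrics\<close>

lemma HomeoD:
  assumes "(X, \<phi>) \<in> Homeo"
  shows "topspace X \<noteq> {}" "totally_disconnected_space X" "compact_space X" "metrizable_space X"
    "Hausdorff_space X" "homeomorphic_map X X \<phi>" "bij_betw \<phi> (topspace X) (topspace X)"
  using assms homeomorphic_imp_injective_map[of X X \<phi>] homeomorphic_imp_surjective_map[of X X \<phi>]
  by (auto simp: Homeo_def metrizable_imp_Hausdorff_space bij_betw_def)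

text \<open>The red edges at level \<open>n\<close> compare \<open>P (Suc n)\<close> with the image of \<open>P n\<close> under this map.
  Writing the odd levels with the inverse of \<open>\<phi>\<close> makes the even and the odd case the same.\<close>

definition twist :: "'a system \<Rightarrow> nat \<Rightarrow> 'a \<Rightarrow> 'a" where
  "twist S n = (if even n then snd S else inv_into (topspace (fst S)) (snd S))"

lemma homeomorphic_map_inv_into:
  assumes "homeomorphic_map X Y f"
  shows "homeomorphic_map Y X (inv_into (topspace X) f)"
proof -
  obtain g where g: "homeomorphic_maps X Y f g" using assms by (auto simp: homeomorphic_map_maps)
  have "inv_into (topspace X) f y = g y" if "y \<in> topspace Y" for y
  proof -
    have "f (g y) = y" "g y \<in> topspace X"
      using g that by (auto simp: homeomorphic_maps_def continuous_map_def)
    then show ?thesis using homeomorphic_imp_injective_map[OF assms] by (metis inv_into_f_f)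
  qed
  moreover have "homeomorphic_map Y X g"
    using g homeomorphic_maps_map homeomorphic_maps_sym by metis
  ultimately show ?thesis by (metis homeomorphic_map_eq)
qed

lemma homeomorphic_map_twist:
  assumes "homeomorphic_map X X \<phi>"
  shows "homeomorphic_map X X (twist (X, \<phi>) n)"
  using assms homeomorphic_map_inv_into by (auto simp: twist_def)

lemma twist_twist:
  assumes "bij_betw \<phi> (topspace X) (topspace X)" "x \<in> topspace X"
  shows "twist (X, \<phi>) (Suc n) (twist (X, \<phi>) n x) = x"
  using assms by (auto simp: twist_def bij_betw_inv_into_left bij_betw_inv_into_right)

lemma bij_betw_twist:
  assumes "bij_betw \<phi> (topspace X) (topspace X)"
  shows "bij_betw (twist (X, \<phi>) n) (topspace X) (topspace X)"
  using assms bij_betw_inv_into by (auto simp: twist_def)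

lemma preimage_part_twist:
  assumes \<phi>: "bij_betw \<phi> (topspace X) (topspace X)" and P: "clopen_partition X P" and "odd n"
  shows "preimage_part (X, \<phi>) P = (`) (twist (X, \<phi>) n) ` P"
proof -
  have "{x \<in> topspace X. \<phi> x \<in> Z} = inv_into (topspace X) \<phi> ` Z" if "Z \<subseteq> topspace X" for Z
  proof (intro equalityI subsetI)
    fix x assume "x \<in> {x \<in> topspace X. \<phi> x \<in> Z}"
    then show "x \<in> inv_into (topspace X) \<phi> ` Z"
      using bij_betw_inv_into_left[OF \<phi>, of x] by (metis (no_types, lifting) image_eqI mem_Collect_eq)
  next
    fix x assume "x \<in> inv_into (topspace X) \<phi> ` Z"
    then show "x \<in> {x \<in> topspace X. \<phi> x \<in> Z}"
      using that bij_betw_inv_into_right[OF \<phi>] bij_betwE[OF bij_betw_inv_into[OF \<phi>]] by auto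
  qed
  then have "(\<lambda>Z. {x \<in> topspace X. \<phi> x \<in> Z}) ` P = (`) (twist (X, \<phi>) n) ` P"
    using clopen_partitionD(6)[OF P] \<open>odd n\<close> by (intro image_cong) (simp_all add: twist_def)
  then show ?thesis by (simp add: preimage_part_def setcompr_eq_image)
qed

lemma image_part_twist: "even n \<Longrightarrow> image_part \<phi> P = (`) (twist (X, \<phi>) n) ` P"
  by (auto simp: image_part_def twist_def)

text \<open>For nested clopen partitions of a compact metrizable space this condition stands for both
  topological requirements on a refined sequence: that the cells generate the topology and that their diameters tend to zero.\<close>

definition small_cells :: "'a topology \<Rightarrow> (nat \<Rightarrow> 'a set set) \<Rightarrow> bool" where
  "small_cells X P \<longleftrightarrow> (\<forall>U x. openin X U \<longrightarrow> x \<in> U \<longrightarrow> (\<exists>n. \<exists>Z \<in> P n. x \<in> Z \<and> Z \<subseteq> U))"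

lemma coarser_mono:
  assumes "\<And>n. P n \<precsim> P (Suc n)" "m \<le> n"
  shows "P m \<precsim> P n"
  using assms(2) by (induction rule: dec_induct) (auto intro: coarser_refl coarser_trans assms(1))

lemma nested_cell:
  assumes P: "\<And>n. clopen_partition X (P n)" and nest: "\<And>n. P n \<precsim> P (Suc n)"
    and "m \<le> n" "Z \<in> P m" "W \<in> P n" "x \<in> Z" "x \<in> W"
  shows "W \<subseteq> Z"
proof -
  obtain Z' where "Z' \<in> P m" "W \<subseteq> Z'"
    using coarser_mono[of P m n, OF nest \<open>m \<le> n\<close>] \<open>W \<in> P n\<close> unfolding coarser_def by blast
  with assms show ?thesis using clopen_partitionD(7)[OF P] by blast
qed

text \<open>Two cells of a nested sequence of partitions are disjoint or one contains the other. So the cells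
  are not only a subbase but a base of the topology that they generate.\<close>

lemma small_cells_generated:
  assumes P: "\<And>n. clopen_partition X (P n)" and nest: "\<And>n. P n \<precsim> P (Suc n)"
  shows "small_cells X P \<longleftrightarrow> X = topology_generated_by (\<Union>n. P n)"
proof
  assume small: "small_cells X P"
  show "X = topology_generated_by (\<Union>n. P n)"
    unfolding topology_eq
  proof (intro allI iffI)
    fix U assume U: "openin X U"
    have "U = \<Union>{Z \<in> (\<Union>n. P n). Z \<subseteq> U}"
    proof (intro equalityI subsetI)
      fix x assume "x \<in> U"
      with small U obtain n Z where "Z \<in> P n" "x \<in> Z" "Z \<subseteq> U" unfolding small_cells_def by meson
      then show "x \<in> \<Union>{Z \<in> (\<Union>n. P n). Z \<subseteq> U}" by blast
    qed blast
    moreover have "openin (topology_generated_by (\<Union>n. P n)) (\<Union>{Z \<in> (\<Union>n. P n). Z \<subseteq> U})"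
      by (intro openin_Union) (auto intro: topology_generated_by_Basis)
    ultimately show "openin (topology_generated_by (\<Union>n. P n)) U" by simp
  next
    fix U assume "openin (topology_generated_by (\<Union>n. P n)) U"
    then have "generate_topology_on (\<Union>n. P n) U" by (rule openin_topology_generated_by)
    then show "openin X U"
    proof (rule generate_topology_on_coarsest[OF istopology_openin, rotated])
      fix Z assume "Z \<in> (\<Union>n. P n)"
      then show "openin X Z" using clopen_partitionD(4)[OF P] by auto
    qed
  qed
next
  assume gen: "X = topology_generated_by (\<Union>n. P n)"
  have "\<exists>n. \<exists>Z \<in> P n. x \<in> Z \<and> Z \<subseteq> U" if "generate_topology_on (\<Union>n. P n) U" "x \<in> U" for U x
    using that
  proof (induction arbitrary: x rule: generate_topology_on.induct)
    case (Int A B)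
    then obtain m n Z W where *: "Z \<in> P m" "x \<in> Z" "Z \<subseteq> A" "W \<in> P n" "x \<in> W" "W \<subseteq> B"
      by (meson IntD1 IntD2)
    show ?case
    proof (cases "m \<le> n")
      case True
      then have "W \<subseteq> Z" using nested_cell[of X P, OF P nest True] * by blast
      then show ?thesis using * by blast
    next
      case False
      then have "Z \<subseteq> W" using nested_cell[of X P n m W Z x, OF P nest] * by simp
      then show ?thesis using * by blast
    qed
  next
    case (UN K)
    then show ?case by (meson Union_iff Sup_upper subset_trans)
  qed auto
  moreover have "openin X U \<Longrightarrow> generate_topology_on (\<Union>n. P n) U" for U
    using gen openin_topology_generated_by by metis
  ultimately show "small_cells X P" unfolding small_cells_def by blast
qed

text \<open>In a compact space small cells are uniformly small: this is the Lebesgue number lemma.\<close>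

lemma cells_subordinate:
  assumes X: "compact_space X"
    and P: "\<And>n. clopen_partition X (P n)" and nest: "\<And>n. P n \<precsim> P (Suc n)"
    and small: "small_cells X P"
    and cover: "\<And>x. x \<in> topspace X \<Longrightarrow> \<exists>U \<in> \<U>. openin X U \<and> x \<in> U"
  shows "\<exists>N. \<forall>n \<ge> N. \<forall>Z \<in> P n. \<exists>U \<in> \<U>. Z \<subseteq> U"
proof -
  define \<V> where "\<V> = {Z. (\<exists>n. Z \<in> P n) \<and> (\<exists>U \<in> \<U>. Z \<subseteq> U)}"
  have "topspace X \<subseteq> \<Union>\<V>"
  proof
    fix x assume "x \<in> topspace X"
    then obtain U where U: "U \<in> \<U>" "openin X U" "x \<in> U" using cover by blast
    then obtain n Z where "Z \<in> P n" "x \<in> Z" "Z \<subseteq> U" using small unfolding small_cells_def by blast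
    with U show "x \<in> \<Union>\<V>" unfolding \<V>_def by blast
  qed
  moreover have "\<forall>V \<in> \<V>. openin X V" using clopen_partitionD(4)[OF P] by (auto simp: \<V>_def)
  ultimately obtain \<F> where \<F>: "finite \<F>" "\<F> \<subseteq> \<V>" "topspace X \<subseteq> \<Union>\<F>"
    using X unfolding compact_space_alt by meson
  define lev where "lev Z = (LEAST n. Z \<in> P n)" for Z
  have lev: "Z \<in> P (lev Z)" if "Z \<in> \<F>" for Z
    using \<F>(2) that unfolding lev_def \<V>_def by (auto intro: LeastI)
  obtain N where N: "\<And>Z. Z \<in> \<F> \<Longrightarrow> lev Z \<le> N"
    using finite_nat_set_iff_bounded_le[of "lev ` \<F>"] \<F>(1) by auto
  have "\<exists>U \<in> \<U>. Z \<subseteq> U" if n: "N \<le> n" and Z: "Z \<in> P n" for n Z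
  proof -
    obtain x where x: "x \<in> Z" using clopen_partitionD(3)[OF P Z] by blast
    then have "x \<in> topspace X" using clopen_partitionD(6)[OF P Z] by blast
    then obtain V where V: "V \<in> \<F>" "x \<in> V" using \<F>(3) by blast
    then have "Z \<subseteq> V"
      using nested_cell[of X P, OF P nest _ lev[OF V(1)] Z] x N[OF V(1)] n by simp
    moreover obtain U where "U \<in> \<U>" "V \<subseteq> U" using V(1) \<F>(2) unfolding \<V>_def by blast
    ultimately show ?thesis by blast
  qed
  then show ?thesis by blast
qed

lemma eventually_finer:
  assumes X: "compact_space X"
    and P: "\<And>n. clopen_partition X (P n)" and nest: "\<And>n. P n \<precsim> P (Suc n)"
    and small: "small_cells X P" and A: "clopen_partition X A"
  shows "\<exists>N. \<forall>n \<ge> N. A \<precsim> P n"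
  unfolding coarser_def
proof (rule cells_subordinate[of X P, OF X P nest small])
  fix x assume "x \<in> topspace X"
  then obtain Z where "Z \<in> A" "x \<in> Z" using clopen_partitionD(8)[OF A] by blast
  then show "\<exists>U \<in> A. openin X U \<and> x \<in> U" using clopen_partitionD(4)[OF A] by blast
qed

lemma part_diam_tendsto_0:
  assumes X: "compact_space X" and ne: "topspace X \<noteq> {}"
    and P: "\<And>n. clopen_partition X (P n)" and nest: "\<And>n. P n \<precsim> P (Suc n)"
    and small: "small_cells X P"
    and d: "Metric_space (topspace X) d" "Metric_space.mtopology (topspace X) d = X"
  shows "(\<lambda>n. part_diam d (P n)) \<longlonglongrightarrow> 0"
proof (rule LIMSEQ_I)
  fix e :: real assume e: "0 < e"
  interpret M: Metric_space "topspace X" d by (rule d(1))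
  let ?B = "(\<lambda>x. M.mball x (e / 3)) ` topspace X"
  have "\<exists>N. \<forall>n \<ge> N. \<forall>Z \<in> P n. \<exists>U \<in> ?B. Z \<subseteq> U"
  proof (rule cells_subordinate[of X P, OF X P nest small])
    fix x assume "x \<in> topspace X"
    then show "\<exists>U \<in> ?B. openin X U \<and> x \<in> U"
      using e M.openin_mball[of x "e / 3"] unfolding d(2) by (intro bexI[of _ "M.mball x (e/3)"]) auto
  qed
  then obtain N where N: "\<And>n Z. N \<le> n \<Longrightarrow> Z \<in> P n \<Longrightarrow> \<exists>x \<in> topspace X. Z \<subseteq> M.mball x (e / 3)" by auto
  have "norm (part_diam d (P n) - 0) < e" if n: "N \<le> n" for n
  proof -
    have "0 \<le> set_diam d Z \<and> set_diam d Z \<le> 2 * e / 3" if Z: "Z \<in> P n" for Z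
    proof -
      obtain c where c: "Z \<subseteq> M.mball c (e / 3)" using N[OF n Z] by blast
      have le: "(case p of (x, y) \<Rightarrow> d x y) \<le> 2 * e / 3" if pZ: "p \<in> Z \<times> Z" for p
      proof -
        obtain x y where p: "p = (x, y)" "x \<in> Z" "y \<in> Z" using pZ by blast
        then have "x \<in> M.mball c (e / 3)" "y \<in> M.mball c (e / 3)" using c by auto
        then have "d c x < e / 3" "d c y < e / 3" "c \<in> topspace X" "x \<in> topspace X" "y \<in> topspace X"
          by (auto simp: M.in_mball)
        then have "d x y \<le> 2 * e / 3" using M.triangle[of x c y] M.commute[of x c] by simp
        then show ?thesis using p by simp
      qed
      obtain z where z: "z \<in> Z" using clopen_partitionD(3)[OF P Z] by blast
      have "bdd_above ((\<lambda>(x, y). d x y) ` (Z \<times> Z))"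
        using le by (intro bdd_aboveI[of _ "2 * e / 3"]) auto
      then have "0 \<le> set_diam d Z"
        unfolding set_diam_def using z by (intro cSUP_upper2[of _ _ "(z, z)"]) auto
      moreover have "set_diam d Z \<le> 2 * e / 3"
        unfolding set_diam_def using z le by (intro cSUP_least) auto
      ultimately show ?thesis by simp
    qed
    moreover have "finite (P n)" using clopen_partitionD(1)[OF P] .
    moreover have "P n \<noteq> {}" using clopen_partitionD(2)[OF P, of n] ne by (metis Sup_empty)
    ultimately have "part_diam d (P n) \<in> {0..2 * e / 3}"
      unfolding part_diam_def by (metis (no_types, lifting) Max_in atLeastAtMost_iff finite_imageI
          image_iff image_is_empty)
    then show ?thesis using e by simp
  qed
  then show "\<exists>no. \<forall>n\<ge>no. norm (part_diam d (P n) - 0) < e" by blast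
qed

text \<open>The metric clause follows from the others by compactness, the clauses for even and for odd levels
  have the same form in terms of the twist, and the join condition contains the nesting, because a
  join refines both of its arguments.\<close>

lemma refined_seq_iff:
  assumes S: "(X, \<phi>) \<in> Homeo"
  shows "refined_seq (X, \<phi>) P \<longleftrightarrow> (\<forall>n. clopen_partition X (P n)) \<and> small_cells X P \<and>
    (\<forall>n. join (P n) ((`) (twist (X, \<phi>) n) ` P n) \<precsim> P (Suc n))"
proof (cases "\<forall>n. clopen_partition X (P n)")
  case True
  then have P: "clopen_partition X (P n)" for n by blast
  note bij = HomeoD(7)[OF S]
  let ?J = "\<lambda>n. join (P n) ((`) (twist (X, \<phi>) n) ` P n) \<precsim> P (Suc n)"
  have dyn: "(\<forall>j. join (P (2*j)) (image_part \<phi> (P (2*j))) \<precsim> P (2*j + 1)) \<and>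
     (\<forall>j. join (P (2*j + 1)) (preimage_part (X, \<phi>) (P (2*j + 1))) \<precsim> P (2*j + 2)) \<longleftrightarrow> (\<forall>n. ?J n)"
    (is "?E \<and> ?O \<longleftrightarrow> _")
  proof -
    have "image_part \<phi> A = (`) (twist (X, \<phi>) (2 * j)) ` A" for j A
      by (rule image_part_twist) simp
    then have "?E \<longleftrightarrow> (\<forall>j. ?J (2*j))" by simp
    moreover have "?O \<longleftrightarrow> (\<forall>j. ?J (2*j + 1))"
      using preimage_part_twist[OF bij P, of "Suc (2 * j)" "Suc (2 * j)" for j] by simp
    moreover have "(\<forall>n. ?J n) \<longleftrightarrow> (\<forall>j. ?J (2*j)) \<and> (\<forall>j. ?J (2*j + 1))"
    proof (intro iffI allI)
      fix n assume "(\<forall>j. ?J (2*j)) \<and> (\<forall>j. ?J (2*j + 1))"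
      then show "?J n" by (cases "even n") (metis evenE, metis oddE)
    qed blast
    ultimately show ?thesis by blast
  qed
  have "\<exists>d. Metric_space (topspace X) d \<and> Metric_space.mtopology (topspace X) d = X"
    using HomeoD(4)[OF S] unfolding metrizable_space_def by (metis Metric_space.topspace_mtopology)
  then have metric: "\<exists>d. Metric_space (topspace X) d \<and> Metric_space.mtopology (topspace X) d = X \<and>
          (\<lambda>n. part_diam d (P n)) \<longlonglongrightarrow> 0" if "\<And>n. P n \<precsim> P (Suc n)" "small_cells X P"
    using part_diam_tendsto_0[of X P, OF HomeoD(3,1)[OF S] P that] by blast
  have nest: "P n \<precsim> P (Suc n)" if "\<forall>n. ?J n" for n
    using that coarser_join1 by blast
  show ?thesis
    unfolding refined_seq_def prod.case dyn
    using True small_cells_generated[of X P, OF P] nest metric by blast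
next
  case False
  then show ?thesis by (auto simp: refined_seq_def)
qed


section \<open>Existence of refined sequences\<close>

text \<open>In a compact Hausdorff space a component can be separated by clopen sets from any closed set
  disjoint from it, and here the components are points.\<close>

lemma clopen_neighbourhood:
  assumes "totally_disconnected_space X" "compact_space X" "Hausdorff_space X" "openin X U" "x \<in> U"
  obtains C where "openin X C" "closedin X C" "x \<in> C" "C \<subseteq> U"
proof -
  have x: "x \<in> topspace X" using assms(4,5) openin_subset by blast
  obtain a where "connected_component_of_set X x \<subseteq> {a}"
    using assms(1) connectedin_connected_component_of unfolding totally_disconnected_space_def by metis
  then have "connected_component_of_set X x = {x}"
    using x connected_component_of_refl[of X x] by blast
  then have "{x} \<in> connected_components_of X" using x by (auto simp: connected_components_of_def)
  then obtain C D where "openin X C" "openin X D" "disjnt C D" "C \<union> D = topspace X" "{x} \<subseteq> C" "C \<subseteq> U"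
    using wilder_locally_compact_component_thm[of X "{x}" U] assms x
    by (metis compact_imp_locally_compact_space compactin_sing empty_subsetI insert_subset)
  moreover from this have "C = topspace X - D" by (auto simp: disjnt_iff)
  ultimately show thesis using that[of C] by auto
qed

text \<open>By compactness there is a finite clopen cover that is subordinate to \<open>\<U>\<close>, and its atoms form
  the partition.\<close>

lemma subordinate_clopen_partition:
  assumes X: "totally_disconnected_space X" "compact_space X" "Hausdorff_space X"
    and cover: "\<And>x. x \<in> topspace X \<Longrightarrow> \<exists>U \<in> \<U>. openin X U \<and> x \<in> U"
  obtains A where "clopen_partition X A" "\<And>Z. Z \<in> A \<Longrightarrow> \<exists>U \<in> \<U>. Z \<subseteq> U"
proof -
  let ?C = "{C. openin X C \<and> closedin X C \<and> (\<exists>U \<in> \<U>. C \<subseteq> U)}"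
  have "topspace X \<subseteq> \<Union>?C"
  proof
    fix x assume "x \<in> topspace X"
    then obtain U where U: "U \<in> \<U>" "openin X U" "x \<in> U" using cover by blast
    obtain C where "openin X C" "closedin X C" "x \<in> C" "C \<subseteq> U"
      using clopen_neighbourhood[OF X U(2,3)] .
    with U show "x \<in> \<Union>?C" by blast
  qed
  then obtain \<F> where \<F>: "finite \<F>" "\<F> \<subseteq> ?C" "topspace X \<subseteq> \<Union>\<F>"
    using X(2)[unfolded compact_space_alt, rule_format, of ?C] by blast
  have "\<exists>A. clopen_partition X A \<and> (\<forall>Z \<in> A. \<forall>C \<in> \<F>. Z \<subseteq> C \<or> Z \<inter> C = {})"
    using \<F>(1,2)
  proof (induction rule: finite_induct)
    case empty
    have "clopen_partition X ({topspace X} - {{}})" by (rule clopen_partitionI) auto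
    then show ?case by blast
  next
    case (insert C \<F>)
    have "\<F> \<subseteq> ?C" using insert.prems by simp
    from insert.IH[OF this] obtain A where A: "clopen_partition X A"
      "\<forall>Z \<in> A. \<forall>C \<in> \<F>. Z \<subseteq> C \<or> Z \<inter> C = {}" by (elim exE conjE)
    have C: "openin X C" "closedin X C" "C \<subseteq> topspace X"
      using insert.prems openin_subset by auto
    have "clopen_partition X ({C, topspace X - C} - {{}})"
      using C by (intro clopen_partitionI) auto
    from clopen_partition_join[OF A(1) this]
    have "clopen_partition X (join A ({C, topspace X - C} - {{}}))" .
    moreover have "Z \<subseteq> D \<or> Z \<inter> D = {}"
      if ZD: "Z \<in> join A ({C, topspace X - C} - {{}})" "D \<in> insert C \<F>" for Z D
    proof -
      obtain V W where VW: "Z = V \<inter> W" "V \<in> A" "W = C \<or> W = topspace X - C"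
        using ZD(1) by (auto simp: join_def)
      show ?thesis
      proof (cases "D = C")
        case True
        then show ?thesis using VW by blast
      next
        case False
        then have "V \<subseteq> D \<or> V \<inter> D = {}" using VW(2) A(2) ZD(2) by simp
        then show ?thesis using VW(1) by blast
      qed
    qed
    ultimately show ?case by blast
  qed
  then obtain A where A: "clopen_partition X A" "\<forall>Z \<in> A. \<forall>C \<in> \<F>. Z \<subseteq> C \<or> Z \<inter> C = {}"
    by (elim exE conjE)
  have "\<exists>U \<in> \<U>. Z \<subseteq> U" if Z: "Z \<in> A" for Z
  proof -
    obtain x where x: "x \<in> Z" "x \<in> topspace X" using clopen_partitionD(3,6)[OF A(1) Z] by blast
    then obtain C where C: "C \<in> \<F>" "x \<in> C" using \<F>(3) by blast
    have "Z \<subseteq> C \<or> Z \<inter> C = {}" using A(2) Z C(1) by simp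
    then have "Z \<subseteq> C" using x C(2) by blast
    moreover have "\<exists>U \<in> \<U>. C \<subseteq> U" using subsetD[OF \<F>(2) C(1)] by simp
    ultimately show ?thesis by (meson subset_trans)
  qed
  then show thesis by (rule that[OF A(1)])
qed

text \<open>Each partition is the join of its predecessor, the twisted image of its predecessor, and a
  partition into cells that lie in balls of radius \<open>1 / Suc n\<close>.\<close>

lemma refined_seq_exists:
  assumes S: "(X, \<phi>) \<in> Homeo"
  shows "\<exists>P. refined_seq (X, \<phi>) P"
proof -
  note X = HomeoD[OF S]
  obtain M d where "Metric_space M d" and Xd: "X = Metric_space.mtopology M d"
    using X(4) unfolding metrizable_space_def by blast
  then interpret Metric_space M d by simp
  have M: "topspace X = M" unfolding Xd by simp
  have "\<exists>A. clopen_partition X A \<and> (\<forall>Z \<in> A. \<exists>y. Z \<subseteq> mball y (1 / real (Suc n)))" for n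
  proof -
    have "\<exists>U \<in> range (\<lambda>y. mball y (1 / real (Suc n))). openin X U \<and> x \<in> U" if "x \<in> topspace X" for x
      using that unfolding Xd by (intro bexI[of _ "mball x (1 / real (Suc n))"]) auto
    then obtain A where "clopen_partition X A"
      "\<And>Z. Z \<in> A \<Longrightarrow> \<exists>U \<in> range (\<lambda>y. mball y (1 / real (Suc n))). Z \<subseteq> U"
      using subordinate_clopen_partition[OF X(2,3,5)] by metis
    then show ?thesis by blast
  qed
  then obtain A where A: "\<And>n. clopen_partition X (A n)"
    "\<And>n Z. Z \<in> A n \<Longrightarrow> \<exists>y. Z \<subseteq> mball y (1 / real (Suc n))" by metis
  let ?tw = "\<lambda>n B. (`) (twist (X, \<phi>) n) ` B"
  define P where "P = rec_nat (A 0) (\<lambda>n B. join (join B (?tw n B)) (A (Suc n)))"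
  have P0: "P 0 = A 0" and PS: "P (Suc n) = join (join (P n) (?tw n (P n))) (A (Suc n))" for n
    by (simp_all add: P_def)
  have clp: "clopen_partition X (P n)" for n
  proof (induction n)
    case (Suc n)
    then show ?case
      unfolding PS by (intro clopen_partition_join A(1)
          clopen_partition_image[OF homeomorphic_map_twist[OF X(6)]])
  qed (simp add: P0 A(1))
  have JP: "join (P n) (?tw n (P n)) \<precsim> P (Suc n)" for n
    using coarser_join1[OF coarser_refl] unfolding PS .
  have AP: "A n \<precsim> P n" for n
    by (cases n) (simp_all add: P0 PS coarser_refl coarser_join2[OF coarser_refl])
  have "small_cells X P"
    unfolding small_cells_def
  proof (intro allI impI)
    fix U x assume U: "openin X U" "x \<in> U"
    then obtain e where e: "e > 0" "mball x e \<subseteq> U" unfolding Xd openin_mtopology by blast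
    have xX: "x \<in> topspace X" using U openin_subset by blast
    obtain n where n: "2 / e < real (Suc n)" by (metis reals_Archimedean2 less_trans lessI of_nat_less_iff)
    then have n': "2 / real (Suc n) < e" using e(1) by (simp add: field_simps)
    obtain Z where Z: "Z \<in> P n" "x \<in> Z" using clopen_partitionD(8)[OF clp xX] by blast
    then obtain W where "W \<in> A n" "Z \<subseteq> W" using AP unfolding coarser_def by blast
    then obtain y where y: "Z \<subseteq> mball y (1 / real (Suc n))" using A(2) by blast
    have "Z \<subseteq> mball x e"
    proof
      fix z assume "z \<in> Z"
      then have "z \<in> mball y (1 / real (Suc n))" "x \<in> mball y (1 / real (Suc n))" using y Z(2) by auto
      then have *: "y \<in> M" "x \<in> M" "z \<in> M" "d y z < 1 / real (Suc n)" "d y x < 1 / real (Suc n)"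
        by auto
      then have "d x z < 1 / real (Suc n) + 1 / real (Suc n)"
        using triangle[of x y z] commute[of x y] by linarith
      also have "\<dots> = 2 / real (Suc n)" by simp
      finally show "z \<in> mball x e" using * n' by simp
    qed
    with Z e(2) show "\<exists>n. \<exists>Z\<in>P n. x \<in> Z \<and> Z \<subseteq> U" by blast
  qed
  then have "refined_seq (X, \<phi>) P" using refined_seq_iff[OF S] clp JP by blast
  then show ?thesis by (intro exI[of _ P])
qed

section \<open>Construction I\<close>

definition colour_map :: "'a system \<Rightarrow> colour \<Rightarrow> nat \<Rightarrow> 'a \<Rightarrow> 'a" where
  "colour_map S c n = (case c of Blue \<Rightarrow> (\<lambda>x. x) | Red \<Rightarrow> twist S n)"

lemma colour_map_simps [simp]:
  "colour_map S Blue n = (\<lambda>x. x)" "colour_map S Red n = twist S n"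
  by (simp_all add: colour_map_def)

lemma bij_betw_colour_map:
  assumes "bij_betw \<phi> (topspace X) (topspace X)"
  shows "bij_betw (colour_map (X, \<phi>) c n) (topspace X) (topspace X)"
  using bij_betw_twist[OF assms] bij_betw_id[unfolded id_def] by (cases c) auto

locale refined_system =
  fixes X :: "'a topology" and \<phi> :: "'a \<Rightarrow> 'a" and P :: "nat \<Rightarrow> 'a set set"
  assumes S: "(X, \<phi>) \<in> Homeo" and refined: "refined_seq (X, \<phi>) P"
begin

lemma part: "clopen_partition X (P n)"
  and small: "small_cells X P"
  and join: "join (P n) ((`) (twist (X, \<phi>) n) ` P n) \<precsim> P (Suc n)"
  using refined_seq_iff[OF S] refined by auto

lemma nest: "P n \<precsim> P (Suc n)"
  using coarser_join1[OF join] .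

lemmas bij = HomeoD(7)[OF S]
lemmas cm_bij = bij_betw_colour_map[OF bij]

text \<open>The images of the cells of \<open>P n\<close> under a colour map form a partition again, and \<open>P (Suc n)\<close>
  refines it. Hence each cell of \<open>P (Suc n)\<close> is the source of exactly one edge of each colour, and
  each cell of \<open>P n\<close> is the range of one.\<close>

lemma cover:
  assumes "W \<in> P (Suc n)"
  shows "\<exists>Z \<in> P n. W \<subseteq> colour_map (X, \<phi>) c n ` Z"
  using assms nest[of n] coarser_join2[OF join[of n]] by (cases c) (auto simp: coarser_def)

lemma unique:
  assumes "x \<in> colour_map (X, \<phi>) c n ` Z" "x \<in> colour_map (X, \<phi>) c n ` Z'" "Z \<in> P k" "Z' \<in> P k"
  shows "Z = Z'"
proof -
  obtain z z' where z: "z \<in> Z" "z' \<in> Z'" "colour_map (X, \<phi>) c n z = x" "colour_map (X, \<phi>) c n z' = x"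
    using assms(1,2) by auto
  then have "z \<in> topspace X" "z' \<in> topspace X" 
    using clopen_partitionD(6)[OF part assms(3)] clopen_partitionD(6)[OF part assms(4)] by auto
  with z have "z = z'" using cm_bij[of c n] by (metis bij_betw_def inj_onD)
  then show ?thesis using clopen_partitionD(7)[OF part assms(3,4)] z by blast
qed

lemma onto:
  assumes Z: "Z \<in> P n"
  shows "\<exists>W \<in> P (Suc n). W \<subseteq> colour_map (X, \<phi>) c n ` Z"
proof -
  obtain z where z: "z \<in> Z" "z \<in> topspace X" using clopen_partitionD(3,6)[OF part Z] by blast
  let ?x = "colour_map (X, \<phi>) c n z"
  have "?x \<in> topspace X" using bij_betwE[OF cm_bij] z(2) by blast
  then obtain W where W: "W \<in> P (Suc n)" "?x \<in> W" using clopen_partitionD(8)[OF part] by blast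
  then obtain Z' where Z': "Z' \<in> P n" "W \<subseteq> colour_map (X, \<phi>) c n ` Z'" using cover by blast
  have "Z' = Z"
  proof (rule unique[OF _ _ Z'(1) Z])
    show "?x \<in> colour_map (X, \<phi>) c n ` Z'" using W(2) Z'(2) by blast
    show "?x \<in> colour_map (X, \<phi>) c n ` Z" using z(1) by (rule imageI)
  qed
  with W Z' show ?thesis by blast
qed

text \<open>With the inverse of \<open>\<phi>\<close> at the odd levels all edges are inclusions into the image of a cell.\<close>

lemma edge_set_I_colour_map:
  "edge_set_I (X, \<phi>) P c n =
    {(c, n, W, Z) | W Z. W \<in> P (Suc n) \<and> Z \<in> P n \<and> W \<subseteq> colour_map (X, \<phi>) c n ` Z}"
proof -
  have "\<phi> ` W \<subseteq> Z \<longleftrightarrow> W \<subseteq> inv_into (topspace X) \<phi> ` Z"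
    if "W \<subseteq> topspace X" "Z \<subseteq> topspace X" for W Z
  proof
    assume "\<phi> ` W \<subseteq> Z"
    show "W \<subseteq> inv_into (topspace X) \<phi> ` Z"
    proof
      fix w assume w: "w \<in> W"
      then have "inv_into (topspace X) \<phi> (\<phi> w) = w"
        using bij_betw_inv_into_left[OF bij] that(1) by blast
      then show "w \<in> inv_into (topspace X) \<phi> ` Z"
        using w \<open>\<phi> ` W \<subseteq> Z\<close> by (metis image_eqI image_subset_iff)
    qed
  next
    assume L: "W \<subseteq> inv_into (topspace X) \<phi> ` Z"
    show "\<phi> ` W \<subseteq> Z"
    proof
      fix y assume "y \<in> \<phi> ` W"
      then obtain z where "z \<in> Z" "y = \<phi> (inv_into (topspace X) \<phi> z)" using L by blast
      then show "y \<in> Z" using bij_betw_inv_into_right[OF bij, of z] that(2) by auto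
    qed
  qed
  then have odd: "\<phi> ` W \<subseteq> Z \<longleftrightarrow> W \<subseteq> inv_into (topspace X) \<phi> ` Z" if "W \<in> P (Suc n)" "Z \<in> P n" for W Z
    using clopen_partitionD(6)[OF part] that by metis
  show ?thesis
  proof (cases c)
    case Blue
    then show ?thesis by (simp add: edge_set_I_def)
  next
    case Red
    then show ?thesis using odd by (auto simp: edge_set_I_def twist_def)
  qed
qed

abbreviation "D \<equiv> construction_I (X, \<phi>) P"

lemma D_simps:
  "vert D n = {n} \<times> P n" "src D (c, n, W, Z) = (Suc n, W)" "rng D (c, n, W, Z) = (n, Z)"
  by (simp_all add: construction_I_def Let_def)

lemma coloured_edges_D:
  "coloured_edges D c n =
    {(c, n, W, Z) | W Z. W \<in> P (Suc n) \<and> Z \<in> P n \<and> W \<subseteq> colour_map (X, \<phi>) c n ` Z}"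
proof -
  have tag: "fst e = c \<and> fst (snd e) = n" if "e \<in> edge_set_I (X, \<phi>) P c n" for e c n
    using that by (auto simp: edge_set_I_def)
  have "coloured_edges D c n = edge_set_I (X, \<phi>) P c n"
    by (cases c) (auto simp: construction_I_def Let_def blue_edges_def red_edges_def dest: tag)
  then show ?thesis by (simp add: edge_set_I_colour_map)
qed

lemma D_HDiag: "D \<in> HDiag"
proof (rule HDiagI)
  note colB = coloured_edges_D[of Blue, unfolded coloured_edges_simps]
    and colR = coloured_edges_D[of Red, unfolded coloured_edges_simps]
  show "finite (vert D n)" for n using clopen_partitionD(1)[OF part, of n] by (simp add: D_simps)
  have "P n \<noteq> {}" for n using clopen_partitionD(2)[OF part, of n] HomeoD(1)[OF S] by (metis Sup_empty)
  then show "vert D n \<noteq> {}" for n by (simp add: D_simps)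
  show "disjoint_family (vert D)" by (auto simp: D_simps disjoint_family_on_def)
  have edge: "edge D n = edge_set_I (X, \<phi>) P Blue n \<union> edge_set_I (X, \<phi>) P Red n" for n
    by (simp add: construction_I_def Let_def)
  show "edge D n = blue_edges D n \<union> red_edges D n" for n
    unfolding edge colB colR edge_set_I_colour_map ..
  show "disjoint_family (edge D)" unfolding edge by (auto simp: disjoint_family_on_def edge_set_I_def)
  show "blue_edges D n \<inter> red_edges D n = {}" for n unfolding colB colR by auto
  show "blue D v = {e \<in> blue_edges D n. rng D e = v}" if "v \<in> vert D n" for n v
    using that unfolding colB by (auto simp: construction_I_def Let_def edge_set_I_colour_map)
  show "red D v = {e \<in> red_edges D n. rng D e = v}" if "v \<in> vert D n" for n v
    using that unfolding colR by (auto simp: construction_I_def Let_def edge_set_I_colour_map)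
  show "bij_betw (src D) (coloured_edges D c n) (vert D (Suc n))" for c n
    unfolding bij_betw_def
  proof
    show "inj_on (src D) (coloured_edges D c n)"
    proof (rule inj_onI)
      fix e f assume "e \<in> coloured_edges D c n" "f \<in> coloured_edges D c n" "src D e = src D f"
      then obtain W Z Z' where *: "e = (c, n, W, Z)" "f = (c, n, W, Z')" "W \<in> P (Suc n)" "Z \<in> P n" "Z' \<in> P n"
        "W \<subseteq> colour_map (X, \<phi>) c n ` Z" "W \<subseteq> colour_map (X, \<phi>) c n ` Z'"
        unfolding coloured_edges_D by (auto simp: D_simps)
      obtain x where "x \<in> W" using clopen_partitionD(3)[OF part *(3)] by blast
      then have "Z = Z'" using unique[of x c n Z Z' n] * by blast
      with * show "e = f" by simp
    qed
    show "src D ` coloured_edges D c n = vert D (Suc n)"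
    proof (intro equalityI subsetI)
      fix w assume "w \<in> vert D (Suc n)"
      then obtain W where W: "w = (Suc n, W)" "W \<in> P (Suc n)" by (auto simp: D_simps)
      then obtain Z where "Z \<in> P n" "W \<subseteq> colour_map (X, \<phi>) c n ` Z" using cover by blast
      with W show "w \<in> src D ` coloured_edges D c n"
        unfolding coloured_edges_D by (intro image_eqI[of _ _ "(c, n, W, Z)"]) (auto simp: D_simps)
    qed (auto simp: coloured_edges_D D_simps)
  qed
  show "rng D ` coloured_edges D c n = vert D n" for c n
  proof (intro equalityI subsetI)
    fix v assume "v \<in> vert D n"
    then obtain Z where Z: "v = (n, Z)" "Z \<in> P n" by (auto simp: D_simps)
    then obtain W where "W \<in> P (Suc n)" "W \<subseteq> colour_map (X, \<phi>) c n ` Z" using onto by blast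
    with Z show "v \<in> rng D ` coloured_edges D c n"
      unfolding coloured_edges_D by (intro image_eqI[of _ _ "(c, n, W, Z)"]) (auto simp: D_simps)
  qed (auto simp: coloured_edges_D D_simps)
  fix n e0 e1 f0 f1
  assume "e0 \<in> blue_edges D n" "e1 \<in> blue_edges D (Suc n)" "f0 \<in> red_edges D n" "f1 \<in> red_edges D (Suc n)"
    and eqs: "rng D e1 = src D e0" "rng D f1 = src D f0" "src D f1 = src D e1"
  then obtain W W1 W1' Z Z' where e: "e0 = (Blue, n, W1, Z)" "e1 = (Blue, Suc n, W, W1)"
     "f0 = (Red, n, W1', Z')" "f1 = (Red, Suc n, W, W1')"
    and in_P: "W \<in> P (Suc (Suc n))" "Z \<in> P n" "Z' \<in> P n"
    and sub: "W \<subseteq> W1" "W1 \<subseteq> Z" "W \<subseteq> twist (X, \<phi>) (Suc n) ` W1'" "W1' \<subseteq> twist (X, \<phi>) n ` Z'"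
    unfolding colB colR by (auto simp: D_simps)
  \<comment> \<open>Two consecutive twists cancel, so both composites put \<open>W\<close> inside \<open>Z'\<close> and \<open>Z\<close>.\<close>
  have "twist (X, \<phi>) (Suc n) ` twist (X, \<phi>) n ` Z' = Z'"
  proof -
    have "(\<lambda>x. twist (X, \<phi>) (Suc n) (twist (X, \<phi>) n x)) ` Z' = (\<lambda>x. x) ` Z'"
      using clopen_partitionD(6)[OF part in_P(3)]
      by (intro image_cong refl twist_twist[OF bij] subsetD[of Z' "topspace X"])
    then show ?thesis by (simp add: image_image)
  qed
  moreover have "W \<subseteq> twist (X, \<phi>) (Suc n) ` twist (X, \<phi>) n ` Z'"
    using sub(3) image_mono[OF sub(4)] by (rule subset_trans)
  ultimately have "W \<subseteq> Z \<inter> Z'" using sub(1,2) by auto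
  moreover obtain x where "x \<in> W" using clopen_partitionD(3)[OF part in_P(1)] by blast
  ultimately have "Z = Z'" using clopen_partitionD(7)[OF part in_P(2,3)] by blast
  then show "rng D f0 = rng D e0" by (simp add: e D_simps)
qed

lemma parent_D:
  assumes "W \<in> P (Suc n)" "Z \<in> P n" "W \<subseteq> colour_map (X, \<phi>) c n ` Z"
  shows "parent D c n (Suc n, W) = (n, Z)"
  by (rule parent_eqI[OF D_HDiag, of "(c, n, W, Z)"]) (use assms in \<open>auto simp: coloured_edges_D D_simps\<close>)

lemma parent_D_cover:
  assumes W: "W \<in> P (Suc n)"
  obtains Z where "Z \<in> P n" "W \<subseteq> colour_map (X, \<phi>) c n ` Z" "parent D c n (Suc n, W) = (n, Z)"
  using cover[OF W] parent_D[OF W] by meson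

lemma ancestor_Blue_D:
  "W \<in> P (a + k) \<Longrightarrow> Z \<in> P a \<Longrightarrow> W \<subseteq> Z \<Longrightarrow> ancestor D Blue a k (a + k, W) = (a, Z)"
proof (induction k arbitrary: a Z)
  case 0
  obtain x where "x \<in> W" using clopen_partitionD(3)[OF part 0(1)] by blast
  then have "W = Z" using 0 clopen_partitionD(7)[OF part, of W 0 Z x] clopen_partitionD(7)[OF part, of W a Z x] by auto
  then show ?case by simp
next
  case (Suc k)
  have le: "Suc a \<le> a + Suc k" by simp
  obtain W1 where W1: "W1 \<in> P (Suc a)" "W \<subseteq> W1"
    using coarser_mono[of P "Suc a" "a + Suc k", OF nest le] Suc.prems(1) unfolding coarser_def by blast
  have W1': "ancestor D Blue (Suc a) k (Suc a + k, W) = (Suc a, W1)"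
    using Suc.IH[of "Suc a" W1] Suc.prems(1) W1 by simp
  obtain x where "x \<in> W" using clopen_partitionD(3)[OF part Suc.prems(1)] by blast
  then have "W1 \<subseteq> Z" using nested_cell[of X P a "Suc a" Z W1 x, OF part nest] W1 Suc.prems(2,3) by auto
  then show ?case using parent_D[OF W1(1) Suc.prems(2), of Blue] W1' by simp
qed

text \<open>A red path of odd length starts at the top with one red step, and the remaining even number of
  steps may be taken blue. So it amounts to one twist followed by inclusions.\<close>

lemma ancestor_odd_D:
  assumes W: "W \<in> P (a + k)" and Z: "Z \<in> P a" and "odd k"
    and sub: "W \<subseteq> colour_map (X, \<phi>) c a ` Z"
  shows "ancestor D c a k (a + k, W) = (a, Z)"
proof (cases c)
  case Blue
  then show ?thesis using ancestor_Blue_D[OF W Z] sub by simp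
next
  case Red
  obtain j where k: "k = Suc (2 * j)" using \<open>odd k\<close> by (auto elim: oddE)
  have W': "W \<in> P (Suc (a + 2 * j))" using W k by simp
  obtain Z1 where Z1: "Z1 \<in> P (a + 2 * j)" "W \<subseteq> colour_map (X, \<phi>) Red (a + 2 * j) ` Z1"
    "parent D Red (a + 2 * j) (Suc (a + 2 * j), W) = (a + 2 * j, Z1)"
    using parent_D_cover[OF W'] .
  have tw: "twist (X, \<phi>) (a + 2 * j) = twist (X, \<phi>) a" by (simp add: twist_def)
  obtain Z2 where Z2: "Z2 \<in> P a" "Z1 \<subseteq> Z2"
    using coarser_mono[of P a "a + 2 * j", OF nest] Z1(1) unfolding coarser_def by auto
  obtain x where x: "x \<in> W" using clopen_partitionD(3)[OF part W] by blast
  have "Z2 = Z"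
  proof (rule unique[OF _ _ Z2(1) Z])
    show "x \<in> colour_map (X, \<phi>) Red a ` Z2" using x Z1(2) Z2(2) tw by auto
    show "x \<in> colour_map (X, \<phi>) Red a ` Z" using x sub Red by auto
  qed
  have "ancestor D Red a k (a + k, W) = ancestor D Red a (2 * j) (a + 2 * j, Z1)"
    unfolding k ancestor_Suc_inner using Z1(3) by simp
  also have "\<dots> = ancestor D Blue a (2 * j) (a + 2 * j, Z1)"
    using ancestor_even[OF D_HDiag, of "(a + 2 * j, Z1)" a j] Z1(1) by (simp add: D_simps)
  also have "\<dots> = (a, Z)" using ancestor_Blue_D[OF Z1(1) Z2] \<open>Z2 = Z\<close> by simp
  finally show ?thesis using Red by simp
qed

end

text \<open>The even start and the odd steps serve to keep the parity of the levels, on which the red edges of Construction I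
  depend.\<close>

lemma contraction_seq_iff:
  "contraction_seq m \<longleftrightarrow> strict_mono m \<and> (\<forall>n. even (m n) = even n)"
proof
  assume m: "contraction_seq m"
  have "even (m n) = even n" for n
  proof (induction n)
    case (Suc n)
    have "odd (m (Suc n) - m n)" "m n < m (Suc n)"
      using m contraction_seq_lt[OF m] by (auto simp: contraction_seq_def)
    with Suc show ?case by auto
  qed (use m in \<open>simp add: contraction_seq_def\<close>)
  then show "strict_mono m \<and> (\<forall>n. even (m n) = even n)" using m by (simp add: contraction_seq_def)
next
  assume m: "strict_mono m \<and> (\<forall>n. even (m n) = even n)"
  then have "m n < m (Suc n)" for n by (simp add: strict_mono_Suc_iff)
  then have "m n \<le> m (Suc n)" for n by (rule less_imp_le)
  then have "odd (m (Suc n) - m n)" for n using m by (simp add: not_less)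
  then show "contraction_seq m" using m by (simp add: contraction_seq_def)
qed

lemma twist_parity: "even m = even n \<Longrightarrow> twist S m = twist S n"
  by (auto simp: twist_def)

context refined_system
begin

text \<open>Only the parity of a level matters for its twist, and finer partitions satisfy the join condition
  all the more.\<close>

lemma refined_subseq:
  assumes m: "contraction_seq m"
  shows "refined_system X \<phi> (P \<circ> m)"
proof -
  have mono: "strict_mono m" and par: "even (m n) = even n" for n
    using m by (auto simp: contraction_seq_iff)
  have "refined_seq (X, \<phi>) (P \<circ> m)"
    unfolding refined_seq_iff[OF S]
  proof (intro conjI allI)
    show "clopen_partition X ((P \<circ> m) n)" for n using part by simp
    show "small_cells X (P \<circ> m)"
      unfolding small_cells_def
    proof (intro allI impI)
      fix U x assume "openin X U" "x \<in> U"
      then obtain n Z where Z: "Z \<in> P n" "x \<in> Z" "Z \<subseteq> U" using small unfolding small_cells_def by blast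
      have "x \<in> topspace X" using clopen_partitionD(6)[OF part Z(1)] Z(2) by blast
      then obtain W where W: "W \<in> P (m n)" "x \<in> W" using clopen_partitionD(8)[OF part] by blast
      have "W \<subseteq> Z"
        using nested_cell[of X P n "m n" Z W x, OF part nest seq_suble[OF mono]] Z W by blast
      with W Z show "\<exists>n. \<exists>Z\<in>(P \<circ> m) n. x \<in> Z \<and> Z \<subseteq> U" by auto
    qed
    fix n
    have "Suc (m n) \<le> m (Suc n)" using mono by (simp add: strict_mono_Suc_iff Suc_le_eq)
    then have "P (Suc (m n)) \<precsim> P (m (Suc n))"
      by (rule coarser_mono[of P, OF nest])
    with join[of "m n"] show "join ((P \<circ> m) n) ((`) (twist (X, \<phi>) n) ` (P \<circ> m) n) \<precsim> (P \<circ> m) (Suc n)"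
      using coarser_trans twist_parity[OF par, of "(X, \<phi>)" n] by simp
  qed
  then show ?thesis using S by unfold_locales
qed

text \<open>The isomorphism replaces the level \<open>m n\<close> in the name of a vertex by \<open>n\<close>.\<close>

lemma contraction_subseq:
  assumes m: "contraction_seq m"
  shows "contraction D m \<cong>h construction_I (X, \<phi>) (P \<circ> m)"
proof -
  interpret R: refined_system X \<phi> "P \<circ> m" by (rule refined_subseq[OF m])
  have par: "even (m n) = even n" for n using m by (simp add: contraction_seq_iff)
  have "level_iso (contraction D m) R.D (\<lambda>n (k, Z). (n, Z))"
    unfolding level_iso_def
  proof (intro allI conjI ballI)
    show "bij_betw (\<lambda>(k, Z). (n, Z)) (vert (contraction D m) n) (vert R.D n)" for n
      by (auto simp: bij_betw_def inj_on_def D_simps R.D_simps)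
    fix n c w assume "w \<in> vert (contraction D m) (Suc n)"
    then have w: "w \<in> vert D (m (Suc n))" by simp
    then obtain W where W: "w = (m (Suc n), W)" "W \<in> P (m (Suc n))" by (auto simp: D_simps)
    then have W': "W \<in> (P \<circ> m) (Suc n)" by simp
    obtain Z where Z: "Z \<in> (P \<circ> m) n" "W \<subseteq> colour_map (X, \<phi>) c n ` Z"
      "parent R.D c n (Suc n, W) = (n, Z)" using R.parent_D_cover[OF W'] .
    have le: "m n + (m (Suc n) - m n) = m (Suc n)"
      using contraction_seq_lt[OF m, of n] by simp
    have "colour_map (X, \<phi>) c n = colour_map (X, \<phi>) c (m n)"
      by (cases c) (simp_all add: twist_parity[OF par])
    then have "ancestor D c (m n) (m (Suc n) - m n) w = (m n, Z)"
      using ancestor_odd_D[of W "m n" "m (Suc n) - m n" Z c] W Z m le by (simp add: contraction_seq_def)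
    then show "(case parent (contraction D m) c n w of (k, Z) \<Rightarrow> (n, Z)) =
        parent R.D c n (case w of (k, Z) \<Rightarrow> (Suc n, Z))"
      using contraction_HDiag_parent(2)[OF D_HDiag m w, of c] W(1) Z(3) by simp
  qed
  then show ?thesis
    by (rule iso_if_level_iso[OF contraction_HDiag_parent(1)[OF D_HDiag m] R.D_HDiag])
qed

lemma h_equiv_subseq:
  assumes m: "contraction_seq m"
  shows "D \<sim>h construction_I (X, \<phi>) (P \<circ> m)"
proof -
  interpret R: refined_system X \<phi> "P \<circ> m" by (rule refined_subseq[OF m])
  show ?thesis
    using h_equiv_trans[OF h_equiv_contraction[OF D_HDiag m]
        h_equiv_if_iso[OF contraction_HDiag_parent(1)[OF D_HDiag m] R.D_HDiag contraction_subseq[OF m]]] .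
qed

end


section \<open>Independence of the refined sequence\<close>

text \<open>Every partition is coarser than all late members of either sequence. Hence late members of the
  two sequences can be combined into one refined sequence that contains a subsequence of each. The
  pattern has period three, not two: the subsequences have to start at an even level and advance by
  odd steps, and this would be impossible if one of them occupied only the even levels.\<close>

lemma h_equiv_refined_seqs:
  assumes P: "refined_system X \<phi> P" and Q: "refined_system X \<phi> Q"
  shows "construction_I (X, \<phi>) P \<sim>h construction_I (X, \<phi>) Q"
proof -
  interpret P: refined_system X \<phi> P by (rule P)
  interpret Q: refined_system X \<phi> Q by (rule Q)
  define Y where "Y k a = (if k mod 3 = 2 then Q a else P a)" for k a :: nat
  have Y: "clopen_partition X (Y k a)" for k a by (simp add: Y_def P.part Q.part)
  let ?J = "\<lambda>k A. join A ((`) (twist (X, \<phi>) k) ` A)"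
  have "\<exists>a. \<forall>k. even (a k) = even k \<and> (a k < a (Suc k) \<and> ?J k (Y k (a k)) \<precsim> Y (Suc k) (a (Suc k)))"
  proof (rule dependent_nat_choice)
    show "\<exists>a. even a = even (0::nat)" by auto
    fix a k :: nat assume "even a = even k"
    have "clopen_partition X (?J k (Y k a))"
      by (intro clopen_partition_join Y clopen_partition_image[OF homeomorphic_map_twist[OF HomeoD(6)[OF P.S]]])
    from eventually_finer[of X P, OF HomeoD(3)[OF P.S] P.part P.nest P.small this]
      eventually_finer[of X Q, OF HomeoD(3)[OF P.S] Q.part Q.nest Q.small this]
    obtain M M' where "\<forall>n \<ge> M. ?J k (Y k a) \<precsim> P n" "\<forall>n \<ge> M'. ?J k (Y k a) \<precsim> Q n"
      by (elim exE)
    then have "?J k (Y k a) \<precsim> Y (Suc k) n" if "max M M' \<le> n" for n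
      using that by (simp add: Y_def[of "Suc k"])
    then obtain N where N: "\<And>n. N \<le> n \<Longrightarrow> ?J k (Y k a) \<precsim> Y (Suc k) n" by metis
    \<comment> \<open>large, and of the parity of \<open>Suc k\<close>\<close>
    let ?b = "2 * (N + a + 1) + (if even k then 1 else 0)"
    have "even ?b = even (Suc k)" "a < ?b" "N \<le> ?b" by auto
    with N show "\<exists>b. even b = even (Suc k) \<and> (a < b \<and> ?J k (Y k a) \<precsim> Y (Suc k) b)" by blast
  qed
  then obtain a where par: "\<And>k. even (a k) = even k" and lt: "\<And>k. a k < a (Suc k)"
    and J: "\<And>k. ?J k (Y k (a k)) \<precsim> Y (Suc k) (a (Suc k))" by blast
  have mono: "strict_mono a" using lt by (simp add: strict_mono_Suc_iff)
  define R where "R k = Y k (a k)" for k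
  define i j where "i n = 3 * n" and "j n = 3 * n + 2" for n :: nat
  have ij: "contraction_seq i" "contraction_seq j"
    by (auto simp: contraction_seq_iff i_def j_def strict_mono_Suc_iff)
  have aij: "contraction_seq (a \<circ> i)" "contraction_seq (a \<circ> j)"
    using ij mono par by (auto simp: contraction_seq_iff strict_mono_o)
  have mod3: "Suc (Suc (3 * n)) mod 3 = 2" for n :: nat by presburger
  have Ri: "R \<circ> i = P \<circ> (a \<circ> i)" and Rj: "R \<circ> j = Q \<circ> (a \<circ> j)"
    by (auto simp: fun_eq_iff R_def Y_def i_def j_def mod3)
  have "small_cells X R"
    unfolding small_cells_def
  proof (intro allI impI)
    fix U x assume Ux: "openin X U" "x \<in> U"
    have "small_cells X (P \<circ> (a \<circ> i))"
      using refined_system.small[OF P.refined_subseq[OF aij(1)]] .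
    then obtain n Z where "Z \<in> (P \<circ> (a \<circ> i)) n" "x \<in> Z" "Z \<subseteq> U"
      using Ux unfolding small_cells_def by blast
    moreover from this have "Z \<in> R (i n)" unfolding Ri[symmetric] by simp
    ultimately show "\<exists>n. \<exists>Z\<in>R n. x \<in> Z \<and> Z \<subseteq> U" by blast
  qed
  then have "refined_seq (X, \<phi>) R"
    unfolding refined_seq_iff[OF P.S] using Y J by (simp add: R_def)
  then interpret R: refined_system X \<phi> R using P.S by unfold_locales
  have "P.D \<sim>h construction_I (X, \<phi>) (R \<circ> i)" unfolding Ri by (rule P.h_equiv_subseq[OF aij(1)])
  also have "\<dots> \<sim>h R.D" by (rule h_equiv_sym[OF R.h_equiv_subseq[OF ij(1)]])
  finally (h_equiv_trans) have 1: "P.D \<sim>h R.D" .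
  have "R.D \<sim>h construction_I (X, \<phi>) (R \<circ> j)" by (rule R.h_equiv_subseq[OF ij(2)])
  also have "\<dots> \<sim>h Q.D" unfolding Rj by (rule h_equiv_sym[OF Q.h_equiv_subseq[OF aij(2)]])
  finally (h_equiv_trans) have 2: "R.D \<sim>h Q.D" .
  show ?thesis by (rule h_equiv_trans[OF 1 2])
qed


section \<open>Conjugate systems and isomorphic diagrams\<close>

lemma iso_construction_I:
  assumes P: "refined_system X \<phi> P" and Q: "refined_system Y \<psi> Q"
    and bij: "\<And>n. bij_betw (p n) (P n) (Q n)"
    and arrow: "\<And>n c W Z. W \<in> P (Suc n) \<Longrightarrow> Z \<in> P n \<Longrightarrow> W \<subseteq> colour_map (X, \<phi>) c n ` Z \<Longrightarrow>
      p (Suc n) W \<subseteq> colour_map (Y, \<psi>) c n ` p n Z"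
  shows "construction_I (X, \<phi>) P \<cong>h construction_I (Y, \<psi>) Q"
proof -
  interpret P: refined_system X \<phi> P by (rule P)
  interpret Q: refined_system Y \<psi> Q by (rule Q)
  have "level_iso P.D Q.D (\<lambda>n (k, Z). (n, p n Z))"
    unfolding level_iso_def
  proof (intro allI conjI ballI)
    show "bij_betw (\<lambda>(k, Z). (n, p n Z)) (vert P.D n) (vert Q.D n)" for n
    proof -
      have "inj_on (\<lambda>(k, Z). (n, p n Z)) ({n} \<times> P n)"
        using bij_betw_imp_inj_on[OF bij[of n]] by (auto simp: inj_on_def)
      moreover have "(\<lambda>(k, Z). (n, p n Z)) ` ({n} \<times> P n) = {n} \<times> (p n ` P n)" by force
      ultimately show ?thesis
        using bij[of n] by (simp add: bij_betw_def P.D_simps Q.D_simps)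
    qed
    fix n c w assume "w \<in> vert P.D (Suc n)"
    then obtain W where W: "w = (Suc n, W)" "W \<in> P (Suc n)" by (auto simp: P.D_simps)
    obtain Z where Z: "Z \<in> P n" "W \<subseteq> colour_map (X, \<phi>) c n ` Z" "parent P.D c n (Suc n, W) = (n, Z)"
      using P.parent_D_cover[OF W(2)] .
    have "parent Q.D c n (Suc n, p (Suc n) W) = (n, p n Z)"
      using bij W(2) Z(1,2) arrow by (intro Q.parent_D) (auto dest: bij_betwE)
    then show "(case parent P.D c n w of (k, Z) \<Rightarrow> (n, p n Z)) =
        parent Q.D c n (case w of (k, Z) \<Rightarrow> (Suc n, p (Suc n) Z))"
      using W(1) Z(3) by simp
  qed
  then show ?thesis by (rule iso_if_level_iso[OF P.D_HDiag Q.D_HDiag])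
qed

lemma twist_conj:
  assumes \<phi>: "bij_betw \<phi> (topspace X) (topspace X)" and \<psi>: "bij_betw \<psi> (topspace Y) (topspace Y)"
    and h: "\<And>x. x \<in> topspace X \<Longrightarrow> h x \<in> topspace Y" "\<And>x. x \<in> topspace X \<Longrightarrow> h (\<phi> x) = \<psi> (h x)"
    and x: "x \<in> topspace X"
  shows "h (twist (X, \<phi>) n x) = twist (Y, \<psi>) n (h x)"
proof (cases "even n")
  case True
  then show ?thesis using h(2)[OF x] by (simp add: twist_def)
next
  case False
  let ?y = "inv_into (topspace X) \<phi> x"
  have y: "?y \<in> topspace X" "\<phi> ?y = x"
    using bij_betwE[OF bij_betw_inv_into[OF \<phi>]] bij_betw_inv_into_right[OF \<phi>] x by auto
  then have "\<psi> (h ?y) = h x" using h(2)[OF y(1)] by simp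
  then have "inv_into (topspace Y) \<psi> (h x) = h ?y"
    using bij_betw_inv_into_left[OF \<psi> h(1)[OF y(1)]] by simp
  then show ?thesis using False by (simp add: twist_def)
qed

lemma transport_refined_seq:
  assumes P: "refined_system X \<phi> P" and T: "(Y, \<psi>) \<in> Homeo"
    and h: "homeomorphic_map X Y h" and conj: "\<And>x. x \<in> topspace X \<Longrightarrow> h (\<phi> x) = \<psi> (h x)"
  shows "refined_system Y \<psi> (\<lambda>n. (`) h ` P n)"
    and "construction_I (X, \<phi>) P \<cong>h construction_I (Y, \<psi>) (\<lambda>n. (`) h ` P n)"
proof -
  interpret P: refined_system X \<phi> P by (rule P)
  let ?Q = "\<lambda>n. (`) h ` P n"
  note surj = homeomorphic_imp_surjective_map[OF h] and inj = homeomorphic_imp_injective_map[OF h]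
  have hY: "h x \<in> topspace Y" if "x \<in> topspace X" for x using surj that by blast
  note tw = twist_conj[of \<phi> X \<psi> Y h, OF P.bij HomeoD(7)[OF T] hY conj]
  have tw_im: "h ` twist (X, \<phi>) n ` Z = twist (Y, \<psi>) n ` h ` Z" if "Z \<in> P k" for n Z k
    using tw clopen_partitionD(6)[OF P.part that] unfolding image_image by (intro image_cong) auto
  have "refined_seq (Y, \<psi>) ?Q"
    unfolding refined_seq_iff[OF T]
  proof (intro conjI allI)
    show part: "clopen_partition Y (?Q n)" for n by (rule clopen_partition_image[OF h P.part])
    show "small_cells Y ?Q"
      unfolding small_cells_def
    proof (intro allI impI)
      fix V y assume V: "openin Y V" "y \<in> V"
      then have "y \<in> topspace Y" using openin_subset by blast
      then obtain x where x: "x \<in> topspace X" "y = h x" using surj by blast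
      have "openin X {x \<in> topspace X. h x \<in> V}"
        using homeomorphic_imp_continuous_map[OF h] V(1) by (auto simp: continuous_map_def)
      then obtain n Z where "Z \<in> P n" "x \<in> Z" "Z \<subseteq> {x \<in> topspace X. h x \<in> V}"
        using P.small x V(2) unfolding small_cells_def by blast
      then show "\<exists>n. \<exists>Z\<in>?Q n. y \<in> Z \<and> Z \<subseteq> V"
        using x(2) by (intro exI[of _ n] bexI[of _ "h ` Z"]) auto
    qed
    fix n
    have "(`) (twist (Y, \<psi>) n) ` ?Q n = (`) h ` (`) (twist (X, \<phi>) n) ` P n"
      unfolding image_image[of "image _"] using tw_im by (intro image_cong) auto
    moreover have "{} \<notin> ?Q (Suc n)" using clopen_partitionD(3)[OF part, of "{}" "Suc n"] by blast
    ultimately show "join (?Q n) ((`) (twist (Y, \<psi>) n) ` ?Q n) \<precsim> ?Q (Suc n)"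
      using coarser_image[OF P.nest] coarser_image[OF coarser_join2[OF P.join]]
      by (intro coarser_joinI) simp_all
  qed
  then show Q: "refined_system Y \<psi> ?Q" using T by unfold_locales
  show "construction_I (X, \<phi>) P \<cong>h construction_I (Y, \<psi>) ?Q"
  proof (rule iso_construction_I[OF P Q])
    show "bij_betw ((`) h) (P n) (?Q n)" for n
      unfolding bij_betw_def
    proof
      show "inj_on ((`) h) (P n)"
        using inj clopen_partitionD(6)[OF P.part] by (meson inj_onI inj_on_image_eq_iff)
    qed simp
    fix n c W Z assume Z: "Z \<in> P n" "W \<subseteq> colour_map (X, \<phi>) c n ` Z"
    then show "h ` W \<subseteq> colour_map (Y, \<psi>) c n ` h ` Z"
      using tw_im[OF Z(1), of n] image_mono[OF Z(2), of h] by (cases c) auto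
  qed
qed

lemma h_equiv_if_conj:
  assumes P: "refined_system X \<phi> P" and Q: "refined_system Y \<psi> Q" and conj: "(X, \<phi>) \<sim>tc (Y, \<psi>)"
  shows "construction_I (X, \<phi>) P \<sim>h construction_I (Y, \<psi>) Q"
proof -
  interpret P: refined_system X \<phi> P by (rule P)
  interpret Q: refined_system Y \<psi> Q by (rule Q)
  obtain h where h: "homeomorphic_map X Y h" "\<And>x. x \<in> topspace X \<Longrightarrow> h (\<phi> x) = \<psi> (h x)"
    using conj by (auto simp: top_conj_def)
  interpret R: refined_system Y \<psi> "\<lambda>n. (`) h ` P n" by (rule transport_refined_seq(1)[OF P Q.S h])
  have "P.D \<sim>h R.D"
    using h_equiv_if_iso[OF P.D_HDiag R.D_HDiag transport_refined_seq(2)[OF P Q.S h]] .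
  also have "R.D \<sim>h Q.D" by (rule h_equiv_refined_seqs[OF R.refined_system_axioms Q])
  finally (h_equiv_trans) show ?thesis .
qed

context refined_system
begin

definition cell :: "nat \<Rightarrow> 'a \<Rightarrow> 'a set" where
  "cell n x = (THE Z. Z \<in> P n \<and> x \<in> Z)"

lemma cell_eqI: "Z \<in> P n \<Longrightarrow> x \<in> Z \<Longrightarrow> cell n x = Z"
  unfolding cell_def using clopen_partitionD(7)[OF part] by (intro the_equality) blast+

lemma cell:
  assumes "x \<in> topspace X"
  shows "cell n x \<in> P n" "x \<in> cell n x"
  using clopen_partitionD(8)[OF part assms] cell_eqI by metis+

lemma point_eqI:
  assumes x: "x \<in> topspace X" "x' \<in> topspace X" and eq: "\<And>n. \<exists>m \<ge> n. cell m x = cell m x'"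
  shows "x = x'"
proof (rule ccontr)
  assume "x \<noteq> x'"
  then obtain U V where U: "openin X U" "openin X V" "x \<in> U" "x' \<in> V" "disjnt U V"
    using HomeoD(5)[OF S] x unfolding Hausdorff_space_def by metis
  then obtain n Z where Z: "Z \<in> P n" "x \<in> Z" "Z \<subseteq> U" using small unfolding small_cells_def by meson
  obtain m where m: "n \<le> m" "cell m x = cell m x'" using eq by blast
  have "cell m x \<subseteq> Z"
    using nested_cell[of X P n m Z "cell m x" x, OF part nest m(1) Z(1) cell(1)[OF x(1)] Z(2) cell(2)[OF x(1)]] .
  then have "x' \<in> U" using cell(2)[OF x(2)] m(2) Z(3) by auto
  with U show False by (auto simp: disjnt_iff)
qed

text \<open>Compactness makes the intersection of the cells nonempty. With the previous lemma, points
  correspond to nested sequences of cells.\<close>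

lemma nested_cells_point:
  assumes Z: "\<And>n. Z n \<in> P n" "\<And>n. Z (Suc n) \<subseteq> Z n"
  obtains x where "x \<in> topspace X" "\<And>n. cell n x = Z n"
proof -
  have "(\<Inter>n. Z n) \<noteq> {}"
  proof (rule compact_space_imp_nest[OF HomeoD(3)[OF S]])
    show "decseq Z" using Z(2) by (simp add: decseq_Suc_iff)
  qed (use clopen_partitionD(3,5)[OF part Z(1)] in auto)
  then obtain x where "\<And>n. x \<in> Z n" by blast
  then show thesis using that clopen_partitionD(6)[OF part Z(1)] cell_eqI[OF Z(1)] by blast
qed

end

text \<open>A system is recovered from the diagram of any refined sequence, because its points are the
  nested sequences of cells and the blue edges record the nesting. The map is recovered from the red
  edges: at an even level \<open>n\<close> they tell which member of \<open>P n\<close> contains \<open>x\<close> once the cell of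
  \<open>\<phi> x\<close> at level \<open>Suc n\<close> is known.\<close>

lemma conj_if_iso:
  assumes P: "refined_system X \<phi> P" and Q: "refined_system Y \<psi> Q"
    and iso: "construction_I (X, \<phi>) P \<cong>h construction_I (Y, \<psi>) Q"
  shows "(X, \<phi>) \<sim>tc (Y, \<psi>)"
proof -
  interpret P: refined_system X \<phi> P by (rule P)
  interpret Q: refined_system Y \<psi> Q by (rule Q)
  obtain p where p: "level_iso P.D Q.D p" using level_iso_if_iso[OF P.D_HDiag Q.D_HDiag iso] .
  have pbij: "bij_betw (p n) ({n} \<times> P n) ({n} \<times> Q n)" for n
    using p unfolding level_iso_def by (simp add: P.D_simps Q.D_simps)
  define \<pi> where "\<pi> n Z = snd (p n (n, Z))" for n Z
  have \<pi>: "p n (n, Z) = (n, \<pi> n Z)" "\<pi> n Z \<in> Q n" if "Z \<in> P n" for n Z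
    using bij_betwE[OF pbij[of n]] that by (auto simp: \<pi>_def mem_Times_iff prod_eq_iff)
  have \<pi>_inj: "Z = Z'" if "\<pi> n Z = \<pi> n Z'" "Z \<in> P n" "Z' \<in> P n" for n Z Z'
    using inj_onD[OF bij_betw_imp_inj_on[OF pbij[of n]], of "(n, Z)" "(n, Z')"]
      \<pi>(1)[OF that(2)] \<pi>(1)[OF that(3)] that by simp
  have \<pi>_surj: "\<exists>Z \<in> P n. \<pi> n Z = V" if V: "V \<in> Q n" for n V
  proof -
    have "(n, V) \<in> p n ` ({n} \<times> P n)" using bij_betw_imp_surj_on[OF pbij[of n]] V by simp
    then obtain Z where "Z \<in> P n" "p n (n, Z) = (n, V)" by auto
    then show ?thesis using \<pi>(1) by (intro bexI[of _ Z]) simp_all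
  qed
  have arrow: "\<pi> (Suc n) W \<subseteq> colour_map (Y, \<psi>) c n ` \<pi> n Z"
    if WZ: "W \<in> P (Suc n)" "Z \<in> P n" "W \<subseteq> colour_map (X, \<phi>) c n ` Z" for n c W Z
  proof -
    have "(Suc n, W) \<in> vert P.D (Suc n)" using WZ(1) by (simp add: P.D_simps)
    then have "p n (parent P.D c n (Suc n, W)) = parent Q.D c n (p (Suc n) (Suc n, W))"
      using p unfolding level_iso_def by blast
    then have *: "parent Q.D c n (Suc n, \<pi> (Suc n) W) = (n, \<pi> n Z)"
      using P.parent_D[OF WZ] \<pi>(1)[OF WZ(1)] \<pi>(1)[OF WZ(2)] by simp
    obtain V where "\<pi> (Suc n) W \<subseteq> colour_map (Y, \<psi>) c n ` V"
      "parent Q.D c n (Suc n, \<pi> (Suc n) W) = (n, V)"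
      using Q.parent_D_cover[OF \<pi>(2)[OF WZ(1)], of c] .
    with * show ?thesis by simp
  qed
  have nestP: "P.cell (Suc n) x \<subseteq> P.cell n x" if "x \<in> topspace X" for n x
    using nested_cell[of X P n "Suc n", OF P.part P.nest _ P.cell(1) P.cell(1) P.cell(2) P.cell(2)] that
    by simp
  have "\<exists>y. y \<in> topspace Y \<and> (\<forall>n. Q.cell n y = \<pi> n (P.cell n x))" if x: "x \<in> topspace X" for x
  proof -
    have "\<pi> (Suc n) (P.cell (Suc n) x) \<subseteq> \<pi> n (P.cell n x)" for n
      using arrow[of "P.cell (Suc n) x" n "P.cell n x" Blue] P.cell[OF x] nestP[OF x] by simp
    then show ?thesis
      using Q.nested_cells_point[of "\<lambda>n. \<pi> n (P.cell n x)"] \<pi>(2) P.cell(1)[OF x] by metis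
  qed
  then obtain h where h: "\<And>x. x \<in> topspace X \<Longrightarrow> h x \<in> topspace Y"
    "\<And>x n. x \<in> topspace X \<Longrightarrow> Q.cell n (h x) = \<pi> n (P.cell n x)" by metis
  have "homeomorphic_map X Y h"
  proof (rule continuous_imp_homeomorphic_map[OF _ HomeoD(3)[OF P.S] HomeoD(5)[OF Q.S]])
    show "continuous_map X Y h"
      unfolding continuous_map_def
    proof (intro conjI allI impI)
      show "h \<in> topspace X \<rightarrow> topspace Y" using h(1) by blast
      fix V assume V: "openin Y V"
      show "openin X {x \<in> topspace X. h x \<in> V}"
      proof (subst openin_subopen, intro ballI)
        fix x assume "x \<in> {x \<in> topspace X. h x \<in> V}"
        then have x: "x \<in> topspace X" "h x \<in> V" by auto
        obtain n Z where Z: "Z \<in> Q n" "h x \<in> Z" "Z \<subseteq> V"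
          using Q.small V x(2) unfolding small_cells_def by meson
        have "P.cell n x \<subseteq> {x \<in> topspace X. h x \<in> V}"
        proof
          fix x' assume x': "x' \<in> P.cell n x"
          then have X: "x' \<in> topspace X"
            using clopen_partitionD(6)[OF P.part P.cell(1)[OF x(1)]] by blast
          have "P.cell n x' = P.cell n x" using P.cell_eqI[OF P.cell(1)[OF x(1)] x'] .
          then have "Q.cell n (h x') = Z" using h(2)[OF X] h(2)[OF x(1)] Q.cell_eqI[OF Z(1,2)] by simp
          then have "h x' \<in> Z" using Q.cell(2)[OF h(1)[OF X], of n] by simp
          with Z(3) X show "x' \<in> {x \<in> topspace X. h x \<in> V}" by blast
        qed
        then show "\<exists>T. openin X T \<and> x \<in> T \<and> T \<subseteq> {x \<in> topspace X. h x \<in> V}"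
          using P.cell[OF x(1), of n] clopen_partitionD(4)[OF P.part] by blast
      qed
    qed
    show "inj_on h (topspace X)"
    proof (rule inj_onI)
      fix x x' assume x: "x \<in> topspace X" "x' \<in> topspace X" "h x = h x'"
      then have "P.cell n x = P.cell n x'" for n
        using h(2)[OF x(1), of n] h(2)[OF x(2), of n] by (intro \<pi>_inj[of n] P.cell) simp_all
      then show "x = x'" using P.point_eqI[OF x(1,2)] by blast
    qed
    show "h ` topspace X = topspace Y"
    proof (intro equalityI subsetI)
      fix y assume y: "y \<in> topspace Y"
      have "\<exists>Z. \<forall>n. Z n \<in> P n \<and> \<pi> n (Z n) = Q.cell n y"
        using \<pi>_surj[OF Q.cell(1)[OF y]] by (intro choice allI) blast
      then obtain Z where Z: "\<And>n. Z n \<in> P n" "\<And>n. \<pi> n (Z n) = Q.cell n y" by blast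
      have "Z (Suc n) \<subseteq> Z n" for n
      proof -
        obtain V where V: "V \<in> P n" "Z (Suc n) \<subseteq> colour_map (X, \<phi>) Blue n ` V"
          using P.cover[OF Z(1)[of "Suc n"], of Blue] by blast
        have "Q.cell (Suc n) y \<subseteq> \<pi> n V"
          using arrow[OF Z(1) V] unfolding Z(2) by simp
        then have "y \<in> \<pi> n V" using Q.cell(2)[OF y] by blast
        then have "\<pi> n V = \<pi> n (Z n)" using Q.cell_eqI[OF \<pi>(2)[OF V(1)]] Z(2) by simp
        then have "V = Z n" by (rule \<pi>_inj[OF _ V(1) Z(1)])
        with V(2) show ?thesis by simp
      qed
      then obtain x where x: "x \<in> topspace X" "\<And>n. P.cell n x = Z n"
        using P.nested_cells_point[of Z] Z(1) by blast
      have "Q.cell n (h x) = Q.cell n y" for n using h(2)[OF x(1)] x(2) Z(2) by simp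
      then have "h x = y" using Q.point_eqI[OF h(1)[OF x(1)] y] by blast
      with x(1) show "y \<in> h ` topspace X" by blast
    qed (use h(1) in auto)
  qed
  moreover have "h (\<phi> x) = \<psi> (h x)" if x: "x \<in> topspace X" for x
  proof -
    have \<phi>x: "\<phi> x \<in> topspace X" using bij_betwE[OF P.bij] x by blast
    define u where "u = inv_into (topspace Y) \<psi> (h (\<phi> x))"
    have u: "u \<in> topspace Y" "\<psi> u = h (\<phi> x)"
      using bij_betwE[OF bij_betw_inv_into[OF Q.bij]] bij_betw_inv_into_right[OF Q.bij] h(1)[OF \<phi>x]
      by (auto simp: u_def)
    have "Q.cell n u = Q.cell n (h x)" if n: "even n" for n
    proof -
      let ?W = "P.cell (Suc n) (\<phi> x)"
      obtain Z where Z: "Z \<in> P n" "?W \<subseteq> colour_map (X, \<phi>) Red n ` Z"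
        using P.cover[OF P.cell(1)[OF \<phi>x]] by blast
      have tw: "twist (X, \<phi>) n = \<phi>" "twist (Y, \<psi>) n = \<psi>" using n by (simp_all add: twist_def)
      have "\<phi> x \<in> colour_map (X, \<phi>) Red n ` Z" using P.cell(2)[OF \<phi>x] Z(2) by blast
      then obtain z where z: "z \<in> Z" "\<phi> x = \<phi> z" by (auto simp: tw)
      moreover have "z \<in> topspace X" using z(1) clopen_partitionD(6)[OF P.part Z(1)] by blast
      ultimately have "x \<in> Z" using bij_betw_imp_inj_on[OF P.bij] x by (metis inj_onD)
      then have Zx: "Z = P.cell n x" using P.cell_eqI[OF Z(1)] by simp
      have "\<pi> (Suc n) ?W \<subseteq> \<psi> ` \<pi> n Z" using arrow[OF P.cell(1)[OF \<phi>x] Z] by (simp add: tw)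
      moreover have "h (\<phi> x) \<in> \<pi> (Suc n) ?W" using Q.cell(2)[OF h(1)[OF \<phi>x]] h(2)[OF \<phi>x] by metis
      ultimately obtain v where v: "v \<in> \<pi> n Z" "\<psi> u = \<psi> v" using u(2) by auto
      moreover have "v \<in> topspace Y" using v(1) clopen_partitionD(6)[OF Q.part \<pi>(2)[OF Z(1)]] by blast
      ultimately have "u \<in> \<pi> n Z" using bij_betw_imp_inj_on[OF Q.bij] u(1) by (metis inj_onD)
      then have "Q.cell n u = \<pi> n Z" by (rule Q.cell_eqI[OF \<pi>(2)[OF Z(1)]])
      then show ?thesis using h(2)[OF x] Zx by simp
    qed
    then have "\<exists>m \<ge> n. Q.cell m u = Q.cell m (h x)" for n
      by (intro exI[of _ "2 * n"]) simp
    then have "u = h x" using Q.point_eqI[OF u(1) h(1)[OF x]] by blast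
    with u(2) show ?thesis by simp
  qed
  ultimately show ?thesis by (auto simp: top_conj_def)
qed

section \<open>Construction II\<close>

locale h_diagram =
  fixes F :: "('v, 'e) diagram"
  assumes F: "F \<in> HDiag"
begin

abbreviation b :: "nat \<Rightarrow> 'v \<Rightarrow> 'v" where "b \<equiv> parent F Blue"
abbreviation \<rho> :: "nat \<Rightarrow> 'v \<Rightarrow> 'v" where "\<rho> \<equiv> parent F Red"
abbreviation X :: "(nat \<Rightarrow> 'e) set" where "X \<equiv> path_space F"
abbreviation vx :: "(nat \<Rightarrow> 'e) \<Rightarrow> nat \<Rightarrow> 'v" where "vx x n \<equiv> rng F (x n)"

lemma blue_edge:
  assumes "e \<in> blue_edges F n"
  shows "rng F e \<in> vert F n" "src F e \<in> vert F (Suc n)" "b n (src F e) = rng F e"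
    "parent_edge F Blue n (src F e) = e"
  using coloured_edge_src_rng[OF F, of e Blue n] parent_eqI[OF F, of e Blue n]
    parent_edge_eqI[OF F, of e Blue n] assms by simp_all

lemma red_edge:
  assumes "e \<in> red_edges F n"
  shows "rng F e \<in> vert F n" "src F e \<in> vert F (Suc n)" "\<rho> n (src F e) = rng F e"
  using coloured_edge_src_rng[OF F, of e Red n] parent_eqI[OF F, of e Red n] assms by simp_all

lemma path:
  assumes "x \<in> X"
  shows "x n \<in> blue_edges F n" "src F (x n) = vx x (Suc n)" "vx x n \<in> vert F n"
    "b n (vx x (Suc n)) = vx x n" "x n = parent_edge F Blue n (vx x (Suc n))"
proof -
  show x: "x n \<in> blue_edges F n" and s: "src F (x n) = vx x (Suc n)"
    using assms by (simp_all add: path_space_def)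
  show "vx x n \<in> vert F n" "b n (vx x (Suc n)) = vx x n" "x n = parent_edge F Blue n (vx x (Suc n))"
    using blue_edge[OF x] by (simp_all add: s)
qed

lemma path_ancestor: "x \<in> X \<Longrightarrow> ancestor F Blue a k (vx x (a + k)) = vx x a"
proof (induction k arbitrary: a)
  case (Suc k)
  then show ?case using Suc.IH[of "Suc a"] path(4) by simp
qed simp

lemma path_agree:
  assumes "x \<in> X" "y \<in> X" "vx x n = vx y n" "m \<le> n"
  shows "vx x m = vx y m"
  using path_ancestor[OF assms(1), of m "n - m"] path_ancestor[OF assms(2), of m "n - m"] assms(3,4)
  by simp

lemma path_eqI:
  assumes "x \<in> X" "y \<in> X" and eq: "\<And>n. \<exists>m \<ge> n. vx x m = vx y m"
  shows "x = y"
proof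
  fix n
  have "vx x k = vx y k" for k using eq path_agree[OF assms(1,2)] by blast
  then show "x n = y n" using path(5)[OF assms(1), of n] path(5)[OF assms(2), of n] by simp
qed

lemma path_through:
  assumes "\<And>n. t n \<in> vert F n" "\<And>n. b n (t (Suc n)) = t n"
  obtains x where "x \<in> X" "\<And>n. vx x n = t n"
proof -
  let ?x = "\<lambda>n. parent_edge F Blue n (t (Suc n))"
  have e: "?x n \<in> blue_edges F n" "src F (?x n) = t (Suc n)" for n
    using parent_edge[OF F assms(1), of Blue n] by simp_all
  have "vx ?x n = t n" for n using assms(2) by (simp add: parent_def)
  with e have "?x \<in> X" "\<And>n. vx ?x n = t n" by (simp_all add: path_space_def)
  then show thesis by (rule that)
qed

text \<open>A path may be prescribed on the even levels only, since parents fill the odd levels.\<close>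

lemma path_through_even:
  assumes u: "\<And>j. u j \<in> vert F (2 * j)" "\<And>j. b (2 * j) (b (Suc (2 * j)) (u (Suc j))) = u j"
  obtains x where "x \<in> X" "\<And>j. vx x (2 * j) = u j"
proof -
  let ?t = "\<lambda>n. if even n then u (n div 2) else b n (u (Suc n div 2))"
  have t: "?t n \<in> vert F n \<and> b n (?t (Suc n)) = ?t n" for n
  proof (cases "even n")
    case True
    then obtain j where n: "n = 2 * j" by (elim evenE)
    show ?thesis using u[of j] by (simp add: n)
  next
    case False
    then obtain j where n: "n = Suc (2 * j)" by (auto elim: oddE)
    have "b n (u (Suc j)) \<in> vert F n" using u(1)[of "Suc j"] by (intro parent_vert[OF F]) (simp add: n)
    then show ?thesis by (simp add: n)
  qed
  obtain x where "x \<in> X" "\<And>n. vx x n = ?t n" using path_through[of ?t] t by blast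
  then show thesis by (intro that[of x]) simp_all
qed

lemma path_through_odd:
  assumes u: "\<And>j. u j \<in> vert F (Suc (2 * j))"
    "\<And>j. b (Suc (2 * j)) (b (Suc (Suc (2 * j))) (u (Suc j))) = u j"
  obtains x where "x \<in> X" "\<And>j. vx x (Suc (2 * j)) = u j"
proof -
  obtain x where x: "x \<in> X" "\<And>j. vx x (2 * j) = b (2 * j) (u j)"
  proof (rule path_through_even[of "\<lambda>j. b (2 * j) (u j)"])
    show "b (2 * j) (u j) \<in> vert F (2 * j)" for j by (rule parent_vert[OF F u(1)])
    show "b (2 * j) (b (Suc (2 * j)) (b (2 * Suc j) (u (Suc j)))) = b (2 * j) (u j)" for j
      using u(2)[of j] by simp
  qed blast
  have "vx x (Suc (2 * j)) = u j" for j
    using path(4)[OF x(1), of "Suc (2 * j)"] x(2)[of "Suc j"] u(2)[of j] by simp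
  with x(1) show thesis by (rule that)
qed

definition cyl :: "nat \<Rightarrow> 'v \<Rightarrow> (nat \<Rightarrow> 'e) set" where
  "cyl n v = {x \<in> X. vx x n = v}"

definition cyls :: "nat \<Rightarrow> (nat \<Rightarrow> 'e) set set" where
  "cyls n = cyl n ` vert F n"

text \<open>Below level \<open>n\<close> the path is forced; above, it can be continued because every vertex is a parent.\<close>

lemma cyl_nonempty:
  assumes v: "v \<in> vert F n"
  shows "cyl n v \<noteq> {}"
proof -
  have "\<exists>s. \<forall>k. (s k \<in> vert F (n + k) \<and> (k = 0 \<longrightarrow> s k = v)) \<and> b (n + k) (s (Suc k)) = s k"
  proof (rule dependent_nat_choice)
    show "\<exists>w. w \<in> vert F (n + 0) \<and> (0 = (0::nat) \<longrightarrow> w = v)" using v by simp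
    fix w k assume "w \<in> vert F (n + k) \<and> (k = 0 \<longrightarrow> w = v)"
    then obtain w' where "w' \<in> vert F (Suc (n + k))" "b (n + k) w' = w"
      using parent_surj[OF F] by blast
    then show "\<exists>w'. (w' \<in> vert F (n + Suc k) \<and> (Suc k = 0 \<longrightarrow> w' = v)) \<and> b (n + k) w' = w" by auto
  qed
  then obtain s where s: "\<And>k. s k \<in> vert F (n + k)" "s 0 = v" "\<And>k. b (n + k) (s (Suc k)) = s k"
    by blast
  let ?t = "\<lambda>i. if i < n then ancestor F Blue i (n - i) v else s (i - n)"
  have t: "?t i \<in> vert F i \<and> b i (?t (Suc i)) = ?t i" for i
  proof (cases "i < n")
    case True
    then obtain k where n: "n = i + Suc k" using less_imp_Suc_add by fastforce
    show ?thesis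
      using ancestor_vert[OF F, of v i "Suc k" Blue] v s(2) by (cases k) (simp_all add: n)
  next
    case False
    then obtain k where i: "i = n + k" using le_Suc_ex not_less by blast
    show ?thesis using s(1,3)[of k] by (simp add: i)
  qed
  obtain x where "x \<in> X" "\<And>i. vx x i = ?t i" using path_through[of ?t] t by blast
  then have "x \<in> cyl n v" using s(2) by (simp add: cyl_def)
  then show ?thesis by blast
qed

lemma cyl_inj: "v \<in> vert F n \<Longrightarrow> cyl n v = cyl n w \<Longrightarrow> v = w"
  using cyl_nonempty[of v n] unfolding cyl_def by blast

lemma cyl_parent: "cyl (Suc n) w \<subseteq> cyl n (b n w)"
  using path(4) by (auto simp: cyl_def)

text \<open>The blue path from the bottom level to a vertex is unique, so fixing the first \<open>Suc n\<close> edges of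
  a path is the same as fixing its vertex at level \<open>Suc n\<close>.\<close>

lemma cylinder_cyl:
  assumes es: "es \<in> tuples F (blue_edges F) 0 (Suc n)"
  shows "cylinder F es = cyl (Suc n) (src F (last es))"
proof (intro equalityI subsetI)
  have len: "length es = Suc n" using es by (simp add: tuples_def)
  then have last: "last es = es ! n" by (metis diff_Suc_1 last_conv_nth length_0_conv nat.simps(3))
  {
    fix x assume "x \<in> cylinder F es"
    then have x: "x \<in> X" "x n = es ! n" using len by (auto simp: cylinder_def)
    then show "x \<in> cyl (Suc n) (src F (last es))" using path(2)[OF x(1), of n] last by (simp add: cyl_def)
  next
    fix x assume "x \<in> cyl (Suc n) (src F (last es))"
    then have x: "x \<in> X" "vx x (Suc n) = src F (last es)" by (auto simp: cyl_def)
    let ?l = "map x [0..<Suc n]"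
    have nth: "?l ! i = x i" if "i < Suc n" for i using that by (metis add_0 diff_zero length_upt nth_map nth_upt)
    have "?l \<in> tuples F (blue_edges F) 0 (0 + Suc n)"
      unfolding tuples_def
    proof (intro CollectI conjI allI impI)
      show "?l ! i \<in> blue_edges F (0 + i)" if "i < length ?l" for i
        using that path(1)[OF x(1)] nth[of i] by simp
      show "src F (?l ! i) = rng F (?l ! Suc i)" if "Suc i < length ?l" for i
        using that path(2)[OF x(1)] nth[of i] nth[of "Suc i"] by simp
    qed simp
    moreover have "src F (last ?l) = src F (last es)" using path(2)[OF x(1), of n] x(2) by simp
    ultimately have "?l = es"
      using es inj_onD[OF bij_betw_imp_inj_on[OF conjunct2[OF tuples_ancestor[OF F, of Blue 0 n]]], of ?l es]
      by simp
    then show "x \<in> cylinder F es" using x(1) nth len by (auto simp: cylinder_def)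
  }
qed

lemma path_topology_cyls: "path_topology F = topology_generated_by (\<Union>n. cyls (Suc n))"
proof -
  have "{cylinder F es | n es. es \<in> tuples F (blue_edges F) 0 (Suc n)} = (\<Union>n. cyls (Suc n))"
  proof (intro equalityI subsetI)
    fix C assume "C \<in> {cylinder F es | n es. es \<in> tuples F (blue_edges F) 0 (Suc n)}"
    then obtain n es where es: "es \<in> tuples F (blue_edges F) 0 (Suc n)" "C = cylinder F es" by blast
    have "src F (last es) \<in> vert F (Suc n)" using tuples_ancestor[OF F, of Blue 0 n] es(1) by simp
    with es cylinder_cyl[OF es(1)] show "C \<in> (\<Union>n. cyls (Suc n))" unfolding cyls_def by blast
  next
    fix C assume "C \<in> (\<Union>n. cyls (Suc n))"
    then obtain n w where w: "w \<in> vert F (Suc n)" "C = cyl (Suc n) w" unfolding cyls_def by blast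
    then have "w \<in> (\<lambda>es. src F (last es)) ` tuples F (blue_edges F) 0 (Suc n)"
      using tuples_ancestor[OF F, of Blue 0 n] by (simp add: bij_betw_def)
    then obtain es where "es \<in> tuples F (blue_edges F) 0 (Suc n)" "w = src F (last es)" by blast
    with w cylinder_cyl show "C \<in> {cylinder F es | n es. es \<in> tuples F (blue_edges F) 0 (Suc n)}" by blast
  qed
  then show ?thesis by (simp add: path_topology_def)
qed

lemma Union_cyls: "\<Union>(cyls n) = X"
  using path(3) by (auto simp: cyls_def cyl_def)

lemma topspace_path: "topspace (path_topology F) = X"
proof -
  have "\<Union>(\<Union>n. cyls (Suc n)) = X"
  proof (intro equalityI subsetI)
    fix x assume "x \<in> \<Union>(\<Union>n. cyls (Suc n))"
    then obtain n where "x \<in> \<Union>(cyls (Suc n))" by auto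
    then show "x \<in> X" by (simp only: Union_cyls)
  next
    fix x assume "x \<in> X"
    then have "x \<in> \<Union>(cyls (Suc 0))" by (simp only: Union_cyls)
    then obtain Z where "Z \<in> cyls (Suc 0)" "x \<in> Z" by (rule UnionE)
    then show "x \<in> \<Union>(\<Union>n. cyls (Suc n))" by (intro UnionI[of Z] UN_I[of 0]) simp_all
  qed
  then show ?thesis unfolding path_topology_cyls topology_generated_by_topspace .
qed

lemma clopen_partition_cyls: "clopen_partition (path_topology F) (cyls n)"
proof (rule clopen_partitionI)
  have op: "openin (path_topology F) (cyl (Suc n) w)" if "w \<in> vert F (Suc n)" for n w
    unfolding path_topology_cyls using that by (intro topology_generated_by_Basis) (auto simp: cyls_def)
  show "openin (path_topology F) Z" if Z: "Z \<in> cyls n" for Z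
  proof (cases n)
    case 0
    obtain v where v: "Z = cyl 0 v" using Z 0 by (auto simp: cyls_def)
    have "Z = \<Union>(cyl (Suc 0) ` {w \<in> vert F (Suc 0). b 0 w = v})"
      unfolding v using path(3,4) by (auto simp: cyl_def)
    moreover have "openin (path_topology F) \<dots>" using op by (intro openin_Union) auto
    ultimately show ?thesis by simp
  next
    case (Suc k)
    then show ?thesis using Z op by (auto simp: cyls_def)
  qed
  show "finite (cyls n)" using HDiag_vert(1)[OF F] by (simp add: cyls_def)
  show "\<Union>(cyls n) = topspace (path_topology F)"
    unfolding topspace_path by (rule Union_cyls)
  show "Z \<noteq> {}" if "Z \<in> cyls n" for Z using that cyl_nonempty by (auto simp: cyls_def)
  show "Z = W" if "Z \<in> cyls n" "W \<in> cyls n" "x \<in> Z" "x \<in> W" for Z W x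
    using that by (auto simp: cyls_def cyl_def)
qed

lemma cyls_nest: "cyls n \<precsim> cyls (Suc n)"
  unfolding coarser_def
proof
  fix Z assume "Z \<in> cyls (Suc n)"
  then obtain w where w: "w \<in> vert F (Suc n)" "Z = cyl (Suc n) w" by (auto simp: cyls_def)
  show "\<exists>W \<in> cyls n. Z \<subseteq> W"
    unfolding cyls_def w(2)
    by (intro bexI[of _ "cyl n (b n w)"] cyl_parent imageI parent_vert[OF F w(1)])
qed

lemma small_cyls: "small_cells (path_topology F) cyls"
proof -
  have "small_cells (path_topology F) (\<lambda>n. cyls (Suc n))"
    using small_cells_generated[of "path_topology F" "\<lambda>n. cyls (Suc n)", OF clopen_partition_cyls cyls_nest]
      path_topology_cyls by blast
  then show ?thesis unfolding small_cells_def by meson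
qed

lemma small_cyl:
  assumes "openin (path_topology F) U" "x \<in> U"
  obtains n where "cyl n (vx x n) \<subseteq> U"
proof -
  obtain n Z where "Z \<in> cyls n" "x \<in> Z" "Z \<subseteq> U"
    using small_cyls assms unfolding small_cells_def by meson
  then show thesis by (intro that[of n]) (auto simp: cyls_def cyl_def)
qed

lemma separated_paths:
  assumes "x \<in> X" "y \<in> X" "x \<noteq> y"
  obtains n where "vx x n \<noteq> vx y n"
  using path_eqI[OF assms(1,2)] assms(3) by blast

lemma openin_cyl: "openin (path_topology F) (cyl n (vx x n))" if "x \<in> X"
  using clopen_partitionD(4)[OF clopen_partition_cyls] path(3)[OF that] by (auto simp: cyls_def)

lemma closedin_cyl: "closedin (path_topology F) (cyl n (vx x n))" if "x \<in> X"
  using clopen_partitionD(5)[OF clopen_partition_cyls] path(3)[OF that] by (auto simp: cyls_def)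

lemma Hausdorff_path: "Hausdorff_space (path_topology F)"
  unfolding Hausdorff_space_def topspace_path
proof (intro allI impI, elim conjE)
  fix x y assume xy: "x \<in> X" "y \<in> X" "x \<noteq> y"
  then obtain n where "vx x n \<noteq> vx y n" by (rule separated_paths)
  then show "\<exists>U V. openin (path_topology F) U \<and> openin (path_topology F) V \<and> x \<in> U \<and> y \<in> V \<and> disjnt U V"
    using openin_cyl[OF xy(1), of n] openin_cyl[OF xy(2), of n] xy
    by (intro exI[of _ "cyl n (vx x n)"] exI[of _ "cyl n (vx y n)"]) (auto simp: cyl_def disjnt_iff)
qed

text \<open>The path space is a closed subspace of a countable product of finite discrete spaces.\<close>

lemma compact_metrizable_path:
  "compact_space (path_topology F)" "metrizable_space (path_topology F)"
proof -
  define B where "B = product_topology (\<lambda>i. discrete_topology (blue_edges F i)) (UNIV :: nat set)"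
  have fin: "finite (blue_edges F i)" for i
    using bij_betw_finite[OF HDiag_bij[OF F, of Blue i]] HDiag_vert(1)[OF F] by simp
  have B: "compact_space B" "metrizable_space B"
    unfolding B_def by (simp_all add: compact_space_product_topology compact_space_discrete_topology fin
        metrizable_space_product_topology metrizable_space_discrete_topology)
  have proj: "continuous_map B (discrete_topology (blue_edges F i)) (\<lambda>x. x i)" for i
    unfolding B_def by (rule continuous_map_product_projection) simp
  have topB: "x \<in> topspace B \<longleftrightarrow> (\<forall>i. x i \<in> blue_edges F i)" for x
    by (auto simp: B_def PiE_iff)
  have clo: "closedin B {x \<in> topspace B. x i = e}" if "e \<in> blue_edges F i" for i e
    using closedin_continuous_map_preimage[OF proj[of i], of "{e}"] that by simp
  have "closedin B {x \<in> topspace B. rng F (x (Suc i)) = src F (x i)}" for i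
  proof -
    let ?R = "{(e, f). e \<in> blue_edges F i \<and> f \<in> blue_edges F (Suc i) \<and> rng F f = src F e}"
    have "{x \<in> topspace B. rng F (x (Suc i)) = src F (x i)} =
      (\<Union>(e, f)\<in>?R. {x \<in> topspace B. x i = e} \<inter> {x \<in> topspace B. x (Suc i) = f})"
      by (auto simp: topB)
    moreover have "finite ?R"
      by (rule finite_subset[of _ "blue_edges F i \<times> blue_edges F (Suc i)"]) (auto simp: fin)
    moreover have "closedin B (case p of (e, f) \<Rightarrow> {x \<in> topspace B. x i = e} \<inter> {x \<in> topspace B. x (Suc i) = f})"
      if "p \<in> ?R" for p
      using that clo by (auto intro!: closedin_Int)
    ultimately show ?thesis by (auto intro!: closedin_Union)
  qed
  then have "closedin B (\<Inter>i. {x \<in> topspace B. rng F (x (Suc i)) = src F (x i)})"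
    by (intro closedin_INT) auto
  moreover have "(\<Inter>i. {x \<in> topspace B. rng F (x (Suc i)) = src F (x i)}) = X"
    by (auto simp: topB path_space_def)
  ultimately have X: "closedin B X" by simp
  let ?S = "subtopology B X"
  have topS: "topspace ?S = X" using closedin_subset[OF X] by (simp add: topspace_subtopology inf.absorb2)
  have S: "compact_space ?S" "metrizable_space ?S"
    using closedin_compact_space[OF B(1) X] metrizable_space_subtopology[OF B(2)]
    by (simp_all add: compact_space_subtopology)
  have "homeomorphic_map ?S (path_topology F) (\<lambda>x. x)"
  proof (rule continuous_imp_homeomorphic_map[OF _ S(1) Hausdorff_path])
    show "continuous_map ?S (path_topology F) (\<lambda>x. x)"
      unfolding path_topology_cyls
    proof (rule continuous_on_generated_topo)
      fix U assume "U \<in> (\<Union>n. cyls (Suc n))"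
      then obtain n w where U: "U = cyl (Suc n) w" by (auto simp: cyls_def)
      have "openin ?S {x \<in> topspace ?S. x (Suc n) \<in> {e \<in> blue_edges F (Suc n). rng F e = w}}"
        by (rule openin_continuous_map_preimage[OF continuous_map_from_subtopology[OF proj]]) auto
      moreover have "{x \<in> topspace ?S. x (Suc n) \<in> {e \<in> blue_edges F (Suc n). rng F e = w}} = (\<lambda>x. x) -` U \<inter> topspace ?S"
        unfolding topS U using path(1) by (auto simp: cyl_def)
      ultimately show "openin ?S ((\<lambda>x. x) -` U \<inter> topspace ?S)" by simp
    next
      have "\<Union>(\<Union>n. cyls (Suc n)) = X"
        using topspace_path unfolding path_topology_cyls topology_generated_by_topspace .
      then show "(\<lambda>x. x) ` topspace ?S \<subseteq> \<Union>(\<Union>n. cyls (Suc n))" using topS by simp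
    qed
  qed (simp_all only: topS topspace_path image_ident inj_on_id2)
  then have "?S homeomorphic_space path_topology F"
    by (rule homeomorphic_map_imp_homeomorphic_space)
  then show "compact_space (path_topology F)" "metrizable_space (path_topology F)"
    using S homeomorphic_compact_space homeomorphic_metrizable_space by blast+
qed

lemma totally_disconnected_path: "totally_disconnected_space (path_topology F)"
  unfolding totally_disconnected_space_def
proof (intro allI impI)
  fix C assume C: "connectedin (path_topology F) C"
  have "x = y" if "x \<in> C" "y \<in> C" for x y
  proof (rule ccontr)
    have xy: "x \<in> X" "y \<in> X" using that connectedin_subset_topspace[OF C] topspace_path by auto
    assume "x \<noteq> y"
    with xy obtain n where n: "vx x n \<noteq> vx y n" by (rule separated_paths)
    have "C \<subseteq> cyl n (vx x n) \<or> disjnt C (cyl n (vx x n))"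
      using connectedin_clopen_cases[OF C closedin_cyl[OF xy(1)] openin_cyl[OF xy(1)]] .
    with that n xy show False by (auto simp: cyl_def disjnt_iff)
  qed
  then show "\<exists>a. C \<subseteq> {a}" by (metis subsetI insertCI)
qed


text \<open>In terms of vertices the map of Construction II is the red parent map from every level
  \<open>2 * j + 2\<close> to the level below. The rombs express this, and condition (c) makes the resulting
  vertices on the odd levels a path.\<close>

lemma red_path:
  assumes x: "x \<in> X"
  obtains y where "y \<in> X" "\<And>j. vx y (Suc (2 * j)) = \<rho> (Suc (2 * j)) (vx x (Suc (Suc (2 * j))))"
proof (rule path_through_odd[of "\<lambda>j. \<rho> (Suc (2 * j)) (vx x (Suc (Suc (2 * j))))"])
  show "\<rho> (Suc (2 * j)) (vx x (Suc (Suc (2 * j)))) \<in> vert F (Suc (2 * j))" for j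
    by (rule parent_vert[OF F path(3)[OF x]])
  fix j
  show "b (Suc (2 * j)) (b (Suc (Suc (2 * j))) (\<rho> (Suc (2 * Suc j)) (vx x (Suc (Suc (2 * Suc j)))))) =
    \<rho> (Suc (2 * j)) (vx x (Suc (Suc (2 * j))))"
    using parent_commute[OF F path(3)[OF x]] by (simp add: path(4)[OF x])
qed (use that in blast)

lemma path_map_rel_red_path:
  assumes x: "x \<in> X" and y: "y \<in> X"
    and red: "\<And>j. vx y (Suc (2 * j)) = \<rho> (Suc (2 * j)) (vx x (Suc (Suc (2 * j))))"
  shows "path_map_rel F x y"
proof -
  define f where "f n = parent_edge F Red n (if even n then vx y (Suc n) else vx x (Suc n))" for n
  have f: "f n \<in> red_edges F n" "src F (f n) = (if even n then vx y (Suc n) else vx x (Suc n))" for n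
    using parent_edge[OF F, of "if even n then vx y (Suc n) else vx x (Suc n)" n Red]
      path(3)[OF x] path(3)[OF y] by (auto simp: f_def)
  have fo: "rng F (f (Suc (2 * j))) = vx y (Suc (2 * j))" for j
    by (simp add: red f_def parent_def)
  have fe: "rng F (f (2 * j)) = vx x (2 * j)" for j
  proof -
    have "rng F (f (2 * j)) = \<rho> (2 * j) (vx y (Suc (2 * j)))" by (simp add: f_def parent_def)
    also have "\<dots> = b (2 * j) (b (Suc (2 * j)) (vx x (Suc (Suc (2 * j)))))"
      using parent_parent[OF F path(3)[OF x]] by (simp add: red)
    also have "\<dots> = vx x (2 * j)" by (simp add: path(4)[OF x])
    finally show ?thesis .
  qed
  show ?thesis
    unfolding path_map_rel_def
  proof (intro exI[of _ f] conjI allI impI)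
    show "romb F (x (2 * j)) (x (2 * j + 1)) (f (2 * j)) (f (2 * j + 1))" for j
      unfolding romb_def using path(1,2)[OF x] f fe fo by auto
    fix j :: nat assume "1 \<le> j"
    then obtain i where j: "j = Suc i" by (cases j) auto
    show "romb F (y (2 * j - 1)) (y (2 * j)) (f (2 * j - 1)) (f (2 * j))"
      unfolding romb_def using path(1,2)[OF y] f fo fe[of j] by (auto simp: j)
  qed (use path(1,2)[OF y] in auto)
qed

lemma level_unique: "v \<in> vert F m \<Longrightarrow> v \<in> vert F n \<Longrightarrow> m = n"
  using disjoint_familyD[OF HDiag_vert(3)[OF F]] by metis

text \<open>The rombs do not mention levels. The levels of all edges involved, and with them the vertices of
  the image path, are found along the chain of rombs because different levels are disjoint.\<close>

lemma path_map_rel_imp_red_path: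
  assumes x: "x \<in> X" and rel: "path_map_rel F x z"
  shows "z \<in> X" "vx z (Suc (2 * j)) = \<rho> (Suc (2 * j)) (vx x (Suc (Suc (2 * j))))"
proof -
  obtain f where r1: "\<And>j. romb F (x (2 * j)) (x (2 * j + 1)) (f (2 * j)) (f (2 * j + 1))"
    and r2: "\<And>j. j \<ge> 1 \<Longrightarrow> romb F (z (2 * j - 1)) (z (2 * j)) (f (2 * j - 1)) (f (2 * j))"
    and z0: "z 0 \<in> (\<Union>n. blue_edges F n)" "src F (z 0) = rng F (z 1)"
    using rel unfolding path_map_rel_def by blast
  have blue_lev: "e \<in> blue_edges F n" if "e \<in> (\<Union>n. blue_edges F n)" "rng F e \<in> vert F n" for e n
    using that blue_edge(1) level_unique by blast
  have red_lev: "e \<in> red_edges F n" if "e \<in> (\<Union>n. red_edges F n)" "rng F e \<in> vert F n" for e n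
    using that red_edge(1) level_unique by blast
  have fe: "f (2 * j) \<in> red_edges F (2 * j)" for j
    using r1[of j] path(3)[OF x, of "2 * j"] by (intro red_lev) (auto simp: romb_def)
  have fo: "f (Suc (2 * j)) \<in> red_edges F (Suc (2 * j))" for j
    using r1[of j] red_edge(2)[OF fe[of j]] by (intro red_lev) (auto simp: romb_def)
  have fo_rng: "rng F (f (Suc (2 * j))) = \<rho> (Suc (2 * j)) (vx x (Suc (Suc (2 * j))))" for j
    using r1[of j] red_edge(3)[OF fo[of j]] path(2)[OF x, of "Suc (2 * j)"] by (simp add: romb_def)
  have fe_src: "src F (f (2 * j)) = rng F (f (Suc (2 * j)))" for j
    using r1[of j] by (simp add: romb_def)
  have r2': "romb F (z (Suc (2 * j))) (z (Suc (Suc (2 * j)))) (f (Suc (2 * j))) (f (Suc (Suc (2 * j))))" for j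
    using r2[of "Suc j"] by simp
  have zo_rng: "vx z (Suc (2 * j)) = rng F (f (Suc (2 * j)))" for j
    using r2'[of j] by (simp add: romb_def)
  have zo: "z (Suc (2 * j)) \<in> blue_edges F (Suc (2 * j))" for j
    using r2'[of j] red_edge(1)[OF fo[of j]] by (intro blue_lev) (auto simp: romb_def)
  have zo_src: "src F (z (Suc (2 * j))) = vx z (Suc (Suc (2 * j)))" for j
    using r2'[of j] by (simp add: romb_def)
  have ze: "z (Suc (Suc (2 * j))) \<in> blue_edges F (Suc (Suc (2 * j)))" for j
    using r2'[of j] blue_edge(2)[OF zo[of j]] by (intro blue_lev) (auto simp: romb_def)
  have ze_src: "src F (z (Suc (Suc (2 * j)))) = vx z (Suc (Suc (Suc (2 * j))))" for j
    using r2'[of j] fe_src[of "Suc j"] zo_rng[of "Suc j"] by (simp add: romb_def)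
  have z0': "z 0 \<in> blue_edges F 0"
  proof -
    obtain k where k: "z 0 \<in> blue_edges F k" using z0(1) by blast
    have "src F (z 0) \<in> vert F (Suc 0)" using z0(2) blue_edge(1)[OF zo[of 0]] by simp
    with blue_edge(2)[OF k] have "Suc k = Suc 0" by (rule level_unique)
    with k show ?thesis by simp
  qed
  have "z n \<in> blue_edges F n \<and> vx z (Suc n) = src F (z n)" for n
  proof (cases n)
    case 0
    then show ?thesis using z0' z0(2) by simp
  next
    case (Suc k)
    show ?thesis
    proof (cases "even k")
      case True
      then obtain j where "k = 2 * j" by (elim evenE)
      then show ?thesis using zo[of j] zo_src[of j] Suc by simp
    next
      case False
      then obtain j where "k = Suc (2 * j)" by (auto elim: oddE)
      then show ?thesis using ze[of j] ze_src[of j] Suc by simp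
    qed
  qed
  then show "z \<in> X" by (simp add: path_space_def)
  show "vx z (Suc (2 * j)) = \<rho> (Suc (2 * j)) (vx x (Suc (Suc (2 * j))))"
    using zo_rng fo_rng by simp
qed

lemma path_eqI_odd:
  assumes "x \<in> X" "y \<in> X" "\<And>j. vx x (Suc (2 * j)) = vx y (Suc (2 * j))"
  shows "x = y"
proof (rule path_eqI[OF assms(1,2)])
  show "\<exists>m\<ge>n. vx x m = vx y m" for n using assms(3)[of n] by (intro exI[of _ "Suc (2 * n)"]) simp
qed

lemma path_eqI_even:
  assumes "x \<in> X" "y \<in> X" "\<And>j. vx x (2 * j) = vx y (2 * j)"
  shows "x = y"
proof (rule path_eqI[OF assms(1,2)])
  show "\<exists>m\<ge>n. vx x m = vx y m" for n using assms(3)[of n] by (intro exI[of _ "2 * n"]) simp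
qed

lemma path_map:
  assumes x: "x \<in> X"
  shows "path_map F x \<in> X" "vx (path_map F x) (Suc (2 * j)) = \<rho> (Suc (2 * j)) (vx x (Suc (Suc (2 * j))))"
proof -
  obtain y where y: "y \<in> X" "\<And>j. vx y (Suc (2 * j)) = \<rho> (Suc (2 * j)) (vx x (Suc (Suc (2 * j))))"
    by (rule red_path[OF x]) (rule that, blast+)
  have "path_map F x = y"
    unfolding path_map_def
  proof (rule the_equality)
    show "path_map_rel F x y" by (rule path_map_rel_red_path[OF x y])
    fix z assume "path_map_rel F x z"
    note z = path_map_rel_imp_red_path[OF x this]
    show "z = y" by (rule path_eqI_odd[OF z(1) y(1)]) (simp add: z(2) y(2))
  qed
  with y show "path_map F x \<in> X" "vx (path_map F x) (Suc (2 * j)) = \<rho> (Suc (2 * j)) (vx x (Suc (Suc (2 * j))))"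
    by simp_all
qed

text \<open>The inverse of the path map has the same form, with the roles of even and odd levels exchanged.\<close>

lemma path_map_even:
  assumes x: "x \<in> X"
  shows "\<rho> (2 * j) (vx (path_map F x) (Suc (2 * j))) = vx x (2 * j)"
  using parent_parent[OF F path(3)[OF x, of "Suc (Suc (2 * j))"]] path(4)[OF x]
  by (simp add: path_map(2)[OF x])

lemma path_map_continuous: "continuous_map (path_topology F) (path_topology F) (path_map F)"
  unfolding continuous_map_def topspace_path
proof (intro conjI allI impI)
  show "path_map F \<in> X \<rightarrow> X" using path_map(1) by blast
  fix U assume U: "openin (path_topology F) U"
  show "openin (path_topology F) {x \<in> X. path_map F x \<in> U}"
  proof (subst openin_subopen, intro ballI)
    fix x assume "x \<in> {x \<in> X. path_map F x \<in> U}"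
    then have x: "x \<in> X" "path_map F x \<in> U" by auto
    obtain n where n: "cyl n (vx (path_map F x) n) \<subseteq> U" using small_cyl[OF U x(2)] .
    let ?k = "Suc (Suc (2 * n))"
    have "cyl ?k (vx x ?k) \<subseteq> {x \<in> X. path_map F x \<in> U}"
    proof
      fix x' assume "x' \<in> cyl ?k (vx x ?k)"
      then have x': "x' \<in> X" "vx x' ?k = vx x ?k" by (auto simp: cyl_def)
      then have "vx (path_map F x') (Suc (2 * n)) = vx (path_map F x) (Suc (2 * n))"
        by (simp add: path_map(2) x(1))
      then have "vx (path_map F x') n = vx (path_map F x) n"
        by (rule path_agree[OF path_map(1)[OF x'(1)] path_map(1)[OF x(1)]]) simp
      then have "path_map F x' \<in> cyl n (vx (path_map F x) n)"
        using path_map(1)[OF x'(1)] by (simp add: cyl_def)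
      with n x'(1) show "x' \<in> {x \<in> X. path_map F x \<in> U}" by blast
    qed
    moreover have "x \<in> cyl ?k (vx x ?k)" using x(1) by (simp add: cyl_def)
    ultimately show "\<exists>T. openin (path_topology F) T \<and> x \<in> T \<and> T \<subseteq> {x \<in> X. path_map F x \<in> U}"
      using openin_cyl[OF x(1), of ?k] by blast
  qed
qed

lemma path_map_homeomorphic: "homeomorphic_map (path_topology F) (path_topology F) (path_map F)"
proof (rule continuous_imp_homeomorphic_map[OF path_map_continuous compact_metrizable_path(1) Hausdorff_path])
  show "inj_on (path_map F) (topspace (path_topology F))"
    unfolding topspace_path
  proof (rule inj_onI)
    fix x x' assume x: "x \<in> X" "x' \<in> X" and eq: "path_map F x = path_map F x'"
    show "x = x'"
    proof (rule path_eqI_even[OF x])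
      show "vx x (2 * j) = vx x' (2 * j)" for j
        using path_map_even[OF x(1), of j] path_map_even[OF x(2), of j] eq by simp
    qed
  qed
  show "path_map F ` topspace (path_topology F) = topspace (path_topology F)"
    unfolding topspace_path
  proof (intro equalityI subsetI)
    fix y assume y: "y \<in> X"
    obtain x where x: "x \<in> X" "\<And>j. vx x (2 * j) = \<rho> (2 * j) (vx y (Suc (2 * j)))"
    proof (rule path_through_even[of "\<lambda>j. \<rho> (2 * j) (vx y (Suc (2 * j)))"])
      show "\<rho> (2 * j) (vx y (Suc (2 * j))) \<in> vert F (2 * j)" for j
        by (rule parent_vert[OF F path(3)[OF y]])
      show "b (2 * j) (b (Suc (2 * j)) (\<rho> (2 * Suc j) (vx y (Suc (2 * Suc j))))) = \<rho> (2 * j) (vx y (Suc (2 * j)))" for j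
        using parent_commute[OF F path(3)[OF y]] by (simp add: path(4)[OF y])
    qed blast
    have "path_map F x = y"
    proof (rule path_eqI_odd[OF path_map(1)[OF x(1)] y])
      fix j
      have "vx x (Suc (Suc (2 * j))) = \<rho> (Suc (Suc (2 * j))) (vx y (Suc (Suc (Suc (2 * j)))))"
        using x(2)[of "Suc j"] by simp
      then show "vx (path_map F x) (Suc (2 * j)) = vx y (Suc (2 * j))"
        using parent_parent[OF F path(3)[OF y, of "Suc (Suc (Suc (2 * j)))"]] path(4)[OF y]
        by (simp add: path_map(2)[OF x(1)])
    qed
    with x(1) show "y \<in> path_map F ` X" by blast
  qed (use path_map(1) in auto)
qed

lemma construction_II_Homeo: "(path_topology F, path_map F) \<in> Homeo"
proof -
  obtain v where "v \<in> vert F 0" using HDiag_vert(2)[OF F, of 0] by blast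
  from cyl_nonempty[OF this] have "X \<noteq> {}" by (auto simp: cyl_def)
  then show ?thesis
    unfolding Homeo_def mem_Collect_eq prod.case topspace_path
    using totally_disconnected_path compact_metrizable_path path_map_homeomorphic by blast
qed

text \<open>The twist carries red parents to images of cylinders, just as inclusion does for blue parents.
  This makes the cylinders a refined sequence, and it identifies the diagram of this sequence with
  the original one.\<close>

lemma cyl_twist:
  assumes w: "w \<in> vert F (Suc n)"
  shows "cyl (Suc n) w \<subseteq> colour_map (path_topology F, path_map F) c n ` cyl n (parent F c n w)"
proof (cases c)
  case Blue
  then show ?thesis using cyl_parent by simp
next
  case Red
  note bij = HomeoD(7)[OF construction_II_Homeo, unfolded topspace_path]
  show ?thesis
  proof
    fix y assume "y \<in> cyl (Suc n) w"
    then have y: "y \<in> X" "vx y (Suc n) = w" by (auto simp: cyl_def)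
    show "y \<in> colour_map (path_topology F, path_map F) c n ` cyl n (parent F c n w)"
    proof (cases "even n")
      case True
      then obtain j where j: "n = 2 * j" by (elim evenE)
      have "y \<in> path_map F ` X" using bij_betw_imp_surj_on[OF bij] y(1) by simp
      then obtain x where x: "x \<in> X" "path_map F x = y" by auto
      then have "vx x n = \<rho> n w" using path_map_even[OF x(1), of j] y(2) by (simp add: j)
      then have "x \<in> cyl n (\<rho> n w)" using x(1) by (simp add: cyl_def)
      then show ?thesis using x(2) True Red by (auto simp: twist_def)
    next
      case False
      then obtain j where j: "n = Suc (2 * j)" by (auto elim: oddE)
      have "path_map F y \<in> cyl n (\<rho> n w)"
        using path_map(1)[OF y(1)] path_map(2)[OF y(1), of j] y(2) by (simp add: cyl_def j)
      moreover have "inv_into X (path_map F) (path_map F y) = y"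
        by (rule bij_betw_inv_into_left[OF bij y(1)])
      ultimately show ?thesis
        using False Red by (auto simp: twist_def topspace_path intro!: image_eqI[of _ _ "path_map F y"])
    qed
  qed
qed

lemma refined_system_cyls: "refined_system (path_topology F) (path_map F) cyls"
proof -
  let ?S = "(path_topology F, path_map F)"
  have "refined_seq ?S cyls"
    unfolding refined_seq_iff[OF construction_II_Homeo]
  proof (intro conjI allI)
    fix n
    have "(`) (twist ?S n) ` cyls n \<precsim> cyls (Suc n)"
      unfolding coarser_def
    proof
      fix Z assume "Z \<in> cyls (Suc n)"
      then obtain w where w: "w \<in> vert F (Suc n)" "Z = cyl (Suc n) w" by (auto simp: cyls_def)
      have "cyl n (\<rho> n w) \<in> cyls n" using parent_vert[OF F w(1)] by (simp add: cyls_def)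
      moreover have "Z \<subseteq> twist ?S n ` cyl n (\<rho> n w)" using cyl_twist[OF w(1), of Red] w(2) by simp
      ultimately show "\<exists>W \<in> (`) (twist ?S n) ` cyls n. Z \<subseteq> W" by blast
    qed
    moreover have "{} \<notin> cyls (Suc n)" using clopen_partitionD(3)[OF clopen_partition_cyls] by blast
    ultimately show "join (cyls n) ((`) (twist ?S n) ` cyls n) \<precsim> cyls (Suc n)"
      by (intro coarser_joinI cyls_nest)
  qed (simp_all add: clopen_partition_cyls small_cyls)
  then show ?thesis using construction_II_Homeo by unfold_locales
qed

lemma iso_construction_I_II: "F \<cong>h construction_I (path_topology F, path_map F) cyls"
proof -
  interpret R: refined_system "path_topology F" "path_map F" cyls by (rule refined_system_cyls)
  have "level_iso F R.D (\<lambda>n v. (n, cyl n v))"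
    unfolding level_iso_def
  proof (intro allI conjI ballI)
    show "bij_betw (\<lambda>v. (n, cyl n v)) (vert F n) (vert R.D n)" for n
      using cyl_inj by (auto simp: bij_betw_def inj_on_def R.D_simps cyls_def)
    fix n c w assume w: "w \<in> vert F (Suc n)"
    show "(n, cyl n (parent F c n w)) = parent R.D c n (Suc n, cyl (Suc n) w)"
      using R.parent_D[of "cyl (Suc n) w" n "cyl n (parent F c n w)" c] cyl_twist[OF w]
        parent_vert[OF F w] w by (simp add: cyls_def)
  qed
  then show ?thesis by (rule iso_if_level_iso[OF F R.D_HDiag])
qed

end

section \<open>Invariance of Construction II\<close>

lemma top_conj_refl: "S \<sim>tc S"
  unfolding top_conj_def by (auto simp: homeomorphic_map_id[unfolded id_def] intro!: exI[of _ "\<lambda>x. x"])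

lemma top_conj_sym:
  assumes S: "S \<in> Homeo" and conj: "S \<sim>tc T"
  shows "T \<sim>tc S"
proof -
  obtain X \<phi> Y \<psi> where ST: "S = (X, \<phi>)" "T = (Y, \<psi>)" by (metis surj_pair)
  obtain h where h: "homeomorphic_map X Y h" "\<And>x. x \<in> topspace X \<Longrightarrow> h (\<phi> x) = \<psi> (h x)"
    using conj by (auto simp: ST top_conj_def)
  let ?g = "inv_into (topspace X) h"
  have bij: "bij_betw h (topspace X) (topspace Y)"
    using homeomorphic_imp_injective_map[OF h(1)] homeomorphic_imp_surjective_map[OF h(1)]
    by (simp add: bij_betw_def)
  have "?g (\<psi> y) = \<phi> (?g y)" if y: "y \<in> topspace Y" for y
  proof -
    have x: "?g y \<in> topspace X" "h (?g y) = y"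
      using bij_betwE[OF bij_betw_inv_into[OF bij]] bij_betw_inv_into_right[OF bij] y by auto
    have "\<phi> (?g y) \<in> topspace X"
      using bij_betwE[OF HomeoD(7)[OF S[unfolded ST]]] x(1) by blast
    then have "?g (h (\<phi> (?g y))) = \<phi> (?g y)" by (rule bij_betw_inv_into_left[OF bij])
    then show ?thesis using h(2)[OF x(1)] x(2) by simp
  qed
  then show ?thesis
    using homeomorphic_map_inv_into[OF h(1)] by (auto simp: ST top_conj_def)
qed

lemma top_conj_trans:
  assumes "S \<sim>tc T" "T \<sim>tc U"
  shows "S \<sim>tc U"
proof -
  obtain X \<phi> Y \<psi> Z \<theta> where STU: "S = (X, \<phi>)" "T = (Y, \<psi>)" "U = (Z, \<theta>)" by (metis surj_pair)
  obtain h where h: "homeomorphic_map X Y h" "\<forall>x \<in> topspace X. h (\<phi> x) = \<psi> (h x)"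
    using assms(1) by (auto simp: STU top_conj_def)
  obtain g where g: "homeomorphic_map Y Z g" "\<forall>x \<in> topspace Y. g (\<psi> x) = \<theta> (g x)"
    using assms(2) by (auto simp: STU top_conj_def)
  have "h x \<in> topspace Y" if "x \<in> topspace X" for x
    using homeomorphic_imp_surjective_map[OF h(1)] that by (metis imageI)
  then have "\<forall>x \<in> topspace X. (g \<circ> h) (\<phi> x) = \<theta> ((g \<circ> h) x)" using h(2) g(2) by simp
  then show ?thesis
    using homeomorphic_map_compose[OF h(1) g(1)] by (auto simp: STU top_conj_def)
qed

lemma construction_II_in_Homeo: "F \<in> HDiag \<Longrightarrow> construction_II F \<in> Homeo"
  using h_diagram.construction_II_Homeo h_diagram.intro unfolding construction_II_def by blast

text \<open>Each system has a refined sequence with the given diagram, so the two sequences have isomorphic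
  diagrams.\<close>

lemma top_conj_if_iso:
  assumes F: "F \<in> HDiag" and G: "G \<in> HDiag" and iso: "F \<cong>h G"
  shows "construction_II F \<sim>tc construction_II G"
proof -
  interpret F: h_diagram F by unfold_locales (rule F)
  interpret G: h_diagram G by unfold_locales (rule G)
  interpret RF: refined_system "path_topology F" "path_map F" F.cyls by (rule F.refined_system_cyls)
  interpret RG: refined_system "path_topology G" "path_map G" G.cyls by (rule G.refined_system_cyls)
  have "RF.D \<cong>h G"
    using iso_trans[OF RF.D_HDiag F G iso_sym[OF F RF.D_HDiag F.iso_construction_I_II] iso] .
  then have "RF.D \<cong>h RG.D"
    using iso_trans[OF RF.D_HDiag G RG.D_HDiag _ G.iso_construction_I_II] by blast
  from conj_if_iso[OF F.refined_system_cyls G.refined_system_cyls this]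
  show ?thesis by (simp add: construction_II_def)
qed

text \<open>A contraction of the diagram of a refined sequence is the diagram of a subsequence, and this
  belongs to the same system.\<close>

lemma top_conj_contraction:
  assumes F: "F \<in> HDiag" and m: "contraction_seq m"
  shows "construction_II F \<sim>tc construction_II (contraction F m)"
proof -
  have C: "contraction F m \<in> HDiag" by (rule contraction_HDiag_parent(1)[OF F m])
  interpret F: h_diagram F by unfold_locales (rule F)
  interpret C: h_diagram "contraction F m" by unfold_locales (rule C)
  interpret RF: refined_system "path_topology F" "path_map F" F.cyls by (rule F.refined_system_cyls)
  interpret RC: refined_system "path_topology (contraction F m)" "path_map (contraction F m)" C.cyls
    by (rule C.refined_system_cyls)
  interpret RM: refined_system "path_topology F" "path_map F" "F.cyls \<circ> m" by (rule RF.refined_subseq[OF m])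
  have CR: "contraction RF.D m \<in> HDiag" by (rule contraction_HDiag_parent(1)[OF RF.D_HDiag m])
  have "contraction F m \<cong>h contraction RF.D m"
    by (rule contraction_cong_iso[OF F RF.D_HDiag m F.iso_construction_I_II])
  from iso_trans[OF C CR RM.D_HDiag this RF.contraction_subseq[OF m]]
  have "RM.D \<cong>h contraction F m" by (rule iso_sym[OF C RM.D_HDiag])
  from iso_trans[OF RM.D_HDiag C RC.D_HDiag this C.iso_construction_I_II]
  have "RM.D \<cong>h RC.D" .
  from conj_if_iso[OF RF.refined_subseq[OF m] C.refined_system_cyls this]
  show ?thesis by (simp add: construction_II_def)
qed

lemma top_conj_h_step:
  assumes "h_step F G"
  shows "construction_II F \<sim>tc construction_II G"
proof -
  have FG: "F \<in> HDiag" "G \<in> HDiag" using assms by (simp_all add: h_step_def)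
  consider "F \<cong>h G" | m where "contraction_seq m" "contraction F m \<cong>h G"
    using assms by (auto simp: h_step_def)
  then show ?thesis
  proof cases
    case 1
    then show ?thesis by (rule top_conj_if_iso[OF FG])
  next
    case 2
    from top_conj_if_iso[OF contraction_HDiag_parent(1)[OF FG(1) 2(1)] FG(2) 2(2)]
    show ?thesis by (rule top_conj_trans[OF top_conj_contraction[OF FG(1) 2(1)]])
  qed
qed

lemma top_conj_if_h_equiv:
  assumes "F \<sim>h G"
  shows "construction_II F \<sim>tc construction_II G"
proof -
  obtain F' G' where FG: "F \<in> HDiag" "G \<in> HDiag" "F' \<in> HDiag" "G' \<in> HDiag" "F \<cong>h F'"
    "equivclp h_step F' G'" "G' \<cong>h G" using assms unfolding h_equiv_def by blast
  from FG(6) have "construction_II F' \<sim>tc construction_II G'"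
  proof (induction rule: equivclp_induct)
    case base
    show ?case by (rule top_conj_refl)
  next
    case (step G H)
    have "construction_II G \<sim>tc construction_II H"
    proof (cases "h_step G H")
      case True
      then show ?thesis by (rule top_conj_h_step)
    next
      case False
      with step(2) have HG: "h_step H G" by blast
      then have "H \<in> HDiag" by (simp add: h_step_def)
      from top_conj_sym[OF construction_II_in_Homeo[OF this] top_conj_h_step[OF HG]]
      show ?thesis .
    qed
    with step(3) show ?case by (rule top_conj_trans)
  qed
  from top_conj_trans[OF top_conj_trans[OF top_conj_if_iso[OF FG(1,3,5)] this] top_conj_if_iso[OF FG(4,2,7)]]
  show ?thesis .
qed


section \<open>The correspondence\<close>

lemma refined_systemI: "(X, \<phi>) \<in> Homeo \<Longrightarrow> refined_seq (X, \<phi>) P \<Longrightarrow> refined_system X \<phi> P"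
  by unfold_locales

lemma construction_I_in_HDiag:
  assumes "S \<in> Homeo" "refined_seq S P"
  shows "construction_I S P \<in> HDiag"
  using assms refined_system.D_HDiag[OF refined_systemI] by (cases S) blast

lemma construction_II_I:
  assumes S: "S \<in> Homeo" and P: "refined_seq S P"
  shows "S \<sim>tc construction_II (construction_I S P)"
proof -
  obtain X \<phi> where XS: "S = (X, \<phi>)" by (cases S)
  interpret R: refined_system X \<phi> P using S P unfolding XS by (rule refined_systemI)
  interpret H: h_diagram R.D by unfold_locales (rule R.D_HDiag)
  from conj_if_iso[OF R.refined_system_axioms H.refined_system_cyls H.iso_construction_I_II]
  show ?thesis by (simp add: XS construction_II_def)
qed

lemma construction_I_cong:
  assumes "S \<in> Homeo" "refined_seq S P" "T \<in> Homeo" "refined_seq T Q" "S \<sim>tc T"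
  shows "construction_I S P \<sim>h construction_I T Q"
proof -
  obtain X \<phi> Y \<psi> where ST: "S = (X, \<phi>)" "T = (Y, \<psi>)" by (metis surj_pair)
  show ?thesis
    using assms h_equiv_if_conj[OF refined_systemI refined_systemI] unfolding ST by blast
qed

lemma construction_I_II:
  assumes F: "F \<in> HDiag" and T: "T \<in> Homeo" and conj: "construction_II F \<sim>tc T" and Q: "refined_seq T Q"
  shows "F \<sim>h construction_I T Q"
proof -
  interpret F: h_diagram F by unfold_locales (rule F)
  interpret R: refined_system "path_topology F" "path_map F" F.cyls by (rule F.refined_system_cyls)
  have "F \<sim>h R.D" by (rule h_equiv_if_iso[OF F R.D_HDiag F.iso_construction_I_II])
  moreover have "R.D \<sim>h construction_I T Q"
    using construction_I_cong[OF R.S R.refined T Q] conj by (simp add: construction_II_def)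
  ultimately show ?thesis by (rule h_equiv_trans)
qed

text \<open>Construction II of a diagram on natural numbers lives on sequences of natural numbers; applied to
  a copy of a diagram of \<open>S\<close> it gives back \<open>S\<close> up to conjugacy.\<close>

lemma usystem_copy:
  assumes S: "S \<in> Homeo"
  obtains U :: usystem where "U \<in> Homeo" "S \<sim>tc U"
proof -
  obtain P where P: "refined_seq S P" using S refined_seq_exists by (cases S) blast
  note D = construction_I_in_HDiag[OF S P]
  obtain N :: udiagram where N: "N \<in> HDiag" "construction_I S P \<cong>h N" using HDiag_nat_copy[OF D] .
  from top_conj_trans[OF construction_II_I[OF S P] top_conj_if_iso[OF D N]]
  show thesis by (rule that[OF construction_II_in_Homeo[OF N(1)]])
qed

lemma system_class_eq:
  assumes "S \<in> Homeo" "S \<sim>tc T"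
  shows "system_class S = system_class T"
  unfolding system_class_def
  using top_conj_trans[OF assms(2)] top_conj_trans[OF top_conj_sym[OF assms]]
  by (intro Collect_cong conj_cong refl iffI)

lemma diagram_class_eq:
  assumes "F \<sim>h G"
  shows "diagram_class F = diagram_class G"
  unfolding diagram_class_def
  using h_equiv_trans[OF assms] h_equiv_trans[OF h_equiv_sym[OF assms]]
  by (intro Collect_cong conj_cong refl iffI)

lemma Homeo_classes_eq: "Homeo_classes = system_class ` (Homeo :: usystem set)"
  unfolding Homeo_classes_def system_class_def quotient_def by auto

lemma HDiag_classes_eq: "HDiag_classes = diagram_class ` (HDiag :: udiagram set)"
  unfolding HDiag_classes_def diagram_class_def quotient_def by auto

lemma system_class_in: "S \<in> Homeo \<Longrightarrow> system_class S \<in> Homeo_classes"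
  by (metis Homeo_classes_eq usystem_copy imageI system_class_eq)

lemma diagram_class_in: "F \<in> HDiag \<Longrightarrow> diagram_class F \<in> HDiag_classes"
  by (metis HDiag_classes_eq HDiag_nat_copy imageI diagram_class_eq h_equiv_if_iso)

lemma class_map_I_eq:
  assumes S: "S \<in> Homeo" and P: "refined_seq S P"
  shows "class_map_I (system_class S) = diagram_class (construction_I S P)"
proof -
  have eq: "diagram_class (construction_I T Q) = diagram_class (construction_I S P)"
    if "T \<in> system_class S" "refined_seq T Q" for T Q
    using construction_I_cong[OF S P, of T Q] diagram_class_eq that by (auto simp: system_class_def)
  obtain U :: usystem where U: "U \<in> Homeo" "S \<sim>tc U" using usystem_copy[OF S] .
  obtain Q where Q: "refined_seq U Q" using U(1) refined_seq_exists by (cases U) blast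
  have "U \<in> system_class S" using U by (simp add: system_class_def)
  with eq Q show ?thesis unfolding class_map_I_def by blast
qed

lemma class_map_II_eq:
  assumes F: "F \<in> HDiag"
  shows "class_map_II (diagram_class F) = system_class (construction_II F)"
proof -
  have eq: "system_class (construction_II G) = system_class (construction_II F)"
    if "G \<in> diagram_class F" for G
    using that system_class_eq[OF construction_II_in_Homeo[OF F] top_conj_if_h_equiv]
    by (auto simp: diagram_class_def)
  obtain N :: udiagram where N: "N \<in> HDiag" "F \<cong>h N" using HDiag_nat_copy[OF F] .
  then have "N \<in> diagram_class F" using h_equiv_if_iso[OF F N] by (simp add: diagram_class_def)
  with eq show ?thesis unfolding class_map_II_def by blast
qed

lemma class_map_II_I: "\<S> \<in> Homeo_classes \<Longrightarrow> class_map_II (class_map_I \<S>) = \<S>"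
proof -
  assume "\<S> \<in> Homeo_classes"
  then obtain S :: usystem where S: "S \<in> Homeo" "\<S> = system_class S"
    unfolding Homeo_classes_eq by blast
  obtain P where P: "refined_seq S P" using S(1) refined_seq_exists by (cases S) blast
  show ?thesis
    unfolding S(2) class_map_I_eq[OF S(1) P] class_map_II_eq[OF construction_I_in_HDiag[OF S(1) P]]
    by (rule system_class_eq[OF S(1) construction_II_I[OF S(1) P], symmetric])
qed

lemma class_map_I_II: "\<F> \<in> HDiag_classes \<Longrightarrow> class_map_I (class_map_II \<F>) = \<F>"
proof -
  assume "\<F> \<in> HDiag_classes"
  then obtain F :: udiagram where F: "F \<in> HDiag" "\<F> = diagram_class F"
    unfolding HDiag_classes_eq by blast
  note T = construction_II_in_Homeo[OF F(1)]
  obtain P where P: "refined_seq (construction_II F) P"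
    using T refined_seq_exists by (cases "construction_II F") auto
  show ?thesis
    unfolding F(2) class_map_II_eq[OF F(1)] class_map_I_eq[OF T P]
    by (rule diagram_class_eq[OF construction_I_II[OF F(1) T top_conj_refl P], symmetric])
qed

theorem theorem1p2:
  shows
    "(\<forall>S \<in> (Homeo :: 'a system set).
        system_class S \<in> Homeo_classes \<and>
        (\<exists>P. refined_seq S P) \<and>
        (\<forall>P. refined_seq S P \<longrightarrow>
           construction_I S P \<in> HDiag \<and>
           class_map_I (system_class S) = diagram_class (construction_I S P))) \<and>
     (\<forall>F \<in> (HDiag :: ('v, 'e) diagram set).
        diagram_class F \<in> HDiag_classes \<and>
        construction_II F \<in> Homeo \<and>
        class_map_II (diagram_class F) = system_class (construction_II F)) \<and>
     bij_betw class_map_I Homeo_classes HDiag_classes \<and>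
     bij_betw class_map_II HDiag_classes Homeo_classes \<and>
     (\<forall>\<S> \<in> Homeo_classes. class_map_II (class_map_I \<S>) = \<S>) \<and>
     (\<forall>\<F> \<in> HDiag_classes. class_map_I (class_map_II \<F>) = \<F>)"
proof -
  have ex: "\<exists>P. refined_seq S P" if "S \<in> Homeo" for S :: "'b system"
    using that refined_seq_exists by (cases S) blast
  have I: "class_map_I \<S> \<in> HDiag_classes" if "\<S> \<in> Homeo_classes" for \<S>
    using that ex class_map_I_eq diagram_class_in[OF construction_I_in_HDiag]
    unfolding Homeo_classes_eq by (metis imageE)
  have II: "class_map_II \<F> \<in> Homeo_classes" if "\<F> \<in> HDiag_classes" for \<F>
    using that class_map_II_eq system_class_in[OF construction_II_in_Homeo]
    unfolding HDiag_classes_eq by (metis imageE)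
  have "bij_betw class_map_I Homeo_classes HDiag_classes"
    by (rule bij_betw_byWitness[of _ class_map_II]) (use class_map_II_I class_map_I_II I II in auto)
  moreover have "bij_betw class_map_II HDiag_classes Homeo_classes"
    by (rule bij_betw_byWitness[of _ class_map_I]) (use class_map_II_I class_map_I_II I II in auto)
  ultimately show ?thesis
    using system_class_in ex construction_I_in_HDiag class_map_I_eq diagram_class_in
      construction_II_in_Homeo class_map_II_eq class_map_II_I class_map_I_II by (intro conjI ballI allI impI)
qed

end
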